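(* Suppose Assumptions $(\mathbf{W^*})$ and $(\underline{\mathbf{B}})$ hold. Let $u$ be the function $u(x)=\liminf_{\alpha\uparrow1,\,y\to x}u_\alpha(y)$, $x\in\mathbb{X}$, and let $A^*(x)$, $A_*(x)$ be the associated sets of actions (all defined in the context). Then there exists a stationary policy $\phi$ satisfying $$\overline{w}+u(x)\ \ge\ c(x,\phi(x))+\int_{\mathbb{X}}u(y)\,q(dy|x,\phi(x)),\qquad x\in\mathbb{X}.\qquad( * )$$ Thus, for this policy $\phi$, the policy $\phi$ is average-cost optimal and $$w(x)=w^{\phi}(x)=\limsup_{\alpha\uparrow1}(1-\alpha)v_\alpha(x)=\overline{w}=w^*,\qquad x\in\mathbb{X}.$$ Furthermore, the following statements hold: (a) the function $u:\mathbb{X}\to[0,\infty)$ is lower semi-continuous; (b) the sets $A^*(x)$, $x\in\mathbb{X}$, are nonempty and satisfy: (b$_1$) the graph $\mathrm{Gr}(A^* )=\{(x,a):x\in\mathbb{X},\ a\in A^*(x)\}$ is a Borel subset of $\mathbb{X}\times\mathbb{A}$; (b$_2$) for each $x\in\mathbb{X}$ the set $A^*(x)$ is compact; (c) a stationary policy $\phi$ is average-cost optimal and satisfies $( * )$ if $\phi(x)\in A^*(x)$ for all $x\in\mathbb{X}$; (d) there exists a stationary policy $\phi$ with $\phi(x)\in A_*(x)\subseteq A^*(x)$ for all $x\in\mathbb{X}$; (e) if, in addition, Assumption $(\mathbf{Wu})$ holds, then the function $u$ is inf-compact on $\mathbb{X}$.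
   Context: **MDP.** The state space $\mathbb{X}$ and the action space $\mathbb{A}$ are Borel subsets of Polish spaces, with metrics $\rho$ and $\gamma$ respectively. For each $x\in\mathbb{X}$ a nonempty Borel set $A(x)\subseteq\mathbb{A}$ of available actions is given; $\mathrm{Gr}(A)=\{(x,a):x\in\mathbb{X},a\in A(x)\}$ is a Borel subset of $\mathbb{X}\times\mathbb{A}$, and there exists a Borel map $\phi:\mathbb{X}\to\mathbb{A}$ with $\phi(x)\in A(x)$ for all $x$. The one-step cost $c:\mathrm{Gr}(A)\to(-\infty,+\infty]$ is Borel and bounded below. The transition kernel $q$ is such that $q(\cdot|x,a)$ is a Borel probability measure on $\mathbb{X}$ for each $(x,a)$ and $q(B|\cdot,\cdot)$ is Borel on $\mathrm{Gr}(A)$ for each Borel $B\subseteq\mathbb{X}$. **Policies.** A policy $\pi=\{\pi_n\}_{n\ge0}$ is a sequence of regular transition probabilities $\pi_n$ from histories $h_n=(\xi_0,u_0,\dots,u_{n-1},\xi_n)\in(\mathbb{X}\times\mathbb{A})^n\times\mathbb{X}$ to $\mathbb{A}$ with $\pi_n(A(\xi_n)|h_n)=1$; $\Pi$ is the set of all policies. A stationary policy is a Borel map $\phi:\mathbb{X}\to\mathbb{A}$ with $\phi(x)\in A(x)$ for all $x$ (the action $\phi(\xi_n)$ is used at every time $n$). An initial state $x$ and a policy $\pi$ define a probability $P_x^\pi$ on trajectories $(\xi_0,u_0,\xi_1,u_1,\dots)$ with expectation $\mathbb{E}_x^\pi$. **Costs.** $v_{N,\alpha}^\pi(x)=\mathbb{E}_x^\pi\sum_{n=0}^{N-1}\alpha^n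 c(\xi_n,u_n)$ (with $\alpha^0=1$), $v_N^\pi=v_{N,1}^\pi$; for $\alpha\in[0,1)$, $v_\alpha^\pi(x)=\mathbb{E}_x^\pi\sum_{n=0}^{\infty}\alpha^n c(\xi_n,u_n)$; $w^\pi(x)=\limsup_{N\to\infty}\frac1N v_N^\pi(x)$. Optimal values: $v_\alpha(x)=\inf_{\pi\in\Pi}v_\alpha^\pi(x)$, $w(x)=\inf_{\pi\in\Pi}w^\pi(x)$. A policy $\pi$ is average-cost optimal if $w^\pi(x)=w(x)$ for all $x\in\mathbb{X}$. Set $w^*=\inf_{x\in\mathbb{X}}w(x)$ and, for $\alpha\in[0,1)$, $m_\alpha=\inf_{x\in\mathbb{X}}v_\alpha(x)$, $u_\alpha(x)=v_\alpha(x)-m_\alpha$, and $\underline{w}=\liminf_{\alpha\uparrow1}(1-\alpha)m_\alpha$, $\overline{w}=\limsup_{\alpha\uparrow1}(1-\alpha)m_\alpha$. **Semicontinuity.** An extended-real-valued function $f$ on a set $U$ is lower semi-continuous (resp. inf-compact) on $U$ if for every $\lambda\in\mathbb{R}$ the level set $\{y\in U:f(y)\le\lambda\}$ is closed in $U$ (resp. compact). **Assumption $(\mathbf{W^*})$:** (i) $c$ is lower semi-continuous and bounded below on $\mathrm{Gr}(A)$; (ii) if a sequence $\{x_n\}$ in $\mathbb{X}$ converges to $x\in\mathbb{X}$, then any sequence $\{a_n\}$ with $a_n\in A(x_n)$, such that $\{c(x_n,a_n)\}$ is bounded above, has a limit point (limit of a subsequence) $a\in A(x)$; (iii) $q(\cdot|x,a)$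 is weakly continuous in $(x,a)\in\mathrm{Gr}(A)$, i.e. $\int f(z)q(dz|x_k,a_k)\to\int f(z)q(dz|x,a)$ for every bounded continuous $f:\mathbb{X}\to\mathbb{R}$ whenever $(x_k,a_k)\to(x,a)$ in $\mathrm{Gr}(A)$. **Assumption $(\mathbf{Wu})$:** (i) $c$ is inf-compact on $\mathrm{Gr}(A)$; (ii) $q(\cdot|x,a)$ is weakly continuous in $(x,a)\in\mathrm{Gr}(A)$. **Assumption $(\underline{\mathbf{B}})$:** (i) $w^*<+\infty$; (ii) $\liminf_{\alpha\uparrow1}u_\alpha(x)<\infty$ for all $x\in\mathbb{X}$. **The function $u$ and the action sets.** $$u(x)=\liminf_{\alpha\uparrow1,\,y\to x}u_\alpha(y):=\sup_{\beta\in[0,1),\,R>0}\ \inf\{u_\alpha(y):\alpha\in[\beta,1),\ y\in\mathbb{X},\ \rho(y,x)<R\},$$ $$A^*(x)=\Big\{a\in A(x):\ \overline{w}+u(x)\ge c(x,a)+\int_{\mathbb{X}}u(y)q(dy|x,a)\Big\},$$ $$A_*(x)=\Big\{a\in A(x):\ \inf_{b\in A(x)}\Big[c(x,b)+\int_{\mathbb{X}}u(y)q(dy|x,b)\Big]=c(x,a)+\int_{\mathbb{X}}u(y)q(dy|x,a)\Big\}.$$ *)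

theory Defs
  imports "HOL-Probability.Probability"
begin

section \<open>Integration and semicontinuity of extended-real-valued functions\<close>

text \<open>Only used for functions whose negative part has a finite integral (with respect to a
  probability measure), so that the difference is never of the form \<open>\<infinity> - \<infinity>\<close>.\<close>

definition ext_integral :: "'b measure \<Rightarrow> ('b \<Rightarrow> ereal) \<Rightarrow> ereal" where
  "ext_integral M f =
     enn2ereal (\<integral>\<^sup>+ z. e2ennreal (f z) \<partial>M) - enn2ereal (\<integral>\<^sup>+ z. e2ennreal (- f z) \<partial>M)"

definition lower_semicontinuous_on :: "'b::topological_space set \<Rightarrow> ('b \<Rightarrow> ereal) \<Rightarrow> bool" where
  "lower_semicontinuous_on U f \<longleftrightarrow>
     (\<forall>l::real. closedin (top_of_set U) {y \<in> U. f y \<le> ereal l})"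

definition inf_compact_on :: "'b::topological_space set \<Rightarrow> ('b \<Rightarrow> ereal) \<Rightarrow> bool" where
  "inf_compact_on U f \<longleftrightarrow> (\<forall>l::real. compact {y \<in> U. f y \<le> ereal l})"

definition bounded_below_on :: "'b set \<Rightarrow> ('b \<Rightarrow> ereal) \<Rightarrow> bool" where
  "bounded_below_on U f \<longleftrightarrow> (\<exists>K::real. \<forall>y\<in>U. ereal K \<le> f y)"


section \<open>Markov decision processes\<close>

text \<open>The cost and the transition kernel are total functions, but only their values on the
  graph of the action correspondence matter.\<close>

record ('x, 'a) mdp =
  state_space :: "'x set"
  action_space :: "'a set"
  avail :: "'x \<Rightarrow> 'a set"
  cost :: "'x \<times> 'a \<Rightarrow> ereal"
  trans_kernel :: "'x \<times> 'a \<Rightarrow> 'x measure"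

definition Gr :: "'x set \<Rightarrow> ('x \<Rightarrow> 'a set) \<Rightarrow> ('x \<times> 'a) set" where
  "Gr X A = {(x, a). x \<in> X \<and> a \<in> A x}"

abbreviation graph :: "('x, 'a) mdp \<Rightarrow> ('x \<times> 'a) set" where
  "graph M \<equiv> Gr (state_space M) (avail M)"

definition state_borel :: "('x::polish_space, 'a) mdp \<Rightarrow> 'x measure" where
  "state_borel M = restrict_space borel (state_space M)"

definition action_borel :: "('x, 'a::polish_space) mdp \<Rightarrow> 'a measure" where
  "action_borel M = restrict_space borel (action_space M)"

definition step_borel :: "('x::polish_space, 'a::polish_space) mdp \<Rightarrow> ('x \<times> 'a) measure" where
  "step_borel M = state_borel M \<Otimes>\<^sub>M action_borel M"

definition stationary :: "('x::polish_space, 'a::polish_space) mdp \<Rightarrow> ('x \<Rightarrow> 'a) \<Rightarrow> bool" where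
  "stationary M \<phi> \<longleftrightarrow>
     \<phi> \<in> state_borel M \<rightarrow>\<^sub>M action_borel M \<and> (\<forall>x\<in>state_space M. \<phi> x \<in> avail M x)"

definition is_mdp :: "('x::polish_space, 'a::polish_space) mdp \<Rightarrow> bool" where
  "is_mdp M \<longleftrightarrow>
     state_space M \<in> sets borel \<and>
     action_space M \<in> sets borel \<and>
     (\<forall>x\<in>state_space M. avail M x \<noteq> {} \<and> avail M x \<in> sets (action_borel M)) \<and>
     graph M \<in> sets (restrict_space borel (state_space M \<times> action_space M)) \<and>
     (\<exists>\<phi>. stationary M \<phi>) \<and>
     cost M \<in> borel_measurable (restrict_space borel (graph M)) \<and>
     bounded_below_on (graph M) (cost M) \<and>
     trans_kernel M \<in> restrict_space borel (graph M) \<rightarrow>\<^sub>M prob_algebra (state_borel M)"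


section \<open>Policies and trajectories\<close>

text \<open>A history \<open>(\<xi>\<^sub>0, u\<^sub>0, \<dots>, u\<^sub>n\<^sub>-\<^sub>1, \<xi>\<^sub>n)\<close> is a pair \<open>(h, \<xi>\<^sub>n)\<close> with
  \<open>h i = (\<xi>\<^sub>i, u\<^sub>i)\<close> for \<open>i < n\<close>.\<close>

definition history_borel ::
    "('x::polish_space, 'a::polish_space) mdp \<Rightarrow> nat \<Rightarrow> ((nat \<Rightarrow> 'x \<times> 'a) \<times> 'x) measure" where
  "history_borel M n = (\<Pi>\<^sub>M i\<in>{0..<n}. step_borel M) \<Otimes>\<^sub>M state_borel M"

type_synonym ('x, 'a) policy = "nat \<Rightarrow> (nat \<Rightarrow> 'x \<times> 'a) \<times> 'x \<Rightarrow> 'a measure"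

definition policies :: "('x::polish_space, 'a::polish_space) mdp \<Rightarrow> ('x, 'a) policy set" where
  "policies M = {\<pi>. \<forall>n.
     \<pi> n \<in> history_borel M n \<rightarrow>\<^sub>M prob_algebra (action_borel M) \<and>
     (\<forall>(h, y)\<in>space (history_borel M n). emeasure (\<pi> n (h, y)) (avail M y) = 1)}"

definition stationary_policy ::
    "('x, 'a::polish_space) mdp \<Rightarrow> ('x \<Rightarrow> 'a) \<Rightarrow> ('x, 'a) policy" where
  "stationary_policy M \<phi> n = (\<lambda>(h, y). return (action_borel M) (\<phi> y))"

text \<open>The law of the next state given the steps so far. Off the graph, where the transition
  kernel is unconstrained, a Dirac measure is used to make this a kernel on all histories in
  \<open>(X \<times> A)\<^sup>n\<close>; under every policy such histories have probability zero.\<close>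

definition next_state ::
    "('x::polish_space, 'a::polish_space) mdp \<Rightarrow> 'x \<Rightarrow> nat \<Rightarrow> (nat \<Rightarrow> 'x \<times> 'a) \<Rightarrow> 'x measure" where
  "next_state M x n h =
     (case n of 0 \<Rightarrow> return (state_borel M) x
      | Suc k \<Rightarrow> if h k \<in> graph M then trans_kernel M (h k)
                else return (state_borel M) (fst (h k)))"

definition step_kernel ::
    "('x::polish_space, 'a::polish_space) mdp \<Rightarrow> ('x, 'a) policy \<Rightarrow> 'x \<Rightarrow>
      nat \<Rightarrow> (nat \<Rightarrow> 'x \<times> 'a) \<Rightarrow> ('x \<times> 'a) measure" where
  "step_kernel M \<pi> x n h =
     next_state M x n h \<bind> (\<lambda>y. distr (\<pi> n (h, y)) (step_borel M) (\<lambda>a. (y, a)))"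

text \<open>The measure on trajectories \<open>\<omega>\<close>, \<open>\<omega> n = (\<xi>\<^sub>n, u\<^sub>n)\<close>, given by the theorem of
  Ionescu Tulcea; the locale assumptions are verified below in
  \<open>Ionescu_Tulcea_step_kernel\<close>.\<close>

definition traj_measure ::
    "('x::polish_space, 'a::polish_space) mdp \<Rightarrow> ('x, 'a) policy \<Rightarrow> 'x \<Rightarrow>
      (nat \<Rightarrow> 'x \<times> 'a) measure" where
  "traj_measure M \<pi> x =
     projective_family.lim UNIV
       (Ionescu_Tulcea.CI (step_kernel M \<pi> x) (\<lambda>_. step_borel M)) (\<lambda>_. step_borel M)"

lemma step_borel_to_borel: "(\<lambda>p. p) \<in> step_borel M \<rightarrow>\<^sub>M borel"
proof -
  have "fst \<in> step_borel M \<rightarrow>\<^sub>M borel" "snd \<in> step_borel M \<rightarrow>\<^sub>M borel"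
    unfolding step_borel_def state_borel_def action_borel_def
    by (rule measurable_compose[OF measurable_fst] measurable_compose[OF measurable_snd],
        rule measurable_restrict_space1, simp)+
  then have "(\<lambda>p. (fst p, snd p)) \<in> step_borel M \<rightarrow>\<^sub>M borel \<Otimes>\<^sub>M borel"
    by (rule measurable_Pair)
  then show ?thesis
    by (simp add: borel_prod)
qed

lemma graph_in_step_borel:
  assumes M: "is_mdp M"
  shows "graph M \<in> sets (step_borel M)"
proof -
  have X: "state_space M \<times> action_space M \<in> sets borel"
    using M by (auto simp: is_mdp_def intro!: borel_Times)
  have G: "graph M \<in> sets borel" and sub: "graph M \<subseteq> state_space M \<times> action_space M"
    using M X by (auto simp: is_mdp_def sets_restrict_space)
  have "space (step_borel M) = state_space M \<times> action_space M"
    by (simp add: step_borel_def state_borel_def action_borel_def space_pair_measure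
        space_restrict_space)
  then show ?thesis
    using measurable_sets[OF step_borel_to_borel[of M] G] sub by (simp add: Int_absorb2)
qed

lemma measurable_next_state:
  assumes M: "is_mdp M" and x: "x \<in> state_space M"
  shows "next_state M x n \<in> (\<Pi>\<^sub>M i\<in>{0..<n}. step_borel M) \<rightarrow>\<^sub>M prob_algebra (state_borel M)"
proof (cases n)
  case 0
  have "return (state_borel M) x \<in> space (prob_algebra (state_borel M))"
    using x by (auto simp: space_prob_algebra state_borel_def space_restrict_space
        intro!: prob_space_return)
  then show ?thesis
    unfolding next_state_def 0 by simp
next
  case (Suc k)
  let ?H = "\<Pi>\<^sub>M i\<in>{0..<n}. step_borel M"
  have ext: "(\<lambda>p. if p \<in> graph M then trans_kernel M p else return (state_borel M) (fst p))
      \<in> step_borel M \<rightarrow>\<^sub>M prob_algebra (state_borel M)"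
  proof (rule measurable_If_restrict_space_iff[THEN iffD2], goal_cases)
    case 1
    have "{p \<in> space (step_borel M). p \<in> graph M} = graph M"
      using sets.sets_into_space[OF graph_in_step_borel[OF M]] by auto
    then show ?case
      using graph_in_step_borel[OF M] by simp
  next
    case 2
    have "(\<lambda>p. p) \<in> restrict_space (step_borel M) (graph M) \<rightarrow>\<^sub>M restrict_space borel (graph M)"
      by (intro measurable_restrict_space2 measurable_restrict_space1 step_borel_to_borel)
         (auto simp: space_restrict_space)
    moreover have "trans_kernel M \<in> restrict_space borel (graph M) \<rightarrow>\<^sub>M prob_algebra (state_borel M)"
      using M unfolding is_mdp_def by blast
    ultimately have "trans_kernel M \<in>
        restrict_space (step_borel M) (graph M) \<rightarrow>\<^sub>M prob_algebra (state_borel M)"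
      by (rule measurable_compose)
    moreover have "(\<lambda>p. return (state_borel M) (fst p)) \<in> step_borel M \<rightarrow>\<^sub>M prob_algebra (state_borel M)"
      unfolding step_borel_def
      by (rule measurable_compose[OF measurable_fst measurable_return_prob_space])
    ultimately show ?case
      by (auto intro: measurable_restrict_space1)
  qed
  have "(\<lambda>h. h k) \<in> ?H \<rightarrow>\<^sub>M step_borel M"
    using Suc by (intro measurable_component_singleton) simp
  from measurable_compose[OF this ext]
  have "(\<lambda>h. if h k \<in> graph M then trans_kernel M (h k) else return (state_borel M) (fst (h k)))
      \<in> ?H \<rightarrow>\<^sub>M prob_algebra (state_borel M)" .
  then show ?thesis
    by (simp only: next_state_def[abs_def] Suc nat.case)
qed

lemma Ionescu_Tulcea_step_kernel:
  assumes M: "is_mdp M" and pi: "\<pi> \<in> policies M" and x: "x \<in> state_space M"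
  shows "Ionescu_Tulcea (step_kernel M \<pi> x) (\<lambda>_. step_borel M)"
proof -
  have K: "step_kernel M \<pi> x n \<in> (\<Pi>\<^sub>M i\<in>{0..<n}. step_borel M) \<rightarrow>\<^sub>M prob_algebra (step_borel M)" for n
    unfolding step_kernel_def
  proof (rule measurable_bind_prob_space2[OF measurable_next_state[OF M x]])
    let ?H = "\<Pi>\<^sub>M i\<in>{0..<n}. step_borel M"
    have "\<pi> n \<in> ?H \<Otimes>\<^sub>M state_borel M \<rightarrow>\<^sub>M prob_algebra (action_borel M)"
      using pi by (simp add: policies_def history_borel_def)
    moreover have "(\<lambda>(p, a). (snd p, a)) \<in>
        (?H \<Otimes>\<^sub>M state_borel M) \<Otimes>\<^sub>M action_borel M \<rightarrow>\<^sub>M step_borel M"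
      unfolding step_borel_def case_prod_beta'
      by (intro measurable_Pair measurable_compose[OF measurable_fst measurable_snd] measurable_snd)
    ultimately have "(\<lambda>p. distr (\<pi> n p) (step_borel M) (\<lambda>a. (snd p, a)))
        \<in> ?H \<Otimes>\<^sub>M state_borel M \<rightarrow>\<^sub>M prob_algebra (step_borel M)"
      by (rule measurable_distr_prob_space2)
    then show "(\<lambda>(h, y). distr (\<pi> n (h, y)) (step_borel M) (Pair y))
        \<in> ?H \<Otimes>\<^sub>M state_borel M \<rightarrow>\<^sub>M prob_algebra (step_borel M)"
      by (simp add: case_prod_beta')
  qed
  show ?thesis
  proof (rule Ionescu_Tulcea.intro)
    fix n h
    show "step_kernel M \<pi> x n \<in>
        (\<Pi>\<^sub>M i\<in>{0..<n}. step_borel M) \<rightarrow>\<^sub>M subprob_algebra (step_borel M)"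
      by (rule measurable_prob_algebraD[OF K])
    assume "h \<in> space (\<Pi>\<^sub>M i\<in>{0..<n}. step_borel M)"
    from measurable_space[OF K this] show "prob_space (step_kernel M \<pi> x n h)"
      by (simp add: space_prob_algebra)
  qed
qed


section \<open>Costs and optimal values\<close>

definition finite_cost ::
    "('x::polish_space, 'a::polish_space) mdp \<Rightarrow> nat \<Rightarrow> real \<Rightarrow> ('x, 'a) policy \<Rightarrow> 'x \<Rightarrow> ereal" where
  "finite_cost M N \<alpha> \<pi> x =
     ext_integral (traj_measure M \<pi> x) (\<lambda>\<omega>. \<Sum>n<N. ereal (\<alpha> ^ n) * cost M (\<omega> n))"

definition discounted_cost ::
    "('x::polish_space, 'a::polish_space) mdp \<Rightarrow> real \<Rightarrow> ('x, 'a) policy \<Rightarrow> 'x \<Rightarrow> ereal" where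
  "discounted_cost M \<alpha> \<pi> x =
     ext_integral (traj_measure M \<pi> x) (\<lambda>\<omega>. \<Sum>n. ereal (\<alpha> ^ n) * cost M (\<omega> n))"

definition average_cost ::
    "('x::polish_space, 'a::polish_space) mdp \<Rightarrow> ('x, 'a) policy \<Rightarrow> 'x \<Rightarrow> ereal" where
  "average_cost M \<pi> x = limsup (\<lambda>N. ereal (1 / real N) * finite_cost M N 1 \<pi> x)"

definition opt_discounted :: "('x::polish_space, 'a::polish_space) mdp \<Rightarrow> real \<Rightarrow> 'x \<Rightarrow> ereal" where
  "opt_discounted M \<alpha> x = (INF \<pi>\<in>policies M. discounted_cost M \<alpha> \<pi> x)"

definition opt_average :: "('x::polish_space, 'a::polish_space) mdp \<Rightarrow> 'x \<Rightarrow> ereal" where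
  "opt_average M x = (INF \<pi>\<in>policies M. average_cost M \<pi> x)"

definition average_optimal ::
    "('x::polish_space, 'a::polish_space) mdp \<Rightarrow> ('x, 'a) policy \<Rightarrow> bool" where
  "average_optimal M \<pi> \<longleftrightarrow> (\<forall>x\<in>state_space M. average_cost M \<pi> x = opt_average M x)"

definition w_star :: "('x::polish_space, 'a::polish_space) mdp \<Rightarrow> ereal" where
  "w_star M = (INF x\<in>state_space M. opt_average M x)"

definition m_disc :: "('x::polish_space, 'a::polish_space) mdp \<Rightarrow> real \<Rightarrow> ereal" where
  "m_disc M \<alpha> = (INF x\<in>state_space M. opt_discounted M \<alpha> x)"

definition u_disc :: "('x::polish_space, 'a::polish_space) mdp \<Rightarrow> real \<Rightarrow> 'x \<Rightarrow> ereal" where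
  "u_disc M \<alpha> x = opt_discounted M \<alpha> x - m_disc M \<alpha>"

definition w_upper :: "('x::polish_space, 'a::polish_space) mdp \<Rightarrow> ereal" where
  "w_upper M = Limsup (at_left 1) (\<lambda>\<alpha>. ereal (1 - \<alpha>) * m_disc M \<alpha>)"


section \<open>Assumptions\<close>

definition weakly_continuous_kernel :: "('x::polish_space, 'a::polish_space) mdp \<Rightarrow> bool" where
  "weakly_continuous_kernel M \<longleftrightarrow>
     (\<forall>f :: 'x \<Rightarrow> real. continuous_on (state_space M) f \<longrightarrow> bounded (f ` state_space M) \<longrightarrow>
       (\<forall>p s. p \<in> graph M \<longrightarrow> (\<forall>k::nat. s k \<in> graph M) \<longrightarrow> s \<longlonglongrightarrow> p \<longrightarrow>
          (\<lambda>k. \<integral>z. f z \<partial>trans_kernel M (s k)) \<longlonglongrightarrow> (\<integral>z. f z \<partial>trans_kernel M p)))"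

definition assumption_W_star :: "('x::polish_space, 'a::polish_space) mdp \<Rightarrow> bool" where
  "assumption_W_star M \<longleftrightarrow>
     lower_semicontinuous_on (graph M) (cost M) \<and> bounded_below_on (graph M) (cost M) \<and>
     (\<forall>x xs as. x \<in> state_space M \<longrightarrow> (\<forall>n. xs n \<in> state_space M) \<longrightarrow> xs \<longlonglongrightarrow> x \<longrightarrow>
        (\<forall>n. as n \<in> avail M (xs n)) \<longrightarrow> (\<exists>K::real. \<forall>n. cost M (xs n, as n) \<le> ereal K) \<longrightarrow>
        (\<exists>a\<in>avail M x. \<exists>r::nat \<Rightarrow> nat. strict_mono r \<and> (as \<circ> r) \<longlonglongrightarrow> a)) \<and>
     weakly_continuous_kernel M"

definition assumption_Wu :: "('x::polish_space, 'a::polish_space) mdp \<Rightarrow> bool" where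
  "assumption_Wu M \<longleftrightarrow> inf_compact_on (graph M) (cost M) \<and> weakly_continuous_kernel M"

definition assumption_B :: "('x::polish_space, 'a::polish_space) mdp \<Rightarrow> bool" where
  "assumption_B M \<longleftrightarrow>
     w_star M < \<infinity> \<and> (\<forall>x\<in>state_space M. Liminf (at_left 1) (\<lambda>\<alpha>. u_disc M \<alpha> x) < \<infinity>)"


section \<open>The limit function and the action sets\<close>

definition u_lim :: "('x::polish_space, 'a::polish_space) mdp \<Rightarrow> 'x \<Rightarrow> ereal" where
  "u_lim M x =
     (SUP (\<beta>, R)\<in>{0..<1} \<times> {0<..}.
        INF (\<alpha>, y)\<in>{\<beta>..<1} \<times> {y \<in> state_space M. dist y x < R}. u_disc M \<alpha> y)"

definition acoi_rhs :: "('x::polish_space, 'a::polish_space) mdp \<Rightarrow> 'x \<Rightarrow> 'a \<Rightarrow> ereal" where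
  "acoi_rhs M x a = cost M (x, a) + ext_integral (trans_kernel M (x, a)) (u_lim M)"

definition A_upper :: "('x::polish_space, 'a::polish_space) mdp \<Rightarrow> 'x \<Rightarrow> 'a set" where
  "A_upper M x = {a \<in> avail M x. w_upper M + u_lim M x \<ge> acoi_rhs M x a}"

definition A_lower :: "('x::polish_space, 'a::polish_space) mdp \<Rightarrow> 'x \<Rightarrow> 'a set" where
  "A_lower M x = {a \<in> avail M x. (INF b\<in>avail M x. acoi_rhs M x b) = acoi_rhs M x a}"

definition acoi :: "('x::polish_space, 'a::polish_space) mdp \<Rightarrow> ('x \<Rightarrow> 'a) \<Rightarrow> bool" where
  "acoi M \<phi> \<longleftrightarrow> (\<forall>x\<in>state_space M. w_upper M + u_lim M x \<ge> acoi_rhs M x (\<phi> x))"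

end

theory Submission
  imports Defs
begin

text \<open>
  Write \<open>q\<close> for the transition kernel, \<open>m\<^sub>\<alpha>\<close> for the infimum of the \<open>\<alpha>\<close>-discounted value \<open>v\<^sub>\<alpha>\<close>
  and \<open>u\<^sub>\<alpha> = v\<^sub>\<alpha> - m\<^sub>\<alpha>\<close>. The heart of the matter is the optimality inequality: at every state \<open>x\<close> some
  action \<open>a\<close> satisfies \<open>c(x,a) + \<integral>u dq(x,a) \<le> w + u(x)\<close>, where \<open>w\<close> is the upper limit of
  \<open>(1 - \<alpha>) m\<^sub>\<alpha>\<close> (lemma \<open>average_cost_optimality_inequality\<close>). It comes from the discounted
  optimality inequality by letting \<open>\<alpha>\<close> tend to 1. Subtracting \<open>m\<^sub>\<alpha>\<close> turns the latter into
  \<open>c(y,a) + \<alpha> \<integral>u\<^sub>\<alpha> dq(y,a) \<le> u\<^sub>\<alpha>(y) + (1 - \<alpha>) m\<^sub>\<alpha>\<close>. Choose \<open>\<alpha>\<^sub>n \<rightarrow> 1\<close> and \<open>y\<^sub>n \<rightarrow> x\<close> along which the right-hand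
  sides stay below \<open>w + u(x) + \<epsilon>\<close>. Then the costs of the chosen actions are bounded, so the
  compactness part of Assumption (W*) yields a subsequence of actions that converges to some \<open>a\<close>
  available at \<open>x\<close>, and both terms on the left pass to the limit from below: the cost because it is lower
  semicontinuous, the integral by a Fatou lemma in which the measures converge weakly and
  the integrands vary (lemma \<open>Fatou_weak_convergence\<close>). That lemma reduces to monotone
  convergence once the integrands are replaced by bounded Lipschitz minorants, whose supremum
  is exactly the lower limit that defines \<open>u\<close>.

  The discounted optimality inequality, and the lower semicontinuity and hence measurability of
  \<open>v\<^sub>\<alpha>\<close>, are obtained by value iteration from \<open>0\<close>. Every iterate bounds the cost of an arbitrary
  policy over the same horizon from below, and the limit is attained by a stationary policy
  (lemma \<open>discounted_attains_V\<close>). Both this policy and the one asked for in the theorem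
  minimize a function of state and action that is lower semicontinuous and has the compactness
  property \<open>K_inf_compact\<close>; a Borel minimizer exists because the set of minimizers meets a closed set
  \<open>F\<close> exactly when the minimum over the actions in \<open>F\<close> equals the full minimum, and both minima
  are lower semicontinuous in the state (lemma \<open>measurable_minimizer\<close>).

  For a stationary policy that satisfies the optimality inequality, adding it up along the
  trajectory bounds the cost of \<open>N\<close> steps by \<open>u(x) + N w\<close>, so its average cost is at most \<open>w\<close>.
  Conversely, Abel means are asymptotically dominated by Cesaro means
  (lemma \<open>Limsup_Abel_le_Cesaro\<close>), so
  \<open>w \<le> limsup (1 - \<alpha>) v\<^sub>\<alpha>(x)\<close>, and this upper limit is at most the average cost of every policy at
  \<open>x\<close>. Hence all the quantities in the theorem coincide.

  A cost bounded below by \<open>K\<close> is a nonnegative cost plus \<open>K\<close>. Everything above is carried out for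
  the nonnegative cost, with values in \<^typ>\<open>ennreal\<close>; the last part translates the results back to
  extended-real-valued costs.
\<close>

section \<open>Lower semicontinuity\<close>

text \<open>
  The sequential form over an arbitrary complete linear order serves extended real and extended
  nonnegative functions alike; on metric spaces it agrees with closedness of the sublevel sets.
\<close>

definition lsc_on :: "'b::topological_space set \<Rightarrow> ('b \<Rightarrow> 'c::complete_linorder) \<Rightarrow> bool" where
  "lsc_on S f \<longleftrightarrow> (\<forall>p\<in>S. \<forall>s. (\<forall>n. s n \<in> S) \<longrightarrow> s \<longlonglongrightarrow> p \<longrightarrow> f p \<le> liminf (\<lambda>n. f (s n)))"

lemma lsc_onD:
  "lsc_on S f \<Longrightarrow> p \<in> S \<Longrightarrow> (\<And>n. s n \<in> S) \<Longrightarrow> s \<longlonglongrightarrow> p \<Longrightarrow> f p \<le> liminf (\<lambda>n. f (s n))"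
  unfolding lsc_on_def by blast

lemma lsc_on_level:
  assumes "lsc_on S f" "p \<in> S" "\<And>n. s n \<in> S" "s \<longlonglongrightarrow> p" and b: "frequently (\<lambda>n. f (s n) \<le> b) sequentially"
  shows "f p \<le> b"
proof (rule ccontr)
  assume "\<not> f p \<le> b"
  then have "b < liminf (\<lambda>n. f (s n))"
    using lsc_onD[OF assms(1-4)] by auto
  then have "eventually (\<lambda>n. b < f (s n)) sequentially"
    by (rule less_LiminfD)
  with b show False
    unfolding frequently_def by (simp add: not_le)
qed

lemma lsc_on_level':
  assumes "lsc_on S f" "p \<in> S" "\<And>n. s n \<in> S" "s \<longlonglongrightarrow> p" and b: "\<And>n. f (s n) \<le> b"
  shows "f p \<le> b"
  by (rule lsc_on_level[OF assms(1-4)]) (use b in auto)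

lemma frequently_subseq:
  assumes "frequently P sequentially"
  obtains r :: "nat \<Rightarrow> nat" where "strict_mono r" "\<And>n. P (r n)"
proof
  have inf: "infinite {n. P n}"
    using assms by (simp add: frequently_cofinite flip: cofinite_eq_sequentially)
  show "strict_mono (enumerate {n. P n})"
    by (rule strict_mono_enumerate[OF inf])
  show "P (enumerate {n. P n} k)" for k
    using enumerate_in_set[OF inf, of k] by simp
qed

text \<open>
  If \<open>f p\<close> exceeded the lower limit along a sequence, a subsequence would stay under a
  level strictly below \<open>f p\<close>. So it suffices to check that sublevel sets are
  sequentially closed, a criterion that suprema and minima inherit at once.
\<close>

lemma lsc_onI_level:
  assumes "\<And>b p s. p \<in> S \<Longrightarrow> (\<And>n::nat. s n \<in> S) \<Longrightarrow> s \<longlonglongrightarrow> p \<Longrightarrow> (\<And>n. f (s n) \<le> b) \<Longrightarrow> f p \<le> b"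
  shows "lsc_on S f"
  unfolding lsc_on_def le_Liminf_iff
proof (intro ballI allI impI)
  fix p s y
  assume p: "p \<in> S" and s: "\<forall>n. s n \<in> S" "s \<longlonglongrightarrow> p" and y: "y < f p"
  show "eventually (\<lambda>n. y < f (s n)) sequentially"
  proof (rule ccontr)
    assume "\<not> ?thesis"
    then have "frequently (\<lambda>n. f (s n) \<le> y) sequentially"
      by (simp add: not_eventually not_less)
    then obtain r :: "nat \<Rightarrow> nat" where r: "strict_mono r" "\<And>n. f (s (r n)) \<le> y"
      by (rule frequently_subseq) blast
    have "f p \<le> y"
      using assms[of p "s \<circ> r" y] p s r LIMSEQ_subseq_LIMSEQ[OF s(2) r(1)] by (simp add: o_def)
    with y show False by simp
  qed
qed

lemma closedin_sequential:
  fixes S :: "'b::metric_space set"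
  shows "closedin (top_of_set S) T \<longleftrightarrow>
    T \<subseteq> S \<and> (\<forall>s l. (\<forall>n::nat. s n \<in> T) \<longrightarrow> s \<longlonglongrightarrow> l \<longrightarrow> l \<in> S \<longrightarrow> l \<in> T)"
proof (intro iffI conjI allI impI)
  assume T: "closedin (top_of_set S) T"
  show "T \<subseteq> S" by (rule closedin_imp_subset[OF T])
  fix s l assume s: "\<forall>n::nat. s n \<in> T" "s \<longlonglongrightarrow> l" "l \<in> S"
  obtain C where C: "closed C" "T = S \<inter> C"
    using T by (auto simp: closedin_closed)
  have "l \<in> C"
    using s C by (intro closed_sequentially[OF C(1) _ s(2)]) auto
  then show "l \<in> T" using C s by simp
next
  assume T: "T \<subseteq> S \<and> (\<forall>s l. (\<forall>n::nat. s n \<in> T) \<longrightarrow> s \<longlonglongrightarrow> l \<longrightarrow> l \<in> S \<longrightarrow> l \<in> T)"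
  have "T = S \<inter> closure T"
    using T closure_subset[of T] by (fastforce simp: closure_sequential)
  then show "closedin (top_of_set S) T"
    by (metis closedin_closed closed_closure)
qed

lemma lower_semicontinuous_on_iff_lsc_on:
  fixes f :: "'b::metric_space \<Rightarrow> ereal"
  shows "lower_semicontinuous_on S f \<longleftrightarrow> lsc_on S f"
proof
  assume l: "lower_semicontinuous_on S f"
  show "lsc_on S f"
  proof (rule lsc_onI_level)
    fix b p s
    assume p: "p \<in> S" and s: "\<And>n::nat. s n \<in> S" "s \<longlonglongrightarrow> p" and b: "\<And>n. f (s n) \<le> b"
    have *: "f p \<le> ereal r" if "b \<le> ereal r" for r
    proof -
      have "closedin (top_of_set S) {y \<in> S. f y \<le> ereal r}"
        using l by (auto simp: lower_semicontinuous_on_def)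
      moreover have "s n \<in> {y \<in> S. f y \<le> ereal r}" for n
        using s b[of n] that by auto
      ultimately have "p \<in> {y \<in> S. f y \<le> ereal r}"
        using p s(2) unfolding closedin_sequential by blast
      then show ?thesis by simp
    qed
    show "f p \<le> b"
      by (rule ereal_le_real) (use * in auto)
  qed
next
  assume l: "lsc_on S f"
  show "lower_semicontinuous_on S f"
    unfolding lower_semicontinuous_on_def closedin_sequential
    using lsc_on_level'[OF l] by blast
qed

lemma closedin_lsc_on_level:
  fixes S :: "'b::metric_space set"
  assumes "lsc_on S f"
  shows "closedin (top_of_set S) {y \<in> S. f y \<le> b}"
  unfolding closedin_sequential using lsc_on_level'[OF assms] by blast

lemma borel_measurable_lsc_on:
  fixes S :: "'b::metric_space set" and f :: "'b \<Rightarrow> 'c::{complete_linorder, linorder_topology, second_countable_topology}"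
  assumes "lsc_on S f"
  shows "f \<in> borel_measurable (restrict_space borel S)"
proof (rule borel_measurableI_le)
  fix b
  obtain T where T: "closed T" "{y \<in> S. f y \<le> b} = S \<inter> T"
    using closedin_lsc_on_level[OF assms, of b] by (auto simp: closedin_closed)
  have "{x \<in> space (restrict_space borel S). f x \<le> b} = S \<inter> T"
    using T(2) by (auto simp: space_restrict_space)
  also have "\<dots> \<in> sets (restrict_space borel S)"
    using T(1) by (auto simp: sets_restrict_space)
  finally show "{x \<in> space (restrict_space borel S). f x \<le> b} \<in> sets (restrict_space borel S)" .
qed

lemma lsc_on_SUP:
  assumes "\<And>i. i \<in> I \<Longrightarrow> lsc_on S (f i)"
  shows "lsc_on S (\<lambda>x. SUP i\<in>I. f i x)"
proof (rule lsc_onI_level)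
  fix b p s
  assume p: "p \<in> S" and s: "\<And>n::nat. s n \<in> S" "s \<longlonglongrightarrow> p" and b: "\<And>n. (SUP i\<in>I. f i (s n)) \<le> b"
  show "(SUP i\<in>I. f i p) \<le> b"
  proof (rule SUP_least)
    fix i assume i: "i \<in> I"
    show "f i p \<le> b"
      by (rule lsc_on_level'[OF assms[OF i] p s]) (use b i in \<open>auto simp: SUP_le_iff\<close>)
  qed
qed

lemma liminf_add_le_ennreal:
  fixes f g :: "nat \<Rightarrow> ennreal"
  shows "liminf f + liminf g \<le> liminf (\<lambda>n. f n + g n)"
proof -
  have inc: "incseq (\<lambda>n. INF m\<in>{n..}. F m)" for F :: "nat \<Rightarrow> ennreal"
    by (intro monoI INF_superset_mono) auto
  have "liminf f + liminf g = (SUP n. (INF m\<in>{n..}. f m) + (INF m\<in>{n..}. g m))"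
    unfolding liminf_SUP_INF by (rule ennreal_SUP_add[symmetric]) (rule inc)+
  also have "\<dots> \<le> liminf (\<lambda>n. f n + g n)"
    unfolding liminf_SUP_INF
    by (intro SUP_mono' INF_greatest add_mono INF_lower) auto
  finally show ?thesis .
qed

lemma lsc_on_add_ennreal:
  fixes f g :: "'b::topological_space \<Rightarrow> ennreal"
  assumes "lsc_on S f" "lsc_on S g"
  shows "lsc_on S (\<lambda>x. f x + g x)"
  unfolding lsc_on_def
proof (intro ballI allI impI)
  fix p s assume "p \<in> S" "\<forall>n. s n \<in> S" "s \<longlonglongrightarrow> p"
  then have "f p + g p \<le> liminf (\<lambda>n. f (s n)) + liminf (\<lambda>n. g (s n))"
    using assms by (intro add_mono lsc_onD[of S]) auto
  also have "\<dots> \<le> liminf (\<lambda>n. f (s n) + g (s n))"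
    by (rule liminf_add_le_ennreal)
  finally show "f p + g p \<le> liminf (\<lambda>n. f (s n) + g (s n))" .
qed

lemma liminf_cmult_ennreal:
  assumes "0 < a" "a < top"
  shows "liminf (\<lambda>n. a * f n) = a * liminf (f :: nat \<Rightarrow> ennreal)"
  using assms
  by (intro Liminf_compose_continuous_mono ennreal_continuous_on_cmult continuous_on_id)
     (auto intro!: monoI mult_left_mono)

lemma lsc_on_cmult_ennreal:
  fixes f :: "'b::topological_space \<Rightarrow> ennreal"
  assumes "lsc_on S f" "a < top"
  shows "lsc_on S (\<lambda>x. a * f x)"
proof (cases "a = 0")
  case True
  then show ?thesis by (simp add: lsc_on_def)
next
  case False
  then have "0 < a" by (simp add: zero_less_iff_neq_zero)
  show ?thesis
    unfolding lsc_on_def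
    using assms \<open>0 < a\<close> by (auto simp: liminf_cmult_ennreal intro!: mult_left_mono lsc_onD[OF assms(1)])
qed


section \<open>Lower limits of increasing sequences of functions\<close>

text \<open>
  The lower limit of \<open>h k z\<close> as \<open>k \<rightarrow> \<infinity>\<close> and \<open>z
  \<rightarrow> y\<close> within \<open>S\<close>. For \<open>h\<close> increasing in
  \<open>k\<close> the index and the radius may be tied together, which leaves a single countable
  supremum.
\<close>

definition lower_limit :: "'b::metric_space set \<Rightarrow> (nat \<Rightarrow> 'b \<Rightarrow> ennreal) \<Rightarrow> 'b \<Rightarrow> ennreal" where
  "lower_limit S h y = (SUP k. INF z\<in>{z\<in>S. dist z y < inverse (real (Suc k))}. h k z)"

text \<open>
  The Pasch-Hausdorff envelope of \<open>h k\<close> with Lipschitz constant \<open>k\<close>,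
  truncated at \<open>k\<close>.
\<close>

definition lipschitz_minorant :: "'b::metric_space set \<Rightarrow> (nat \<Rightarrow> 'b \<Rightarrow> ennreal) \<Rightarrow> nat \<Rightarrow> 'b \<Rightarrow> ennreal" where
  "lipschitz_minorant S h k y = min (ennreal k) (INF z\<in>S. h k z + ennreal (k * dist z y))"

text \<open>
  A small ball around a point close to \<open>p\<close> lies inside a given ball around
  \<open>p\<close>, so every infimum that enters the lower limit at \<open>p\<close> is eventually
  dominated by one that enters the lower limit at \<open>s n\<close>.
\<close>

lemma lower_limit_lsc_on:
  fixes S T :: "'b::metric_space set"
  assumes h: "\<And>z. incseq (\<lambda>k. h k z)"
  shows "lsc_on T (lower_limit S h)"
  unfolding lsc_on_def
proof (intro ballI allI impI)
  fix p :: 'b and s assume "s \<longlonglongrightarrow> p"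
  show "lower_limit S h p \<le> liminf (\<lambda>n. lower_limit S h (s n))"
    unfolding lower_limit_def[of S h p]
  proof (rule SUP_least)
    fix k
    let ?e = "inverse (real (Suc k))"
    obtain j0 where j0: "inverse (real (Suc j0)) < ?e / 2"
      using reals_Archimedean[of "?e/2"] by auto
    define j where "j = max k j0"
    have jk: "k \<le> j" and "inverse (real (Suc j)) \<le> inverse (real (Suc j0))"
      by (auto simp: j_def intro!: le_imp_inverse_le)
    then have j: "inverse (real (Suc j)) < ?e / 2" using j0 by linarith
    have "eventually (\<lambda>n. dist (s n) p < ?e / 2) sequentially"
      using \<open>s \<longlonglongrightarrow> p\<close> by (rule tendstoD) simp
    then have "eventually (\<lambda>n. (INF z\<in>{z\<in>S. dist z p < ?e}. h k z) \<le> lower_limit S h (s n)) sequentially"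
    proof eventually_elim
      case (elim n)
      have "(INF z\<in>{z\<in>S. dist z p < ?e}. h k z) \<le> (INF z\<in>{z\<in>S. dist z (s n) < inverse (real (Suc j))}. h j z)"
      proof (rule INF_mono)
        fix z assume "z \<in> {z\<in>S. dist z (s n) < inverse (real (Suc j))}"
        then have "z \<in> S" "dist z (s n) < ?e / 2" using j by auto
        then have "z \<in> {z\<in>S. dist z p < ?e}"
          using dist_triangle[of z p "s n"] elim by simp
        then show "\<exists>z'\<in>{z\<in>S. dist z p < ?e}. h k z' \<le> h j z"
          using incseqD[OF h jk] by blast
      qed
      also have "\<dots> \<le> lower_limit S h (s n)"
        unfolding lower_limit_def by (rule SUP_upper) simp
      finally show ?case .
    qed
    then show "(INF z\<in>{z\<in>S. dist z p < ?e}. h k z) \<le> liminf (\<lambda>n. lower_limit S h (s n))"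
      by (rule Liminf_bounded)
  qed
qed

lemma lower_limit_le:
  assumes "y \<in> S"
  shows "lower_limit S h y \<le> (SUP k. h k y)"
  unfolding lower_limit_def
  by (rule SUP_mono, rule bexI[OF _ UNIV_I], rule INF_lower2[where i=y]) (use assms in auto)

text \<open>
  Lower semicontinuous functions are their own lower limits; through this the Fatou lemma below also
  covers a fixed integrand.
\<close>

lemma lower_limit_const:
  assumes v: "lsc_on S v" and y: "y \<in> S"
  shows "lower_limit S (\<lambda>_. v) y = v y"
proof (rule antisym)
  show "lower_limit S (\<lambda>_. v) y \<le> v y"
    using lower_limit_le[OF y, of "\<lambda>_. v"] by simp
  show "v y \<le> lower_limit S (\<lambda>_. v) y"
  proof (rule dense_le)
    fix b assume b: "b < v y"
    have "\<exists>k. \<forall>z\<in>S. dist z y < inverse (real (Suc k)) \<longrightarrow> b < v z"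
    proof (rule ccontr)
      assume "\<not> ?thesis"
      then have "\<forall>k. \<exists>z. z \<in> S \<and> dist z y < inverse (real (Suc k)) \<and> v z \<le> b"
        by (auto simp: not_less)
      then obtain s where s: "\<And>k. s k \<in> S" "\<And>k. dist (s k) y < inverse (real (Suc k))" "\<And>k. v (s k) \<le> b"
        by metis
      have "(\<lambda>k. dist (s k) y) \<longlonglongrightarrow> 0"
        by (rule real_tendsto_sandwich[OF _ _ tendsto_const LIMSEQ_inverse_real_of_nat])
           (use s(2) in \<open>auto intro!: always_eventually less_imp_le\<close>)
      then have "s \<longlonglongrightarrow> y" by (rule tendsto_dist_iff[THEN iffD2])
      from lsc_on_level'[OF v y s(1) this s(3)] b show False by simp
    qed
    then obtain k where k: "\<And>z. z \<in> S \<Longrightarrow> dist z y < inverse (real (Suc k)) \<Longrightarrow> b < v z" by blast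
    have "b \<le> (INF z\<in>{z\<in>S. dist z y < inverse (real (Suc k))}. v z)"
      by (rule INF_greatest) (use k in \<open>auto simp: less_imp_le\<close>)
    also have "\<dots> \<le> lower_limit S (\<lambda>_. v) y"
      unfolding lower_limit_def by (rule SUP_upper) simp
    finally show "b \<le> lower_limit S (\<lambda>_. v) y" .
  qed
qed

lemma lipschitz_minorant_le: "z \<in> S \<Longrightarrow> lipschitz_minorant S h k z \<le> h k z"
  unfolding lipschitz_minorant_def by (rule min.coboundedI2, rule INF_lower2[where i=z]) auto

lemma lipschitz_minorant_mono:
  assumes h: "\<And>z. incseq (\<lambda>k. h k z)"
  shows "incseq (\<lambda>k. lipschitz_minorant S h k y)"
proof (rule monoI)
  fix j k :: nat assume "j \<le> k"
  then show "lipschitz_minorant S h j y \<le> lipschitz_minorant S h k y"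
    unfolding lipschitz_minorant_def
    by (intro min.mono ennreal_leI INF_mono' add_mono incseqD[OF h] mult_right_mono) auto
qed

lemma lipschitz_minorant_lipschitz:
  "lipschitz_minorant S h k y \<le> lipschitz_minorant S h k y' + ennreal (k * dist y y')"
proof -
  let ?I = "\<lambda>y. INF z\<in>S. h k z + ennreal (k * dist z y)"
  let ?d = "ennreal (k * dist y y')"
  have "?I y - ?d \<le> ?I y'"
  proof (rule INF_greatest)
    fix z assume "z \<in> S"
    then have "?I y \<le> h k z + ennreal (k * dist z y)" by (rule INF_lower)
    also have "\<dots> \<le> h k z + ennreal (k * dist z y' + k * dist y y')"
      using dist_triangle2[of z y y']
      by (intro add_left_mono ennreal_leI) (simp add: mult_left_mono flip: distrib_left)
    also have "\<dots> = ?d + (h k z + ennreal (k * dist z y'))"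
      by (simp add: ennreal_plus add_ac)
    finally show "?I y - ?d \<le> h k z + ennreal (k * dist z y')"
      by (simp add: ennreal_minus_le_iff)
  qed
  then have *: "?I y \<le> ?I y' + ?d"
    by (simp add: ennreal_minus_le_iff add.commute)
  show ?thesis
    unfolding lipschitz_minorant_def
  proof (cases "ennreal k \<le> ?I y'")
    case True
    then show "min (ennreal k) (?I y) \<le> min (ennreal k) (?I y') + ?d"
      by (auto simp: min_absorb1 intro: min.coboundedI1 add_increasing2)
  next
    case False
    then show "min (ennreal k) (?I y) \<le> min (ennreal k) (?I y') + ?d"
      using * by (auto simp: min_absorb2 intro: min.coboundedI2)
  qed
qed

lemma lipschitz_minorant_le_index: "lipschitz_minorant S h k y \<le> ennreal k"
  unfolding lipschitz_minorant_def by simp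

lemma lipschitz_minorant_real:
  obtains g :: "'b::metric_space \<Rightarrow> real" where
    "continuous_on UNIV g" "\<And>y. 0 \<le> g y" "\<And>y. g y \<le> k" "\<And>y. lipschitz_minorant S h k y = ennreal (g y)"
proof
  define g where "g y = enn2real (lipschitz_minorant S h k y)" for y
  show eq: "lipschitz_minorant S h k y = ennreal (g y)" for y
    using lipschitz_minorant_le_index[of S h k y]
    by (auto simp: g_def ennreal_enn2real_if top_unique)
  show g0: "0 \<le> g y" for y by (simp add: g_def)
  show "g y \<le> k" for y
    using lipschitz_minorant_le_index[of S h k y] by (simp add: eq)
  have 1: "g y \<le> g y' + k * dist y y'" for y y'
  proof -
    have "ennreal (g y) \<le> ennreal (g y') + ennreal (k * dist y y')"
      using lipschitz_minorant_lipschitz[of S h k y y'] by (simp add: eq)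
    then show ?thesis using g0 by (simp flip: ennreal_plus)
  qed
  have "k-lipschitz_on UNIV g"
  proof (rule lipschitz_onI)
    fix y y' show "dist (g y) (g y') \<le> k * dist y y'"
      using 1[of y y'] 1[of y' y] by (simp add: dist_real_def dist_commute abs_le_iff)
  qed simp
  then show "continuous_on UNIV g" by (rule lipschitz_on_continuous_on)
qed

text \<open>
  Points near \<open>y\<close> contribute the values of \<open>h k\<close>, while points at a fixed
  positive distance are penalized by \<open>k\<close> times that distance and drop out of the
  infimum as \<open>k\<close> grows.
\<close>

lemma SUP_lipschitz_minorant:
  assumes h: "\<And>z. incseq (\<lambda>k. h k z)"
  shows "(SUP k. lipschitz_minorant S h k y) = lower_limit S h y"
proof (rule antisym)
  show "(SUP k. lipschitz_minorant S h k y) \<le> lower_limit S h y"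
  proof (rule SUP_least)
    fix k
    have le: "lipschitz_minorant S h k y \<le> lower_limit S h y + ennreal (k * inverse (real (Suc j)))" if "k \<le> j" for j
    proof -
      have "lipschitz_minorant S h k y - ennreal (k * inverse (real (Suc j)))
          \<le> (INF z\<in>{z\<in>S. dist z y < inverse (real (Suc j))}. h j z)"
      proof (rule INF_greatest)
        fix z assume z: "z \<in> {z\<in>S. dist z y < inverse (real (Suc j))}"
        have "lipschitz_minorant S h k y \<le> h k z + ennreal (k * dist z y)"
          unfolding lipschitz_minorant_def using z by (auto intro: min.coboundedI2 INF_lower)
        also have "\<dots> \<le> h j z + ennreal (k * inverse (real (Suc j)))"
          using z incseqD[OF h that] by (intro add_mono ennreal_leI mult_left_mono) auto
        finally show "lipschitz_minorant S h k y - ennreal (k * inverse (real (Suc j))) \<le> h j z"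
          by (simp add: ennreal_minus_le_iff add.commute)
      qed
      also have "\<dots> \<le> lower_limit S h y"
        unfolding lower_limit_def by (rule SUP_upper) simp
      finally show ?thesis
        by (simp add: ennreal_minus_le_iff add.commute)
    qed
    have "(\<lambda>j. lower_limit S h y + ennreal (k * inverse (real (Suc j)))) \<longlonglongrightarrow> lower_limit S h y + ennreal (real k * 0)"
      by (intro tendsto_intros LIMSEQ_inverse_real_of_nat)
    then have "(\<lambda>j. lower_limit S h y + ennreal (k * inverse (real (Suc j)))) \<longlonglongrightarrow> lower_limit S h y"
      by simp
    then show "lipschitz_minorant S h k y \<le> lower_limit S h y"
      by (rule LIMSEQ_le_const) (use le in blast)
  qed
  show "lower_limit S h y \<le> (SUP k. lipschitz_minorant S h k y)"
    unfolding lower_limit_def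
  proof (rule SUP_least, rule dense_le)
    fix j b assume b: "b < (INF z\<in>{z\<in>S. dist z y < inverse (real (Suc j))}. h j z)"
    then obtain r where r: "b = ennreal r" "0 \<le> r"
      by (cases b) auto
    \<comment> \<open>With this \<open>k\<close>, distance at least \<open>1/(j+1)\<close> from \<open>y\<close> already costs \<open>r\<close>.\<close>
    obtain k :: nat where k: "r * real (Suc j) \<le> k" "j \<le> k"
      using real_arch_simple[of "max (r * real (Suc j)) (real j)"] by auto
    have rk: "r \<le> k"
      using k(1) mult_left_mono[of 1 "real (Suc j)" r] r(2) by simp
    have "b \<le> lipschitz_minorant S h k y"
      unfolding lipschitz_minorant_def
    proof (intro min.boundedI INF_greatest)
      show "b \<le> ennreal k" using rk r by (simp add: ennreal_leI)
      fix z assume z: "z \<in> S"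
      show "b \<le> h k z + ennreal (k * dist z y)"
      proof (cases "dist z y < inverse (real (Suc j))")
        case True
        then have "b \<le> h j z" using b z by (auto simp: less_INF_D intro: less_imp_le)
        also have "\<dots> \<le> h k z" by (rule incseqD[OF h k(2)])
        finally show ?thesis by (rule add_increasing2[rotated]) simp
      next
        case False
        have "r = (r * real (Suc j)) * inverse (real (Suc j))" by (simp add: field_simps)
        also have "\<dots> \<le> k * dist z y"
          using False k(1) r(2) by (intro mult_mono) auto
        finally have "b \<le> ennreal (k * dist z y)" using r by (simp add: ennreal_leI)
        then show ?thesis by (rule add_increasing[rotated]) simp
      qed
    qed
    also have "\<dots> \<le> (SUP k. lipschitz_minorant S h k y)" by (rule SUP_upper) simp
    finally show "b \<le> (SUP k. lipschitz_minorant S h k y)" .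
  qed
qed

text \<open>
  For a fixed \<open>k\<close> the \<open>k\<close>-th Lipschitz minorant is bounded and continuous,
  so its integrals converge by weak convergence, and it eventually lies below the integrands.
  Monotone convergence in \<open>k\<close> then recovers the integral of the lower limit.
\<close>

lemma Fatou_weak_convergence:
  fixes S :: "'b::metric_space set" and \<mu> :: "'b measure"
  assumes \<mu>: "prob_space \<mu>" "sets \<mu> = sets (restrict_space borel S)"
    and \<nu>: "\<And>n. prob_space (\<nu> n)" "\<And>n. sets (\<nu> n) = sets (restrict_space borel S)"
    and weak: "\<And>f :: 'b \<Rightarrow> real. continuous_on S f \<Longrightarrow> bounded (f ` S) \<Longrightarrow>
      (\<lambda>n. \<integral>z. f z \<partial>\<nu> n) \<longlonglongrightarrow> (\<integral>z. f z \<partial>\<mu>)"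
    and h: "\<And>z. incseq (\<lambda>k. h k z)"
    and le: "\<And>k. eventually (\<lambda>n. \<forall>z\<in>S. h k z \<le> f n z) sequentially"
  shows "(\<integral>\<^sup>+z. lower_limit S h z \<partial>\<mu>) \<le> liminf (\<lambda>n. \<integral>\<^sup>+z. f n z \<partial>\<nu> n)"
proof -
  have space\<nu>: "space (\<nu> n) = S" for n
    using sets_eq_imp_space_eq[OF \<nu>(2)] by (simp add: space_restrict_space)
  have "lipschitz_minorant S h k \<in> borel_measurable \<mu>" for k
  proof -
    obtain g where g: "continuous_on UNIV g" "\<And>y. lipschitz_minorant S h k y = ennreal (g y)"
      using lipschitz_minorant_real[of k S h] by metis
    have "g \<in> borel_measurable (restrict_space borel S)"
      by (rule measurable_restrict_space1[OF borel_measurable_continuous_onI[OF g(1)]])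
    then show ?thesis
      unfolding measurable_cong_sets[OF \<mu>(2) refl] g(2)[abs_def] by measurable
  qed
  then have "(\<integral>\<^sup>+z. lower_limit S h z \<partial>\<mu>) = (SUP k. \<integral>\<^sup>+z. lipschitz_minorant S h k z \<partial>\<mu>)"
    unfolding SUP_lipschitz_minorant[OF h, symmetric]
    using lipschitz_minorant_mono[of h, OF h]
    by (intro nn_integral_monotone_convergence_SUP) (auto simp: incseq_def le_fun_def)
  also have "\<dots> \<le> liminf (\<lambda>n. \<integral>\<^sup>+z. f n z \<partial>\<nu> n)"
  proof (rule SUP_least)
    fix k
    obtain g :: "'b \<Rightarrow> real" where g: "continuous_on UNIV g" "\<And>y. 0 \<le> g y" "\<And>y. g y \<le> k"
        "\<And>y. lipschitz_minorant S h k y = ennreal (g y)"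
      using lipschitz_minorant_real[of k S h] by metis
    have gm: "g \<in> borel_measurable (restrict_space borel S)"
      by (rule measurable_restrict_space1[OF borel_measurable_continuous_onI[OF g(1)]])
    have int: "(\<integral>\<^sup>+z. lipschitz_minorant S h k z \<partial>N) = ennreal (\<integral>z. g z \<partial>N)"
      if "prob_space N" "sets N = sets (restrict_space borel S)" for N
    proof -
      interpret prob_space N by fact
      have "g \<in> borel_measurable N" using gm unfolding measurable_cong_sets[OF that(2) refl] .
      then have "integrable N g"
        by (intro integrable_const_bound[where B=k]) (use g in auto)
      then show ?thesis
        unfolding g(4) by (intro nn_integral_eq_integral) (use g in auto)
    qed
    have "bounded (g ` S)"
      unfolding bounded_iff using g by (intro exI[of _ "real k"]) auto
    then have "(\<lambda>n. \<integral>z. g z \<partial>\<nu> n) \<longlonglongrightarrow> (\<integral>z. g z \<partial>\<mu>)"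
      using g(1) by (intro weak continuous_on_subset[OF g(1)]) auto
    then have "(\<lambda>n. \<integral>\<^sup>+z. lipschitz_minorant S h k z \<partial>\<nu> n) \<longlonglongrightarrow> (\<integral>\<^sup>+z. lipschitz_minorant S h k z \<partial>\<mu>)"
      unfolding int[OF \<mu>] int[OF \<nu>] by (rule tendsto_ennrealI)
    then have "(\<integral>\<^sup>+z. lipschitz_minorant S h k z \<partial>\<mu>) = liminf (\<lambda>n. \<integral>\<^sup>+z. lipschitz_minorant S h k z \<partial>\<nu> n)"
      by (intro lim_imp_Liminf[symmetric]) auto
    also have "\<dots> \<le> liminf (\<lambda>n. \<integral>\<^sup>+z. f n z \<partial>\<nu> n)"
    proof (rule Liminf_mono, rule eventually_mono[OF le[of k]])
      fix n assume "\<forall>z\<in>S. h k z \<le> f n z"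
      then show "(\<integral>\<^sup>+z. lipschitz_minorant S h k z \<partial>\<nu> n) \<le> (\<integral>\<^sup>+z. f n z \<partial>\<nu> n)"
        by (intro nn_integral_mono) (auto simp: space\<nu> intro: order_trans[OF lipschitz_minorant_le])
    qed
    finally show "(\<integral>\<^sup>+z. lipschitz_minorant S h k z \<partial>\<mu>) \<le> liminf (\<lambda>n. \<integral>\<^sup>+z. f n z \<partial>\<nu> n)" .
  qed
  finally show ?thesis .
qed


section \<open>Minimization over noncompact action sets\<close>

text \<open>
  The sequential form of K-inf-compactness: over every compact set of states the sublevel sets of
  \<open>f\<close> are compact. It replaces compactness of the action sets in Berge's maximum
  theorem.
\<close>

definition K_inf_compact :: "'b::metric_space set \<Rightarrow> ('b \<Rightarrow> 'a::metric_space set) \<Rightarrow> ('b \<times> 'a \<Rightarrow> ennreal) \<Rightarrow> bool" where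
  "K_inf_compact S A f \<longleftrightarrow>
     (\<forall>x xs as b. x \<in> S \<longrightarrow> (\<forall>n::nat. xs n \<in> S \<and> as n \<in> A (xs n) \<and> f (xs n, as n) \<le> b) \<longrightarrow> b < \<infinity> \<longrightarrow>
        xs \<longlonglongrightarrow> x \<longrightarrow> (\<exists>a\<in>A x. f (x, a) \<le> b \<and> (\<exists>r. strict_mono r \<and> (as \<circ> r) \<longlonglongrightarrow> a)))"

lemma K_inf_compactD:
  assumes "K_inf_compact S A f" "x \<in> S" "\<And>n::nat. xs n \<in> S" "\<And>n. as n \<in> A (xs n)"
    "\<And>n. f (xs n, as n) \<le> b" "b < \<infinity>" "xs \<longlonglongrightarrow> x"
  obtains a r where "a \<in> A x" "f (x, a) \<le> b" "strict_mono r" "(as \<circ> r) \<longlonglongrightarrow> a"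
  using assms unfolding K_inf_compact_def by blast

text \<open>
  Minimization over \<open>A x \<inter> F\<close> is what detects whether the set of minimizers
  meets \<open>F\<close>.
\<close>

lemma K_inf_compact_Int_closed:
  assumes f: "K_inf_compact S A f" and F: "closed F"
  shows "K_inf_compact S (\<lambda>x. A x \<inter> F) f"
  unfolding K_inf_compact_def
proof (intro allI impI)
  fix x xs as b
  assume x: "x \<in> S" and s: "\<forall>n::nat. xs n \<in> S \<and> as n \<in> A (xs n) \<inter> F \<and> f (xs n, as n) \<le> b"
    and b: "b < \<infinity>" and lim: "xs \<longlonglongrightarrow> x"
  obtain a r where a: "a \<in> A x" "f (x, a) \<le> b" "strict_mono r" "(as \<circ> r) \<longlonglongrightarrow> a"
    using K_inf_compactD[OF f x, of xs as b] s b lim by blast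
  have "a \<in> F"
    by (rule closed_sequentially[OF F _ a(4)]) (use s in auto)
  with a show "\<exists>a\<in>A x \<inter> F. f (x, a) \<le> b \<and> (\<exists>r. strict_mono r \<and> (as \<circ> r) \<longlonglongrightarrow> a)"
    by blast
qed

lemma K_inf_compact_lsc_on:
  assumes f: "K_inf_compact S A f"
  shows "lsc_on (Gr S A) f"
proof (rule lsc_onI_level)
  fix b p s
  assume p: "p \<in> Gr S A" and s: "\<And>n::nat. s n \<in> Gr S A" "s \<longlonglongrightarrow> p" and b: "\<And>n. f (s n) \<le> b"
  show "f p \<le> b"
  proof (cases "b < \<infinity>")
    case True
    have lim: "(\<lambda>n. fst (s n)) \<longlonglongrightarrow> fst p" "(\<lambda>n. snd (s n)) \<longlonglongrightarrow> snd p"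
      using s(2) by (auto intro: tendsto_intros)
    have s': "fst (s n) \<in> S" "snd (s n) \<in> A (fst (s n))" for n
      using s(1)[of n] by (auto simp: Gr_def)
    obtain a r where a: "a \<in> A (fst p)" "f (fst p, a) \<le> b" "strict_mono r" "((\<lambda>n. snd (s n)) \<circ> r) \<longlonglongrightarrow> a"
      by (rule K_inf_compactD[OF f _ s' _ True lim(1)]) (use p b in \<open>auto simp: Gr_def\<close>)
    have "((\<lambda>n. snd (s n)) \<circ> r) \<longlonglongrightarrow> snd p"
      by (rule LIMSEQ_subseq_LIMSEQ[OF lim(2) a(3)])
    then have "a = snd p" using a(4) LIMSEQ_unique by blast
    with a(2) show ?thesis by simp
  qed (simp add: not_less top_unique)
qed

lemma K_inf_compact_level_compact:
  assumes f: "K_inf_compact S A f" and x: "x \<in> S" and b: "b < \<infinity>"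
  shows "compact {a \<in> A x. f (x, a) \<le> b}"
  unfolding compact_def
proof (intro allI impI)
  fix as :: "nat \<Rightarrow> 'b" assume as: "\<forall>n. as n \<in> {a \<in> A x. f (x, a) \<le> b}"
  obtain a r where "a \<in> A x" "f (x, a) \<le> b" "strict_mono r" "(as \<circ> r) \<longlonglongrightarrow> a"
    by (rule K_inf_compactD[OF f x, of "\<lambda>_. x" as b]) (use x as b in auto)
  then show "\<exists>l\<in>{a \<in> A x. f (x, a) \<le> b}. \<exists>r. strict_mono r \<and> (as \<circ> r) \<longlonglongrightarrow> l"
    by blast
qed

text \<open>
  A minimizing sequence of actions at the fixed state \<open>x\<close> has a convergent subsequence,
  and lower semicontinuity shows that its limit is a minimizer.
\<close>

lemma K_inf_compact_attained:
  assumes f: "K_inf_compact S A f" and x: "x \<in> S" and fin: "(INF a\<in>A x. f (x, a)) < \<infinity>"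
  shows "\<exists>a\<in>A x. f (x, a) = (INF a\<in>A x. f (x, a))"
proof -
  let ?m = "INF a\<in>A x. f (x, a)"
  have "\<exists>a\<in>A x. f (x, a) \<le> ?m + ennreal (inverse (real (Suc n)))" for n
  proof -
    have "?m < ?m + ennreal (inverse (real (Suc n)))"
      using fin by (cases ?m) (auto simp: ennreal_less_iff simp flip: ennreal_plus)
    then show ?thesis
      unfolding INF_less_iff by (auto intro: less_imp_le)
  qed
  then obtain as where as: "\<And>n. as n \<in> A x" "\<And>n. f (x, as n) \<le> ?m + ennreal (inverse (real (Suc n)))"
    by metis
  have le1: "?m + ennreal (inverse (real (Suc n))) \<le> ?m + 1" for n
    by (intro add_left_mono) (simp add: inverse_le_1_iff)
  obtain a r where a: "a \<in> A x" "strict_mono r" "(as \<circ> r) \<longlonglongrightarrow> a"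
    by (rule K_inf_compactD[OF f x, of "\<lambda>_. x" as "?m + 1"])
       (use x as fin order_trans[OF as(2) le1] in auto)
  have "f (x, a) \<le> ?m + ennreal (inverse (real (Suc n)))" for n
  proof (rule lsc_on_level[OF K_inf_compact_lsc_on[OF f]])
    show "(x, a) \<in> Gr S A" "\<And>n. (x, as (r n)) \<in> Gr S A"
      using x a(1) as(1) by (auto simp: Gr_def)
    show "(\<lambda>n. (x, as (r n))) \<longlonglongrightarrow> (x, a)"
      using a(3) by (intro tendsto_Pair tendsto_const) (simp add: o_def)
    have "eventually (\<lambda>k. f (x, as (r k)) \<le> ?m + ennreal (inverse (real (Suc n)))) sequentially"
      unfolding eventually_sequentially
    proof (intro exI allI impI)
      fix k assume "n \<le> k"
      also have "k \<le> r k" by (rule seq_suble[OF a(2)])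
      finally have "?m + ennreal (inverse (real (Suc (r k)))) \<le> ?m + ennreal (inverse (real (Suc n)))"
        by (intro add_left_mono ennreal_leI le_imp_inverse_le) auto
      with as(2)[of "r k"] show "f (x, as (r k)) \<le> ?m + ennreal (inverse (real (Suc n)))"
        by (rule order_trans)
    qed
    then show "frequently (\<lambda>k. f (x, as (r k)) \<le> ?m + ennreal (inverse (real (Suc n)))) sequentially"
      by (intro eventually_frequently) auto
  qed
  moreover have "(\<lambda>n. ?m + ennreal (inverse (real (Suc n)))) \<longlonglongrightarrow> ?m + ennreal 0"
    by (intro tendsto_intros LIMSEQ_inverse_real_of_nat)
  ultimately have "f (x, a) \<le> ?m + ennreal 0"
    by (intro LIMSEQ_le_const) auto
  then have "f (x, a) = ?m"
    using a(1) by (intro antisym INF_lower) auto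
  with a(1) show ?thesis by blast
qed

text \<open>
  The lower-semicontinuous half of Berge's maximum theorem: minimizing actions along
  \<open>xs\<close> subconverge to an action at \<open>x\<close> whose value is no larger than the
  common bound.
\<close>

lemma K_inf_compact_min_lsc_on:
  assumes f: "K_inf_compact S A f"
  shows "lsc_on S (\<lambda>x. INF a\<in>A x. f (x, a))"
proof (rule lsc_onI_level)
  fix b x xs
  assume x: "x \<in> S" and s: "\<And>n::nat. xs n \<in> S" "xs \<longlonglongrightarrow> x" and b: "\<And>n. (INF a\<in>A (xs n). f (xs n, a)) \<le> b"
  show "(INF a\<in>A x. f (x, a)) \<le> b"
  proof (cases "b < \<infinity>")
    case True
    have "\<exists>a\<in>A (xs n). f (xs n, a) \<le> b" for n
      using K_inf_compact_attained[OF f s(1), of n] b[of n] True by (metis le_less_trans)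
    then obtain as where as: "\<And>n. as n \<in> A (xs n)" "\<And>n. f (xs n, as n) \<le> b" by metis
    obtain a where "a \<in> A x" "f (x, a) \<le> b"
      by (rule K_inf_compactD[OF f x s(1) as True s(2)])
    then show ?thesis by (rule INF_lower2)
  qed (simp add: not_less top_unique)
qed


section \<open>Measurable selection\<close>

lemma compact_decseq_INT_nonempty:
  fixes K :: "nat \<Rightarrow> 'a::metric_space set"
  assumes "\<And>k. compact (K k)" "\<And>k. K k \<noteq> {}" "decseq K"
  shows "(\<Inter>k. K k) \<noteq> {}"
proof -
  have "K 0 \<inter> (\<Inter>k\<in>UNIV. K k) \<noteq> {}"
  proof (rule compact_imp_fip_image)
    show "compact (K 0)" "\<And>k. closed (K k)" using assms(1) by (auto intro: compact_imp_closed)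
    fix I :: "nat set" assume I: "finite I"
    have "K (Max (insert 0 I)) \<subseteq> K k" if "k \<in> insert 0 I" for k
      using I that by (intro decseqD[OF assms(3)] Max_ge) auto
    then have "K (Max (insert 0 I)) \<subseteq> K 0 \<inter> (\<Inter>k\<in>I. K k)" by blast
    then show "K 0 \<inter> (\<Inter>k\<in>I. K k) \<noteq> {}"
      using assms(2)[of "Max (insert 0 I)"] by blast
  qed
  then show ?thesis by blast
qed

text \<open>
  A Kuratowski and Ryll-Nardzewski selection for compact values. The set \<open>\<Phi> x\<close> is
  cut down successively by balls of radius \<open>1/(k+1)\<close>, always the first ball of a
  countable dense family that it meets, and the intersection is a single point. Compactness supplies
  this point, and it also makes the point lie in a closed set \<open>F\<close> exactly when every
  stage meets \<open>F\<close>.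
\<close>

lemma measurable_compact_selection:
  fixes \<Phi> :: "'b \<Rightarrow> 'a::{metric_space, second_countable_topology} set"
  assumes ne: "\<And>x. x \<in> space N \<Longrightarrow> \<Phi> x \<noteq> {}" and cpt: "\<And>x. x \<in> space N \<Longrightarrow> compact (\<Phi> x)"
    and hit: "\<And>F. closed F \<Longrightarrow> {x \<in> space N. \<Phi> x \<inter> F \<noteq> {}} \<in> sets N"
  obtains \<phi> where "\<phi> \<in> N \<rightarrow>\<^sub>M borel" "\<And>x. x \<in> space N \<Longrightarrow> \<phi> x \<in> \<Phi> x"
proof -
  obtain D :: "'a set" where D: "countable D" "\<And>X. open X \<Longrightarrow> X \<noteq> {} \<Longrightarrow> \<exists>d\<in>D. d \<in> X"
    by (rule countable_dense_setE) blast
  have "D \<noteq> {}" using D(2)[of UNIV] by auto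
  define d where "d = from_nat_into D"
  define B where "B k j = cball (d j) (inverse (real (Suc k)))" for k j
  have B_closed: "closed (B k j)" for k j by (simp add: B_def)
  have B_cover: "\<exists>j. a \<in> B k j" for a k
  proof -
    obtain e where e: "e \<in> D" "e \<in> ball a (inverse (real (Suc k)))"
      using D(2)[of "ball a (inverse (real (Suc k)))"] by auto
    obtain j where "e = d j"
      using from_nat_into_surj[OF D(1) e(1)] by (auto simp: d_def)
    with e(2) show ?thesis by (intro exI[of _ j]) (simp add: B_def dist_commute)
  qed
  define \<Psi> where "\<Psi> = rec_nat \<Phi> (\<lambda>k P x. P x \<inter> B k (LEAST j. P x \<inter> B k j \<noteq> {}))"
  have \<Psi>_0: "\<Psi> 0 = \<Phi>" by (simp add: \<Psi>_def)
  have \<Psi>_Suc: "\<Psi> (Suc k) x = \<Psi> k x \<inter> B k (LEAST j. \<Psi> k x \<inter> B k j \<noteq> {})" for k x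
    by (simp add: \<Psi>_def)
  have \<Psi>_ex: "\<exists>j. \<Psi> k x \<inter> B k j \<noteq> {}" if "\<Psi> k x \<noteq> {}" for k x
    using B_cover that by blast
  have \<Psi>_ne: "\<Psi> k x \<noteq> {}" if x: "x \<in> space N" for k x
  proof (induction k)
    case 0 show ?case by (simp add: \<Psi>_0 ne x)
  next
    case (Suc k)
    show ?case unfolding \<Psi>_Suc by (rule LeastI_ex[OF \<Psi>_ex[OF Suc]])
  qed
  have \<Psi>_cpt: "compact (\<Psi> k x)" if x: "x \<in> space N" for k x
  proof (induction k)
    case 0 show ?case by (simp add: \<Psi>_0 cpt x)
  next
    case (Suc k) then show ?case unfolding \<Psi>_Suc by (rule compact_Int_closed[OF _ B_closed])
  qed
  have \<Psi>_hit: "{x \<in> space N. \<Psi> k x \<inter> F \<noteq> {}} \<in> sets N" if "closed F" for k F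
    using that
  proof (induction k arbitrary: F)
    case 0 then show ?case by (simp add: \<Psi>_0 hit)
  next
    case (Suc k)
    have IH: "Measurable.pred N (\<lambda>x. \<Psi> k x \<inter> F' \<noteq> {})" if "closed F'" for F'
      using Suc.IH[OF that] by (simp add: pred_def)
    have [measurable]: "Measurable.pred N (\<lambda>x. \<Psi> k x \<inter> B k j \<noteq> {})" for j
      by (rule IH[OF B_closed])
    have [measurable]: "Measurable.pred N (\<lambda>x. \<Psi> k x \<inter> (B k j \<inter> F) \<noteq> {})" for j
      by (rule IH) (use B_closed Suc.prems in auto)
    have [measurable]: "(\<lambda>x. LEAST j. \<Psi> k x \<inter> B k j \<noteq> {}) \<in> N \<rightarrow>\<^sub>M count_space UNIV"
      by measurable
    have "{x \<in> space N. \<Psi> (Suc k) x \<inter> F \<noteq> {}} =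
        {x \<in> space N. \<exists>j. (LEAST j. \<Psi> k x \<inter> B k j \<noteq> {}) = j \<and> \<Psi> k x \<inter> (B k j \<inter> F) \<noteq> {}}"
      unfolding \<Psi>_Suc by (auto simp: Int_assoc)
    also have "\<dots> \<in> sets N" by measurable
    finally show ?case .
  qed
  have \<Psi>_dec: "decseq (\<lambda>k. \<Psi> k x)" for x
    by (rule decseq_SucI) (auto simp: \<Psi>_Suc)
  define \<phi> where "\<phi> x = (SOME a. \<forall>k. a \<in> \<Psi> k x)" for x
  have \<phi>: "\<phi> x \<in> \<Psi> k x" if x: "x \<in> space N" for k x
  proof -
    have "(\<Inter>k. \<Psi> k x) \<noteq> {}"
      using \<Psi>_ne \<Psi>_cpt x \<Psi>_dec by (intro compact_decseq_INT_nonempty) auto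
    then have "\<exists>a. \<forall>k. a \<in> \<Psi> k x" by auto
    then have "\<forall>k. \<phi> x \<in> \<Psi> k x" unfolding \<phi>_def by (rule someI_ex)
    then show ?thesis ..
  qed
  have unique: "a = \<phi> x" if x: "x \<in> space N" and a: "\<And>k. a \<in> \<Psi> k x" for a x
  proof (rule ccontr)
    assume "a \<noteq> \<phi> x"
    then obtain k where k: "inverse (real (Suc k)) < dist a (\<phi> x) / 2"
      using reals_Archimedean[of "dist a (\<phi> x) / 2"] by auto
    obtain j where "a \<in> B k j" "\<phi> x \<in> B k j"
      using a[of "Suc k"] \<phi>[OF x, of "Suc k"] unfolding \<Psi>_Suc by blast
    then show False
      using k dist_triangle[of a "\<phi> x" "d j"] by (simp add: B_def dist_commute)
  qed
  have "\<phi> \<in> N \<rightarrow>\<^sub>M borel"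
    unfolding borel_eq_closed
  proof (rule measurable_measure_of)
    fix F :: "'a set" assume "F \<in> Collect closed"
    then have F: "closed F" by simp
    have "\<phi> -` F \<inter> space N = {x \<in> space N. \<forall>k. \<Psi> k x \<inter> F \<noteq> {}}"
    proof (intro set_eqI iffI)
      fix x assume "x \<in> \<phi> -` F \<inter> space N"
      then show "x \<in> {x \<in> space N. \<forall>k. \<Psi> k x \<inter> F \<noteq> {}}" using \<phi> by blast
    next
      fix x assume x: "x \<in> {x \<in> space N. \<forall>k. \<Psi> k x \<inter> F \<noteq> {}}"
      then have "(\<Inter>k. \<Psi> k x \<inter> F) \<noteq> {}"
        using \<Psi>_cpt F \<Psi>_dec
        by (intro compact_decseq_INT_nonempty)
           (auto intro: compact_Int_closed intro!: decseq_SucI simp: \<Psi>_Suc)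
      then obtain a where "a \<in> F" "\<And>k. a \<in> \<Psi> k x" by auto
      then show "x \<in> \<phi> -` F \<inter> space N" using unique[of x a] x by auto
    qed
    also have "\<dots> = (\<Inter>k. {x \<in> space N. \<Psi> k x \<inter> F \<noteq> {}})" by auto
    also have "\<dots> \<in> sets N" by (rule sets.countable_INT) (use \<Psi>_hit[OF F] in auto)
    finally show "\<phi> -` F \<inter> space N \<in> sets N" .
  qed auto
  moreover have "\<phi> x \<in> \<Phi> x" if "x \<in> space N" for x
    using \<phi>[OF that, of 0] by (simp add: \<Psi>_0)
  ultimately show ?thesis by (rule that)
qed

text \<open>
  Where the minimum is finite the minimizers form a nonempty compact set, and this set meets a
  closed \<open>F\<close> iff the minimum over \<open>A x \<inter> F\<close> does not exceed the
  minimum over \<open>A x\<close>: a comparison of two lower semicontinuous functions. Where the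
  minimum is infinite every action attains it, so \<open>\<phi>0\<close> serves there.
\<close>

lemma measurable_minimizer:
  fixes S :: "'b::metric_space set" and A :: "'b \<Rightarrow> 'a::{metric_space, second_countable_topology} set"
  assumes f: "K_inf_compact S A f"
    and \<phi>0: "\<phi>0 \<in> restrict_space borel S \<rightarrow>\<^sub>M borel" "\<And>x. x \<in> S \<Longrightarrow> \<phi>0 x \<in> A x"
  obtains \<phi> where "\<phi> \<in> restrict_space borel S \<rightarrow>\<^sub>M borel"
    "\<And>x. x \<in> S \<Longrightarrow> \<phi> x \<in> A x" "\<And>x. x \<in> S \<Longrightarrow> f (x, \<phi> x) = (INF a\<in>A x. f (x, a))"
proof -
  let ?N = "restrict_space borel S"
  define m where "m F x = (INF a\<in>A x \<inter> F. f (x, a))" for F x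
  have m_meas: "m F \<in> borel_measurable ?N" if "closed F" for F
    unfolding m_def[abs_def]
    by (intro borel_measurable_lsc_on K_inf_compact_min_lsc_on K_inf_compact_Int_closed f that)
  define D where "D = {x \<in> S. m UNIV x < \<infinity>}"
  have space_N: "space ?N = S" by (simp add: space_restrict_space)
  have D: "D \<in> sets ?N"
  proof -
    have "{x \<in> space ?N. m UNIV x < \<infinity>} \<in> sets ?N"
      using m_meas[OF closed_UNIV] by measurable
    then show ?thesis by (simp add: D_def space_N)
  qed
  let ?ND = "restrict_space ?N D"
  have space_ND: "space ?ND = D" by (auto simp: space_restrict_space D_def)
  define \<Phi> where "\<Phi> x = {a \<in> A x. f (x, a) \<le> m UNIV x}" for x
  obtain \<phi> where \<phi>: "\<phi> \<in> ?ND \<rightarrow>\<^sub>M borel" "\<And>x. x \<in> space ?ND \<Longrightarrow> \<phi> x \<in> \<Phi> x"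
  proof (rule measurable_compact_selection[of ?ND \<Phi>])
    fix x assume "x \<in> space ?ND"
    then have x: "x \<in> S" "m UNIV x < \<infinity>" by (simp_all only: space_ND) (simp_all add: D_def)
    show "compact (\<Phi> x)"
      unfolding \<Phi>_def by (rule K_inf_compact_level_compact[OF f x])
    show "\<Phi> x \<noteq> {}"
      using K_inf_compact_attained[OF f x(1)] x(2) by (auto simp: \<Phi>_def m_def)
  next
    fix F :: "'a set" assume F: "closed F"
    have "{x \<in> space ?ND. \<Phi> x \<inter> F \<noteq> {}} = {x \<in> space ?ND. m F x \<le> m UNIV x}"
    proof (intro Collect_cong conj_cong refl iffI)
      fix x assume "x \<in> space ?ND" "\<Phi> x \<inter> F \<noteq> {}"
      then obtain a where "a \<in> A x \<inter> F" "f (x, a) \<le> m UNIV x" by (auto simp: \<Phi>_def)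
      then show "m F x \<le> m UNIV x" unfolding m_def[of F] by (rule INF_lower2)
    next
      fix x assume "x \<in> space ?ND" and le: "m F x \<le> m UNIV x"
      then have "x \<in> S" "m UNIV x < \<infinity>" by (simp_all only: space_ND) (simp_all add: D_def)
      with le have x: "x \<in> S" "m F x < \<infinity>" by (auto intro: le_less_trans)
      then obtain a where "a \<in> A x \<inter> F" "f (x, a) = m F x"
        using K_inf_compact_attained[OF K_inf_compact_Int_closed[OF f F], of x] by (auto simp: m_def)
      with le show "\<Phi> x \<inter> F \<noteq> {}" by (auto simp: \<Phi>_def)
    qed
    also have "\<dots> \<in> sets ?ND"
      using measurable_restrict_space1[OF m_meas[OF F], of D]
        measurable_restrict_space1[OF m_meas[OF closed_UNIV], of D] by measurable
    finally show "{x \<in> space ?ND. \<Phi> x \<inter> F \<noteq> {}} \<in> sets ?ND" .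
  qed blast
  show ?thesis
  proof (rule that[of "\<lambda>x. if x \<in> D then \<phi> x else \<phi>0 x"])
    show "(\<lambda>x. if x \<in> D then \<phi> x else \<phi>0 x) \<in> ?N \<rightarrow>\<^sub>M borel"
    proof (rule measurable_If_restrict_space_iff[THEN iffD2])
      show "{x \<in> space ?N. x \<in> D} \<in> sets ?N"
        using D by (simp add: space_N D_def)
      show "\<phi> \<in> restrict_space ?N {x. x \<in> D} \<rightarrow>\<^sub>M borel \<and> \<phi>0 \<in> restrict_space ?N {x. x \<notin> D} \<rightarrow>\<^sub>M borel"
        using \<phi>(1) measurable_restrict_space1[OF \<phi>0(1)] by simp
    qed
    fix x assume x: "x \<in> S"
    show "(if x \<in> D then \<phi> x else \<phi>0 x) \<in> A x"
      using \<phi>(2)[of x] \<phi>0(2)[OF x] by (auto simp: space_ND \<Phi>_def)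
    have "m UNIV x \<le> f (x, a)" if "a \<in> A x" for a
      unfolding m_def using that by (intro INF_lower) auto
    moreover have "f (x, if x \<in> D then \<phi> x else \<phi>0 x) \<le> m UNIV x"
    proof (cases "x \<in> D")
      case True
      then show ?thesis using \<phi>(2)[unfolded space_ND, OF True] by (simp add: \<Phi>_def)
    next
      case False
      then have "m UNIV x = \<infinity>" using x by (auto simp: D_def not_less top_unique)
      then show ?thesis by simp
    qed
    ultimately have "f (x, if x \<in> D then \<phi> x else \<phi>0 x) = m UNIV x"
      using \<open>(if x \<in> D then \<phi> x else \<phi>0 x) \<in> A x\<close> by (intro antisym) auto
    then show "f (x, if x \<in> D then \<phi> x else \<phi>0 x) = (INF a\<in>A x. f (x, a))"
      by (simp add: m_def)
  qed
qed


section \<open>Abel means are dominated by Cesaro means\<close>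

text \<open>
  Summation by parts. All coefficients of the partial sums on the right are nonnegative, so an
  inequality between partial sums carries over to the discounted sums.
\<close>

lemma Abel_sum_identity:
  fixes a :: "nat \<Rightarrow> ennreal"
  assumes "0 \<le> \<alpha>" "\<alpha> \<le> 1"
  shows "(\<Sum>n<N. ennreal (\<alpha> ^ n) * a n)
    = ennreal (\<alpha> ^ N) * (\<Sum>n<N. a n) + ennreal (1 - \<alpha>) * (\<Sum>n<N. ennreal (\<alpha> ^ n) * (\<Sum>i<Suc n. a i))"
proof (induction N)
  case (Suc N)
  let ?S = "\<lambda>N. \<Sum>n<N. a n" and ?T = "\<lambda>N. \<Sum>n<N. ennreal (\<alpha> ^ n) * (\<Sum>i<Suc n. a i)"
  have "ennreal (\<alpha> ^ Suc N) * ?S (Suc N) + ennreal (1 - \<alpha>) * ?T (Suc N)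
      = (ennreal (\<alpha> ^ Suc N) + ennreal (1 - \<alpha>) * ennreal (\<alpha> ^ N)) * ?S (Suc N) + ennreal (1 - \<alpha>) * ?T N"
    by (simp add: distrib_left distrib_right mult.assoc add_ac)
  also have "ennreal (\<alpha> ^ Suc N) + ennreal (1 - \<alpha>) * ennreal (\<alpha> ^ N) = ennreal (\<alpha> ^ N)"
  proof -
    have "ennreal (1 - \<alpha>) * ennreal (\<alpha> ^ N) = ennreal ((1 - \<alpha>) * \<alpha> ^ N)"
      using assms by (intro ennreal_mult[symmetric]) auto
    moreover have "ennreal (\<alpha> ^ Suc N) + ennreal ((1 - \<alpha>) * \<alpha> ^ N) = ennreal (\<alpha> ^ Suc N + (1 - \<alpha>) * \<alpha> ^ N)"
      using assms by (intro ennreal_plus[symmetric]) auto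
    moreover have "\<alpha> ^ Suc N + (1 - \<alpha>) * \<alpha> ^ N = \<alpha> ^ N" by (simp add: algebra_simps)
    ultimately show ?thesis by simp
  qed
  also have "ennreal (\<alpha> ^ N) * ?S (Suc N) + ennreal (1 - \<alpha>) * ?T N = (\<Sum>n<Suc N. ennreal (\<alpha> ^ n) * a n)"
    by (simp add: Suc.IH distrib_left add_ac)
  finally show ?case by simp
qed simp

lemma Abel_sum_mono:
  fixes a b :: "nat \<Rightarrow> ennreal"
  assumes "0 \<le> \<alpha>" "\<alpha> \<le> 1" and le: "\<And>N. (\<Sum>n<N. a n) \<le> (\<Sum>n<N. b n)"
  shows "(\<Sum>n<N. ennreal (\<alpha> ^ n) * a n) \<le> (\<Sum>n<N. ennreal (\<alpha> ^ n) * b n)"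
  unfolding Abel_sum_identity[OF assms(1,2), where a=a] Abel_sum_identity[OF assms(1,2), where a=b]
  by (rule add_mono[OF mult_left_mono[OF le] mult_left_mono[OF sum_mono[OF mult_left_mono[OF le]]]]) auto

text \<open>
  If the averages are eventually below \<open>b\<close>, then for suitable \<open>C\<close> the sum
  of the first \<open>N\<close> terms is at most \<open>b * N + C\<close> for all \<open>N\<close>.
  For \<open>N > 0\<close> these bounds are the partial sums of the constant sequence
  \<open>b\<close> with an extra \<open>C\<close> at time \<open>0\<close>, whose Abel mean is
  \<open>b + (1 - \<alpha>) * C\<close>.
\<close>

lemma Limsup_Abel_le_Cesaro:
  fixes a :: "nat \<Rightarrow> ennreal"
  shows "Limsup (at_left 1) (\<lambda>\<alpha>. ennreal (1 - \<alpha>) * (\<Sum>n. ennreal (\<alpha> ^ n) * a n))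
    \<le> limsup (\<lambda>N. ennreal (1 / real N) * (\<Sum>n<N. a n))" (is "?L \<le> ?R")
proof (rule dense_ge)
  fix b' assume b': "?R < b'"
  show "?L \<le> b'"
  proof (cases "b' = \<infinity>")
    case False
    then obtain b where b: "b' = ennreal b" "0 \<le> b" by (cases b') auto
    have "eventually (\<lambda>N. ennreal (1 / real N) * (\<Sum>n<N. a n) < b') sequentially"
      by (rule Limsup_lessD[OF b'])
    then obtain N0 where N0: "\<And>N. N0 \<le> N \<Longrightarrow> ennreal (1 / real N) * (\<Sum>n<N. a n) < b'"
      by (auto simp: eventually_sequentially)
    define N1 where "N1 = Suc N0"
    have 1: "(\<Sum>n<N. a n) \<le> ennreal (b * N)" if "N1 \<le> N" for N
    proof -
      have N: "0 < real N" "N0 \<le> N" using that by (auto simp: N1_def)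
      have "(\<Sum>n<N. a n) = ennreal (real N) * (ennreal (1 / real N) * (\<Sum>n<N. a n))"
        using N by (simp add: mult.assoc[symmetric] flip: ennreal_mult)
      also have "\<dots> \<le> ennreal (real N) * b'"
        using N0[OF N(2)] by (intro mult_left_mono) auto
      also have "\<dots> = ennreal (b * N)"
        using b by (simp add: mult.commute flip: ennreal_mult)
      finally show ?thesis .
    qed
    \<comment> \<open>The comparison sequence; the extra term at time 0 pays for the partial sums of index below \<open>N1\<close>.\<close>
    define a' where "a' n = ennreal (b + (if n = 0 then b * N1 else 0))" for n :: nat
    have le: "(\<Sum>n<N. a n) \<le> (\<Sum>n<N. a' n)" for N
    proof (cases "N = 0")
      case False
      have sum_a': "(\<Sum>n<N. a' n) = ennreal (b * N + b * N1)"
      proof -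
        have "(\<Sum>n<N. a' n) = ennreal (\<Sum>n<N. b + (if n = 0 then b * N1 else 0))"
          unfolding a'_def using b(2) by (intro sum_ennreal) auto
        also have "(\<Sum>n<N. b + (if n = 0 then b * N1 else 0)) = b * N + b * N1"
          using False by (simp add: sum.distrib sum.delta mult.commute)
        finally show ?thesis .
      qed
      show ?thesis
      proof (cases "N1 \<le> N")
        case True
        then show ?thesis
          unfolding sum_a' using b(2) by (intro order_trans[OF 1[OF True]] ennreal_leI) auto
      next
        case False
        have "(\<Sum>n<N. a n) \<le> (\<Sum>n<N1. a n)"
          using False by (intro sum_mono2) auto
        also have "\<dots> \<le> ennreal (b * N1)" by (rule 1) simp
        also have "\<dots> \<le> ennreal (b * N + b * N1)" using b(2) by (intro ennreal_leI) auto
        finally show ?thesis unfolding sum_a' .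
      qed
    qed simp
    have bound: "ennreal (1 - \<alpha>) * (\<Sum>n. ennreal (\<alpha> ^ n) * a n) \<le> ennreal (b + (1 - \<alpha>) * (b * N1))"
      if \<alpha>: "0 < \<alpha>" "\<alpha> < 1" for \<alpha>
    proof -
      have "(\<Sum>n. ennreal (\<alpha> ^ n) * a n) \<le> ennreal (b / (1 - \<alpha>) + b * N1)"
        unfolding suminf_eq_SUP
      proof (rule SUP_least)
        fix N
        have "(\<Sum>n<N. ennreal (\<alpha> ^ n) * a n) \<le> (\<Sum>n<N. ennreal (\<alpha> ^ n) * a' n)"
          using \<alpha> by (intro Abel_sum_mono le) auto
        also have "\<dots> = ennreal (\<Sum>n<N. \<alpha> ^ n * (b + (if n = 0 then b * N1 else 0)))"
          unfolding a'_def using b(2) \<alpha> by (subst sum_ennreal[symmetric]) (auto simp: ennreal_mult intro!: sum.cong)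
        also have "\<dots> \<le> ennreal (b / (1 - \<alpha>) + b * N1)"
        proof (rule ennreal_leI)
          have "(\<Sum>n<N. \<alpha> ^ n * (b + (if n = 0 then b * N1 else 0)))
              = b * (\<Sum>n<N. \<alpha> ^ n) + (\<Sum>n<N. if n = 0 then b * N1 else 0)"
            unfolding distrib_left sum.distrib sum_distrib_left
            by (intro arg_cong2[where f="(+)"] sum.cong) auto
          also have "\<dots> \<le> b * (1 / (1 - \<alpha>)) + b * N1"
          proof (intro add_mono mult_left_mono b(2))
            have "(\<Sum>n<N. \<alpha> ^ n) \<le> (\<Sum>n. \<alpha> ^ n)"
              using \<alpha> by (intro sum_le_suminf) auto
            also have "\<dots> = 1 / (1 - \<alpha>)" using \<alpha> by (intro suminf_geometric) auto
            finally show "(\<Sum>n<N. \<alpha> ^ n) \<le> 1 / (1 - \<alpha>)" .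
            show "(\<Sum>n<N. if n = 0 then b * N1 else 0) \<le> b * N1"
              using b(2) by (cases "N = 0") auto
          qed
          finally show "(\<Sum>n<N. \<alpha> ^ n * (b + (if n = 0 then b * N1 else 0))) \<le> b / (1 - \<alpha>) + b * N1" by simp
        qed
        finally show "(\<Sum>n<N. ennreal (\<alpha> ^ n) * a n) \<le> ennreal (b / (1 - \<alpha>) + b * N1)" .
      qed
      then have "ennreal (1 - \<alpha>) * (\<Sum>n. ennreal (\<alpha> ^ n) * a n) \<le> ennreal (1 - \<alpha>) * ennreal (b / (1 - \<alpha>) + b * N1)"
        by (rule mult_left_mono) simp
      also have "\<dots> = ennreal (b + (1 - \<alpha>) * (b * N1))"
        using \<alpha> b(2) by (simp add: distrib_left flip: ennreal_mult)
      finally show ?thesis .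
    qed
    have "?L \<le> Limsup (at_left 1) (\<lambda>\<alpha>. ennreal (b + (1 - \<alpha>) * (b * N1)))"
    proof (rule Limsup_mono)
      show "\<forall>\<^sub>F \<alpha> in at_left 1. ennreal (1 - \<alpha>) * (\<Sum>n. ennreal (\<alpha> ^ n) * a n) \<le> ennreal (b + (1 - \<alpha>) * (b * N1))"
        unfolding eventually_at_left_field by (intro exI[of _ 0]) (use bound in auto)
    qed
    also have "\<dots> = ennreal (b + (1 - 1) * (b * N1))"
      by (intro lim_imp_Limsup tendsto_intros) auto
    finally show ?thesis using b by simp
  qed simp
qed


section \<open>One-step disintegration of the trajectory measure\<close>

lemma (in Ionescu_Tulcea) up_to_atLeastLessThan: "up_to {0..<n} = n"
proof (rule antisym)
  show "up_to {0..<n} \<le> n" by (subst up_to_iff) auto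
  show "n \<le> up_to {0..<n}"
    using up_to[of "{0..<n}"] by (cases n) (auto simp: subset_eq)
qed

lemma (in Ionescu_Tulcea) nn_integral_lim_restrict:
  assumes f: "f \<in> borel_measurable (PiM {0..<n} M)"
  shows "(\<integral>\<^sup>+\<omega>. f (restrict \<omega> {0..<n}) \<partial>PF.lim) = (\<integral>\<^sup>+\<omega>. f \<omega> \<partial>C 0 n (\<lambda>_. undefined))"
proof -
  let ?J = "{0..<n}"
  have [simp]: "(\<lambda>_. undefined) \<in> space (PiM {0..<0} M)" by (simp add: space_PiM)
  have s: "sets (C 0 n (\<lambda>_. undefined)) = sets (PiM ?J M)"
    by (subst sets_C) auto
  have "(\<integral>\<^sup>+\<omega>. f (restrict \<omega> ?J) \<partial>PF.lim) = (\<integral>\<^sup>+\<omega>. f \<omega> \<partial>distr PF.lim (PiM ?J M) (\<lambda>\<omega>. restrict \<omega> ?J))"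
  proof (rule nn_integral_distr[symmetric])
    show "(\<lambda>\<omega>. restrict \<omega> ?J) \<in> PF.lim \<rightarrow>\<^sub>M Pi\<^sub>M ?J M"
      unfolding measurable_cong_sets[OF PF.sets_lim refl] by (rule measurable_restrict_subset) simp
  qed (use f in simp)
  also have "\<dots> = (\<integral>\<^sup>+\<omega>. f \<omega> \<partial>distr (C 0 n (\<lambda>_. undefined)) (PiM ?J M) (\<lambda>\<omega>. restrict \<omega> ?J))"
    by (subst distr_lim) (auto simp: CI_def up_to_atLeastLessThan)
  also have "\<dots> = (\<integral>\<^sup>+\<omega>. f (restrict \<omega> ?J) \<partial>C 0 n (\<lambda>_. undefined))"
  proof (rule nn_integral_distr)
    show "(\<lambda>\<omega>. restrict \<omega> ?J) \<in> C 0 n (\<lambda>_. undefined) \<rightarrow>\<^sub>M Pi\<^sub>M ?J M"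
      unfolding measurable_cong_sets[OF s refl] by (rule measurable_restrict_subset) simp
  qed (use f in simp)
  also have "\<dots> = (\<integral>\<^sup>+\<omega>. f \<omega> \<partial>C 0 n (\<lambda>_. undefined))"
    using sets_eq_imp_space_eq[OF s]
    by (intro nn_integral_cong) (auto simp: space_PiM PiE_restrict)
  finally show ?thesis .
qed

text \<open>
  The kernel \<open>P n\<close> is the conditional law of the \<open>n\<close>-th coordinate given
  the previous ones. Only integrals of one coordinate at a time are needed, since the policies are
  compared through the expected costs of the single stages.
\<close>

lemma (in Ionescu_Tulcea) nn_integral_lim_component:
  assumes F: "F \<in> borel_measurable (M n)"
  shows "(\<integral>\<^sup>+\<omega>. F (\<omega> n) \<partial>PF.lim) = (\<integral>\<^sup>+\<omega>. \<integral>\<^sup>+p. F p \<partial>P n (restrict \<omega> {0..<n}) \<partial>PF.lim)"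
proof -
  have u: "(\<lambda>_. undefined) \<in> space (PiM {0..<0} M)" by (simp add: space_PiM)
  have Fn: "(\<lambda>\<omega>. F (\<omega> n)) \<in> borel_measurable (PiM {0..<Suc n} M)"
  proof -
    have "(\<lambda>\<omega>. \<omega> n) \<in> PiM {0..<Suc n} M \<rightarrow>\<^sub>M M n"
      by (rule measurable_component_singleton) simp
    from measurable_compose[OF this F] show ?thesis .
  qed
  have s: "sets (C 0 n (\<lambda>_. undefined)) = sets (PiM {0..<n} M)"
    by (subst sets_C[OF u]) simp
  have "(\<integral>\<^sup>+\<omega>. F (\<omega> n) \<partial>PF.lim) = (\<integral>\<^sup>+\<omega>. F (restrict \<omega> {0..<Suc n} n) \<partial>PF.lim)" by simp
  also have "\<dots> = (\<integral>\<^sup>+\<omega>. F (\<omega> n) \<partial>C 0 (Suc n) (\<lambda>_. undefined))"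
    by (rule nn_integral_lim_restrict[OF Fn])
  also have "\<dots> = (\<integral>\<^sup>+\<omega>. \<integral>\<^sup>+\<omega>'. F (\<omega>' n) \<partial>eP n \<omega> \<partial>C 0 n (\<lambda>_. undefined))"
  proof -
    have "eP n \<in> C 0 n (\<lambda>_. undefined) \<rightarrow>\<^sub>M subprob_algebra (PiM {0..<Suc n} M)"
      unfolding measurable_cong_sets[OF s refl] by (rule measurable_eP)
    then show ?thesis
      by (simp add: nn_integral_bind[OF Fn])
  qed
  also have "\<dots> = (\<integral>\<^sup>+\<omega>. \<integral>\<^sup>+p. F p \<partial>P n \<omega> \<partial>C 0 n (\<lambda>_. undefined))"
    using sets_eq_imp_space_eq[OF s] Fn by (intro nn_integral_cong) (simp add: nn_integral_eP)
  also have "\<dots> = (\<integral>\<^sup>+\<omega>. \<integral>\<^sup>+p. F p \<partial>P n (restrict \<omega> {0..<n}) \<partial>PF.lim)"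
    by (rule nn_integral_lim_restrict[symmetric])
       (rule measurable_compose[OF P nn_integral_measurable_subprob_algebra[OF F]])
  finally show ?thesis .
qed

lemma space_state_borel: "space (state_borel M) = state_space M"
  by (simp add: state_borel_def space_restrict_space)

lemma space_action_borel: "space (action_borel M) = action_space M"
  by (simp add: action_borel_def space_restrict_space)

lemma mem_graph_iff: "(y, a) \<in> graph M \<longleftrightarrow> y \<in> state_space M \<and> a \<in> avail M y"
  by (simp add: Gr_def)

lemma stationary_policy_in_policies:
  assumes M: "is_mdp M" and \<phi>: "stationary M \<phi>"
  shows "stationary_policy M \<phi> \<in> policies M"
  unfolding policies_def
proof (intro CollectI allI conjI ballI, goal_cases)
  case (1 n)
  have "\<phi> \<in> state_borel M \<rightarrow>\<^sub>M action_borel M" using \<phi> by (simp add: stationary_def)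
  from measurable_compose[OF measurable_snd measurable_compose[OF this measurable_return_prob_space]]
  have "(\<lambda>p. return (action_borel M) (\<phi> (snd p)))
      \<in> history_borel M n \<rightarrow>\<^sub>M prob_algebra (action_borel M)"
    unfolding history_borel_def .
  then show ?case
    by (simp add: stationary_policy_def[abs_def] case_prod_beta')
next
  case (2 n p)
  obtain h y where p: "p = (h, y)" by (cases p)
  have "y \<in> state_space M"
    using 2 by (simp add: p history_borel_def space_pair_measure space_state_borel)
  then have "avail M y \<in> sets (action_borel M)" "\<phi> y \<in> avail M y"
    using M \<phi> by (auto simp: is_mdp_def stationary_def)
  then show ?case
    by (simp add: p stationary_policy_def)
qed

locale policy_run =
  fixes M :: "('x::polish_space, 'a::polish_space) mdp" and \<pi> and x
  assumes mdp: "is_mdp M" and policy: "\<pi> \<in> policies M" and init: "x \<in> state_space M"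
begin

sublocale IT: Ionescu_Tulcea "step_kernel M \<pi> x" "\<lambda>_. step_borel M"
  by (rule Ionescu_Tulcea_step_kernel[OF mdp policy init])

abbreviation "\<P> \<equiv> traj_measure M \<pi> x"

lemma traj_eq: "\<P> = IT.PF.lim"
  by (simp add: traj_measure_def)

lemma sets_traj: "sets \<P> = sets (PiM UNIV (\<lambda>_. step_borel M))"
  by (simp add: traj_eq)

lemma space_traj: "space \<P> = space (PiM UNIV (\<lambda>_. step_borel M))"
  by (rule sets_eq_imp_space_eq[OF sets_traj])

lemma prob_space_traj: "prob_space \<P>"
  unfolding traj_eq
proof (rule prob_space_distrD)
  show "(\<lambda>x. restrict x {}) \<in> IT.PF.lim \<rightarrow>\<^sub>M PiM {} (\<lambda>_. step_borel M)"
    unfolding measurable_cong_sets[OF IT.PF.sets_lim refl] by (rule measurable_restrict_subset) simp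
  show "prob_space (distr IT.PF.lim (PiM {} (\<lambda>_. step_borel M)) (\<lambda>x. restrict x {}))"
    by (subst IT.distr_lim) (auto intro: IT.PF.prob_space_P)
qed

lemma measurable_step[measurable]: "(\<lambda>\<omega>. \<omega> n) \<in> \<P> \<rightarrow>\<^sub>M step_borel M"
  unfolding measurable_cong_sets[OF sets_traj refl] by (rule measurable_component_singleton) simp

lemma restrict_history:
  "\<omega> \<in> space \<P> \<Longrightarrow> restrict \<omega> {0..<n} \<in> space (\<Pi>\<^sub>M i\<in>{0..<n}. step_borel M)"
  by (auto simp: space_traj space_PiM)

lemma
  assumes "h \<in> space (\<Pi>\<^sub>M i\<in>{0..<n}. step_borel M)"
  shows sets_next_state: "sets (next_state M x n h) = sets (state_borel M)"
    and space_next_state: "space (next_state M x n h) = state_space M"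
proof -
  show s: "sets (next_state M x n h) = sets (state_borel M)"
    using measurable_space[OF measurable_next_state[OF mdp init] assms] by (simp add: space_prob_algebra)
  show "space (next_state M x n h) = state_space M"
    using sets_eq_imp_space_eq[OF s] by (simp add: space_state_borel)
qed

lemma policy_kernel:
  assumes "h \<in> space (\<Pi>\<^sub>M i\<in>{0..<n}. step_borel M)" "y \<in> state_space M"
  shows "prob_space (\<pi> n (h, y))" "sets (\<pi> n (h, y)) = sets (action_borel M)"
    "space (\<pi> n (h, y)) = action_space M" "emeasure (\<pi> n (h, y)) (avail M y) = 1"
proof -
  have hy: "(h, y) \<in> space (history_borel M n)"
    using assms by (simp add: history_borel_def space_pair_measure space_state_borel)
  have *: "\<pi> n \<in> history_borel M n \<rightarrow>\<^sub>M prob_algebra (action_borel M)"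
    using policy by (simp add: policies_def)
  show "prob_space (\<pi> n (h, y))" and s: "sets (\<pi> n (h, y)) = sets (action_borel M)"
    using measurable_space[OF * hy] by (auto simp: space_prob_algebra)
  show "space (\<pi> n (h, y)) = action_space M"
    using sets_eq_imp_space_eq[OF s] by (simp add: space_action_borel)
  show "emeasure (\<pi> n (h, y)) (avail M y) = 1"
    using policy hy unfolding policies_def by blast
qed

lemma nn_integral_step_kernel:
  assumes h: "h \<in> space (\<Pi>\<^sub>M i\<in>{0..<n}. step_borel M)" and F: "F \<in> borel_measurable (step_borel M)"
  shows "(\<integral>\<^sup>+p. F p \<partial>step_kernel M \<pi> x n h) = (\<integral>\<^sup>+y. \<integral>\<^sup>+a. F (y, a) \<partial>\<pi> n (h, y) \<partial>next_state M x n h)"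
proof -
  let ?H = "\<Pi>\<^sub>M i\<in>{0..<n}. step_borel M"
  have p: "\<pi> n \<in> ?H \<Otimes>\<^sub>M state_borel M \<rightarrow>\<^sub>M prob_algebra (action_borel M)"
    using policy by (simp add: policies_def history_borel_def)
  have "(\<lambda>y. \<pi> n (h, y)) \<in> state_borel M \<rightarrow>\<^sub>M prob_algebra (action_borel M)"
    by (rule measurable_compose[OF _ p]) (rule measurable_Pair1'[OF h])
  moreover have "(\<lambda>(y, a). (y, a)) \<in> state_borel M \<Otimes>\<^sub>M action_borel M \<rightarrow>\<^sub>M step_borel M"
    by (simp add: step_borel_def)
  ultimately have "(\<lambda>y. distr (\<pi> n (h, y)) (step_borel M) (Pair y)) \<in> state_borel M \<rightarrow>\<^sub>M prob_algebra (step_borel M)"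
    by (rule measurable_distr_prob_space2)
  then have "(\<lambda>y. distr (\<pi> n (h, y)) (step_borel M) (Pair y)) \<in> next_state M x n h \<rightarrow>\<^sub>M subprob_algebra (step_borel M)"
    unfolding measurable_cong_sets[OF sets_next_state[OF h] refl] by (rule measurable_prob_algebraD)
  then have "(\<integral>\<^sup>+p. F p \<partial>step_kernel M \<pi> x n h)
      = (\<integral>\<^sup>+y. \<integral>\<^sup>+p. F p \<partial>distr (\<pi> n (h, y)) (step_borel M) (Pair y) \<partial>next_state M x n h)"
    unfolding step_kernel_def by (rule nn_integral_bind[OF F])
  also have "\<dots> = (\<integral>\<^sup>+y. \<integral>\<^sup>+a. F (y, a) \<partial>\<pi> n (h, y) \<partial>next_state M x n h)"
  proof (rule nn_integral_cong)
    fix y assume "y \<in> space (next_state M x n h)"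
    then have y: "y \<in> state_space M" by (simp add: space_next_state[OF h])
    have "Pair y \<in> \<pi> n (h, y) \<rightarrow>\<^sub>M step_borel M"
      unfolding measurable_cong_sets[OF policy_kernel(2)[OF h y] refl] step_borel_def
      using y by (intro measurable_Pair1') (simp add: space_state_borel)
    then show "(\<integral>\<^sup>+p. F p \<partial>distr (\<pi> n (h, y)) (step_borel M) (Pair y)) = (\<integral>\<^sup>+a. F (y, a) \<partial>\<pi> n (h, y))"
      using F by (simp add: nn_integral_distr)
  qed
  finally show ?thesis .
qed

lemma nn_integral_traj_component:
  assumes F: "F \<in> borel_measurable (step_borel M)"
  shows "(\<integral>\<^sup>+\<omega>. F (\<omega> n) \<partial>\<P>) =
    (\<integral>\<^sup>+\<omega>. \<integral>\<^sup>+y. \<integral>\<^sup>+a. F (y, a) \<partial>\<pi> n (restrict \<omega> {0..<n}, y) \<partial>next_state M x n (restrict \<omega> {0..<n}) \<partial>\<P>)"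
proof -
  have "(\<integral>\<^sup>+\<omega>. F (\<omega> n) \<partial>\<P>) = (\<integral>\<^sup>+\<omega>. \<integral>\<^sup>+p. F p \<partial>step_kernel M \<pi> x n (restrict \<omega> {0..<n}) \<partial>\<P>)"
    unfolding traj_eq by (rule IT.nn_integral_lim_component[OF F])
  also have "\<dots> = (\<integral>\<^sup>+\<omega>. \<integral>\<^sup>+y. \<integral>\<^sup>+a. F (y, a) \<partial>\<pi> n (restrict \<omega> {0..<n}, y) \<partial>next_state M x n (restrict \<omega> {0..<n}) \<partial>\<P>)"
    by (intro nn_integral_cong nn_integral_step_kernel[OF restrict_history F])
  finally show ?thesis .
qed

text \<open>
  An almost sure property of the next action, whatever the history, holds almost surely at time
  \<open>n\<close>. It yields that trajectories stay in the graph and that a stationary policy is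
  followed.
\<close>

lemma AE_traj_component:
  assumes N: "Measurable.pred (step_borel M) Q"
    and Q: "\<And>h y. h \<in> space (\<Pi>\<^sub>M i\<in>{0..<n}. step_borel M) \<Longrightarrow> y \<in> state_space M \<Longrightarrow>
      AE a in \<pi> n (h, y). Q (y, a)"
  shows "AE \<omega> in \<P>. Q (\<omega> n)"
proof -
  define F :: "'x \<times> 'a \<Rightarrow> ennreal" where "F p = (if Q p then 0 else 1)" for p
  have F: "F \<in> borel_measurable (step_borel M)"
    using N unfolding F_def[abs_def] by measurable
  have inner: "(\<integral>\<^sup>+y. \<integral>\<^sup>+a. F (y, a) \<partial>\<pi> n (h, y) \<partial>next_state M x n h) = 0"
    if h: "h \<in> space (\<Pi>\<^sub>M i\<in>{0..<n}. step_borel M)" for h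
  proof -
    have "(\<integral>\<^sup>+y. \<integral>\<^sup>+a. F (y, a) \<partial>\<pi> n (h, y) \<partial>next_state M x n h)
        = (\<integral>\<^sup>+y. \<integral>\<^sup>+a. 0 \<partial>\<pi> n (h, y) \<partial>next_state M x n h)"
    proof (rule nn_integral_cong, rule nn_integral_cong_AE)
      fix y assume "y \<in> space (next_state M x n h)"
      then have y: "y \<in> state_space M" by (simp add: space_next_state[OF h])
      show "AE a in \<pi> n (h, y). F (y, a) = 0"
        using Q[OF h y] by eventually_elim (simp add: F_def)
    qed
    then show ?thesis by simp
  qed
  have "(\<integral>\<^sup>+\<omega>. F (\<omega> n) \<partial>\<P>) = (\<integral>\<^sup>+\<omega>. 0 \<partial>\<P>)"
    by (subst nn_integral_traj_component[OF F]) (intro nn_integral_cong inner restrict_history)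
  then have "(\<integral>\<^sup>+\<omega>. F (\<omega> n) \<partial>\<P>) = 0" by simp
  then have "AE \<omega> in \<P>. F (\<omega> n) = 0"
    by (subst (asm) nn_integral_0_iff_AE) (auto intro: measurable_compose[OF measurable_step F])
  then show ?thesis
    by eventually_elim (auto simp: F_def split: if_splits)
qed

lemma AE_traj_graph: "AE \<omega> in \<P>. \<omega> n \<in> graph M"
proof (rule AE_traj_component)
  show "Measurable.pred (step_borel M) (\<lambda>p. p \<in> graph M)"
    using graph_in_step_borel[OF mdp] by (rule pred_sets2[OF _ measurable_ident, unfolded id_def])
  fix h y assume h: "h \<in> space (\<Pi>\<^sub>M i\<in>{0..<n}. step_borel M)" and y: "y \<in> state_space M"
  interpret prob_space "\<pi> n (h, y)" by (rule policy_kernel(1)[OF h y])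
  have "avail M y \<in> events"
    using mdp y by (simp add: is_mdp_def policy_kernel(2)[OF h y])
  then have "AE a in \<pi> n (h, y). a \<in> avail M y"
    using policy_kernel(4)[OF h y] by (simp add: AE_in_set_eq_1 emeasure_eq_measure)
  then show "AE a in \<pi> n (h, y). (y, a) \<in> graph M"
    by eventually_elim (simp add: mem_graph_iff y)
qed

lemma AE_traj_graph_all: "AE \<omega> in \<P>. \<forall>n. \<omega> n \<in> graph M"
  by (simp add: AE_all_countable AE_traj_graph)

lemma nn_integral_traj_state:
  assumes g: "g \<in> borel_measurable (state_borel M)"
  shows "(\<integral>\<^sup>+\<omega>. g (fst (\<omega> n)) \<partial>\<P>) = (\<integral>\<^sup>+\<omega>. \<integral>\<^sup>+y. g y \<partial>next_state M x n (restrict \<omega> {0..<n}) \<partial>\<P>)"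
proof -
  have F: "(\<lambda>p. g (fst p)) \<in> borel_measurable (step_borel M)"
    unfolding step_borel_def by (rule measurable_compose[OF measurable_fst g])
  show ?thesis
    unfolding nn_integral_traj_component[OF F]
  proof (intro nn_integral_cong)
    fix \<omega> y assume \<omega>: "\<omega> \<in> space \<P>" and y: "y \<in> space (next_state M x n (restrict \<omega> {0..<n}))"
    note h = restrict_history[OF \<omega>, of n]
    have y: "y \<in> state_space M" using y by (simp add: space_next_state[OF h])
    interpret prob_space "\<pi> n (restrict \<omega> {0..<n}, y)" by (rule policy_kernel(1)[OF h y])
    show "(\<integral>\<^sup>+a. g (fst (y, a)) \<partial>\<pi> n (restrict \<omega> {0..<n}, y)) = g y"
      by (simp add: emeasure_space_1)
  qed
qed

lemma nn_integral_traj_init: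
  assumes g: "g \<in> borel_measurable (state_borel M)"
  shows "(\<integral>\<^sup>+\<omega>. g (fst (\<omega> 0)) \<partial>\<P>) = g x"
proof -
  interpret prob_space \<P> by (rule prob_space_traj)
  have "(\<integral>\<^sup>+y. g y \<partial>return (state_borel M) x) = g x"
    using init g by (intro nn_integral_return) (auto simp: space_state_borel)
  then show ?thesis
    unfolding nn_integral_traj_state[OF g] by (simp add: next_state_def emeasure_space_1)
qed

text \<open>
  The Markov property in expectation: the step at time \<open>n\<close> is almost surely in the
  graph, where the next state is drawn from the transition kernel.
\<close>

lemma nn_integral_traj_Suc:
  assumes g: "g \<in> borel_measurable (state_borel M)"
  shows "(\<integral>\<^sup>+\<omega>. g (fst (\<omega> (Suc n))) \<partial>\<P>) = (\<integral>\<^sup>+\<omega>. \<integral>\<^sup>+y. g y \<partial>trans_kernel M (\<omega> n) \<partial>\<P>)"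
  unfolding nn_integral_traj_state[OF g]
proof (rule nn_integral_cong_AE)
  show "AE \<omega> in \<P>. (\<integral>\<^sup>+y. g y \<partial>next_state M x (Suc n) (restrict \<omega> {0..<Suc n})) = (\<integral>\<^sup>+y. g y \<partial>trans_kernel M (\<omega> n))"
    using AE_traj_graph[of n] by eventually_elim (simp add: next_state_def)
qed

end

lemma AE_traj_stationary:
  assumes M: "is_mdp M" and \<phi>: "stationary M \<phi>" and x: "x \<in> state_space M"
  shows "AE \<omega> in traj_measure M (stationary_policy M \<phi>) x. snd (\<omega> n) = \<phi> (fst (\<omega> n))"
proof -
  interpret policy_run M "stationary_policy M \<phi>" x
    by standard (fact M stationary_policy_in_policies[OF M \<phi>] x)+
  have \<phi>m: "\<phi> \<in> state_borel M \<rightarrow>\<^sub>M action_borel M" using \<phi> by (simp add: stationary_def)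
  have ab: "(\<lambda>a. a) \<in> action_borel M \<rightarrow>\<^sub>M borel"
    unfolding action_borel_def by (rule measurable_restrict_space1) simp
  have Q: "Measurable.pred (step_borel M) (\<lambda>p. snd p = \<phi> (fst p))"
  proof -
    have "(\<lambda>p. snd p) \<in> step_borel M \<rightarrow>\<^sub>M borel"
      unfolding step_borel_def by (rule measurable_compose[OF measurable_snd ab])
    moreover have "(\<lambda>p. \<phi> (fst p)) \<in> step_borel M \<rightarrow>\<^sub>M borel"
      unfolding step_borel_def by (rule measurable_compose[OF measurable_compose[OF measurable_fst \<phi>m] ab])
    ultimately have "(\<lambda>p. dist (snd p) (\<phi> (fst p))) \<in> borel_measurable (step_borel M)"
      by (rule borel_measurable_dist)
    then have "Measurable.pred (step_borel M) (\<lambda>p. dist (snd p) (\<phi> (fst p)) = 0)" by measurable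
    then show ?thesis by simp
  qed
  show ?thesis
  proof (rule AE_traj_component[OF Q])
    fix h y assume y: "y \<in> state_space M"
    have "\<phi> y \<in> space (action_borel M)"
      using measurable_space[OF \<phi>m, of y] y by (simp add: space_state_borel)
    moreover have "Measurable.pred (action_borel M) (\<lambda>a. snd (y, a) = \<phi> (fst (y, a)))"
    proof -
      have "(\<lambda>a. dist a (\<phi> y)) \<in> borel_measurable (action_borel M)"
        by (rule borel_measurable_dist[OF ab]) simp
      then have "Measurable.pred (action_borel M) (\<lambda>a. dist a (\<phi> y) = 0)" by measurable
      then show ?thesis by simp
    qed
    ultimately show "AE a in stationary_policy M \<phi> n (h, y). snd (y, a) = \<phi> (fst (y, a))"
      unfolding stationary_policy_def case_prod_conv by (subst AE_return) simp_all
  qed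
qed


section \<open>The shifted model\<close>

text \<open>
  A cost with lower bound \<open>K\<close> has the form \<open>shifted K z\<close> with
  \<open>z\<close> in \<^typ>\<open>ennreal\<close>. Discounted sums are then shifted by \<open>K /
  (1 - \<alpha>)\<close> and averages again by \<open>K\<close>.
\<close>

definition shifted :: "real \<Rightarrow> ennreal \<Rightarrow> ereal" where
  "shifted K z = enn2ereal z + ereal K"

lemma shifted_le_iff: "shifted K z \<le> shifted K z' \<longleftrightarrow> z \<le> z'"
  by (cases z; cases z') (auto simp: shifted_def top_unique)

lemma shifted_e2ennreal: "ereal K \<le> y \<Longrightarrow> shifted K (e2ennreal (y - ereal K)) = y"
  unfolding shifted_def by (subst enn2ereal_e2ennreal) (cases y; simp)+

lemma continuous_on_shifted: "continuous_on UNIV (shifted K)"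
  unfolding continuous_on_def shifted_def by (auto intro!: tendsto_add_ereal_general1 tendsto_enn2erealI)

lemma mono_shifted: "mono (shifted K)"
  by (rule monoI) (simp add: shifted_le_iff)

locale wstar_mdp =
  fixes M :: "('x::polish_space, 'a::polish_space) mdp" and K :: real
  assumes mdp: "is_mdp M" and wstar: "assumption_W_star M"
    and cost_ge: "\<And>p. p \<in> graph M \<Longrightarrow> ereal K \<le> cost M p"
begin

abbreviation "X \<equiv> state_space M"
abbreviation "A \<equiv> avail M"
abbreviation "G \<equiv> graph M"

text \<open>
  The nonnegative cost. Off the graph the given cost is arbitrary, possibly not even measurable, so
  it is replaced by \<open>0\<close> there; trajectories almost surely stay in the graph.
\<close>

definition c :: "'x \<times> 'a \<Rightarrow> ennreal" where
  "c p = (if p \<in> G then e2ennreal (cost M p - ereal K) else 0)"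

definition next_exp :: "('x \<Rightarrow> ennreal) \<Rightarrow> 'x \<times> 'a \<Rightarrow> ennreal" where
  "next_exp v p = (if p \<in> G then \<integral>\<^sup>+y. v y \<partial>trans_kernel M p else 0)"

text \<open>
  The value of an action when the continuation is worth \<open>v\<close>. The discount factor is of
  type \<^typ>\<open>ennreal\<close>, and \<open>\<alpha> = 1\<close> gives the right-hand side of
  the average-cost optimality inequality.
\<close>

definition Q :: "ennreal \<Rightarrow> ('x \<Rightarrow> ennreal) \<Rightarrow> 'x \<times> 'a \<Rightarrow> ennreal" where
  "Q \<alpha> v p = c p + \<alpha> * next_exp v p"

lemma cost_eq: "p \<in> G \<Longrightarrow> cost M p = shifted K (c p)"
  using cost_ge[of p] by (simp add: c_def shifted_e2ennreal)

lemma kernel: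
  assumes "p \<in> G"
  shows "prob_space (trans_kernel M p)" "sets (trans_kernel M p) = sets (restrict_space borel X)"
    "space (trans_kernel M p) = X"
proof -
  have "trans_kernel M \<in> restrict_space borel G \<rightarrow>\<^sub>M prob_algebra (state_borel M)"
    using mdp by (simp add: is_mdp_def)
  from measurable_space[OF this, of p] assms
  show "prob_space (trans_kernel M p)" and s: "sets (trans_kernel M p) = sets (restrict_space borel X)"
    by (auto simp: space_prob_algebra space_restrict_space state_borel_def)
  show "space (trans_kernel M p) = X"
    using sets_eq_imp_space_eq[OF s] by (simp add: space_restrict_space)
qed

text \<open>
  Both lower semicontinuity of \<open>next_exp v\<close> and the vanishing discount limit are
  instances.
\<close>

lemma kernel_Fatou:
  assumes p: "p \<in> G" and s: "\<And>n. s n \<in> G" "s \<longlonglongrightarrow> p"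
    and h: "\<And>z. incseq (\<lambda>k. h k z)"
    and le: "\<And>k. eventually (\<lambda>n. \<forall>z\<in>X. h k z \<le> f n z) sequentially"
  shows "next_exp (lower_limit X h) p \<le> liminf (\<lambda>n. next_exp (f n) (s n))"
proof -
  have "(\<integral>\<^sup>+z. lower_limit X h z \<partial>trans_kernel M p) \<le> liminf (\<lambda>n. \<integral>\<^sup>+z. f n z \<partial>trans_kernel M (s n))"
  proof (rule Fatou_weak_convergence[where S=X, OF kernel(1,2)[OF p] kernel(1,2)[OF s(1)] _ h le])
    fix f :: "'x \<Rightarrow> real" assume "continuous_on X f" "bounded (f ` X)"
    moreover have "weakly_continuous_kernel M" using wstar by (simp add: assumption_W_star_def)
    ultimately show "(\<lambda>n. \<integral>z. f z \<partial>trans_kernel M (s n)) \<longlonglongrightarrow> (\<integral>z. f z \<partial>trans_kernel M p)"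
      using p s unfolding weakly_continuous_kernel_def by blast
  qed
  then show ?thesis using p s by (simp add: next_exp_def)
qed

lemma next_exp_cong: "(\<And>y. y \<in> X \<Longrightarrow> v y = v' y) \<Longrightarrow> next_exp v p = next_exp v' p"
  by (auto simp: next_exp_def kernel(3) intro!: nn_integral_cong)

lemma next_exp_mono: "(\<And>y. y \<in> X \<Longrightarrow> v y \<le> v' y) \<Longrightarrow> next_exp v p \<le> next_exp v' p"
  by (auto simp: next_exp_def kernel(3) intro!: nn_integral_mono)

lemma next_exp_lsc_on:
  assumes v: "lsc_on X v"
  shows "lsc_on G (next_exp v)"
  unfolding lsc_on_def
proof (intro ballI allI impI)
  fix p s assume p: "p \<in> G" and s: "\<forall>n. s n \<in> G" "s \<longlonglongrightarrow> p"
  have "next_exp v p = next_exp (lower_limit X (\<lambda>_. v)) p"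
    by (rule next_exp_cong) (simp add: lower_limit_const[OF v])
  also have "\<dots> \<le> liminf (\<lambda>n. next_exp v (s n))"
    by (rule kernel_Fatou[OF p _ s(2)]) (use s in \<open>auto simp: incseq_def\<close>)
  finally show "next_exp v p \<le> liminf (\<lambda>n. next_exp v (s n))" .
qed

lemma c_le_iff: "p \<in> G \<Longrightarrow> c p \<le> b \<longleftrightarrow> cost M p \<le> shifted K b"
  by (simp add: cost_eq shifted_le_iff)

lemma c_lsc_on: "lsc_on G c"
proof (rule lsc_onI_level)
  have l: "lsc_on G (cost M)"
    using wstar by (simp add: assumption_W_star_def lower_semicontinuous_on_iff_lsc_on)
  fix b p s assume p: "p \<in> G" and s: "\<And>n::nat. s n \<in> G" "s \<longlonglongrightarrow> p" and b: "\<And>n. c (s n) \<le> b"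
  show "c p \<le> b"
    unfolding c_le_iff[OF p]
    by (rule lsc_on_level'[OF l p s]) (use b c_le_iff[OF s(1)] in simp)
qed

lemma measurable_on_step_borel:
  fixes f :: "'x \<times> 'a \<Rightarrow> ennreal"
  assumes "f \<in> borel_measurable (restrict_space borel G)" and "\<And>p. p \<notin> G \<Longrightarrow> f p = 0"
  shows "f \<in> borel_measurable (step_borel M)"
proof -
  have "(\<lambda>p. if p \<in> G then f p else 0) \<in> borel_measurable (step_borel M)"
  proof (rule measurable_If_restrict_space_iff[THEN iffD2], goal_cases)
    case 1
    have "{p \<in> space (step_borel M). p \<in> G} = G"
      using sets.sets_into_space[OF graph_in_step_borel[OF mdp]] by auto
    then show ?case using graph_in_step_borel[OF mdp] by simp
  next
    case 2
    have "(\<lambda>p. p) \<in> restrict_space (step_borel M) G \<rightarrow>\<^sub>M restrict_space borel G"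
      by (intro measurable_restrict_space2 measurable_restrict_space1 step_borel_to_borel)
         (auto simp: space_restrict_space)
    from measurable_compose[OF this assms(1)] show ?case by simp
  qed
  also have "(\<lambda>p. if p \<in> G then f p else 0) = f"
    using assms(2) by auto
  finally show ?thesis .
qed

lemma c_measurable: "c \<in> borel_measurable (step_borel M)"
  by (rule measurable_on_step_borel[OF borel_measurable_lsc_on[OF c_lsc_on]]) (simp add: c_def)

lemma next_exp_measurable: "lsc_on X v \<Longrightarrow> next_exp v \<in> borel_measurable (step_borel M)"
  by (rule measurable_on_step_borel[OF borel_measurable_lsc_on[OF next_exp_lsc_on]])
     (simp_all add: next_exp_def)

lemma lsc_on_measurable: "lsc_on X (v :: 'x \<Rightarrow> ennreal) \<Longrightarrow> v \<in> borel_measurable (state_borel M)"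
  unfolding state_borel_def by (rule borel_measurable_lsc_on)

text \<open>
  The compactness part of Assumption (W*), combined with lower semicontinuity of the cost at the
  limit action.
\<close>

lemma c_K_inf_compact: "K_inf_compact X A c"
  unfolding K_inf_compact_def
proof (intro allI impI)
  fix x xs as b
  assume x: "x \<in> X" and s: "\<forall>n::nat. xs n \<in> X \<and> as n \<in> A (xs n) \<and> c (xs n, as n) \<le> b"
    and b: "b < \<infinity>" and lim: "xs \<longlonglongrightarrow> x"
  have in_G: "(xs n, as n) \<in> G" for n using s by (simp add: mem_graph_iff)
  obtain r where "b = ennreal r" "0 \<le> r" using b by (cases b) auto
  then have sb: "shifted K b = ereal (r + K)" by (simp add: shifted_def)
  have "\<forall>n. cost M (xs n, as n) \<le> ereal (r + K)"
    using s in_G by (simp add: c_le_iff sb)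
  then obtain a r where a: "a \<in> A x" "strict_mono r" "(as \<circ> r) \<longlonglongrightarrow> a"
    using wstar x s lim unfolding assumption_W_star_def by (metis (no_types, lifting))
  have "c (x, a) \<le> b"
  proof (rule lsc_on_level'[OF c_lsc_on])
    show "(x, a) \<in> G" using x a by (simp add: mem_graph_iff)
    show "(xs (r n), as (r n)) \<in> G" "c (xs (r n), as (r n)) \<le> b" for n using in_G s by auto
    show "(\<lambda>n. (xs (r n), as (r n))) \<longlonglongrightarrow> (x, a)"
      using LIMSEQ_subseq_LIMSEQ[OF lim a(2)] a(3) by (intro tendsto_Pair) (auto simp: o_def)
  qed
  with a show "\<exists>a\<in>A x. c (x, a) \<le> b \<and> (\<exists>r. strict_mono r \<and> (as \<circ> r) \<longlonglongrightarrow> a)" by blast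
qed

text \<open>
  The summand \<open>g\<close> is nonnegative, so a bound on the sum bounds the cost, which yields
  the limit action; lower semicontinuity of the sum does the rest.
\<close>

lemma K_inf_compact_add_lsc:
  assumes g: "lsc_on G g"
  shows "K_inf_compact X A (\<lambda>p. c p + g p)"
  unfolding K_inf_compact_def
proof (intro allI impI)
  fix x xs as b
  assume x: "x \<in> X" and s: "\<forall>n::nat. xs n \<in> X \<and> as n \<in> A (xs n) \<and> c (xs n, as n) + g (xs n, as n) \<le> b"
    and b: "b < \<infinity>" and lim: "xs \<longlonglongrightarrow> x"
  have in_G: "(xs n, as n) \<in> G" for n using s by (simp add: mem_graph_iff)
  have "c (xs n, as n) \<le> b" for n
    using s by (metis le_iff_add order_trans)
  then obtain a r where a: "a \<in> A x" "strict_mono r" "(as \<circ> r) \<longlonglongrightarrow> a"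
    using K_inf_compactD[OF c_K_inf_compact x, of xs as b] s b lim by blast
  have "c (x, a) + g (x, a) \<le> b"
  proof (rule lsc_on_level'[OF lsc_on_add_ennreal[OF c_lsc_on g]])
    show "(x, a) \<in> G" using x a by (simp add: mem_graph_iff)
    show "(xs (r n), as (r n)) \<in> G" "c (xs (r n), as (r n)) + g (xs (r n), as (r n)) \<le> b" for n using in_G s by auto
    show "(\<lambda>n. (xs (r n), as (r n))) \<longlonglongrightarrow> (x, a)"
      using LIMSEQ_subseq_LIMSEQ[OF lim a(2)] a(3) by (intro tendsto_Pair) (auto simp: o_def)
  qed
  with a show "\<exists>a\<in>A x. c (x, a) + g (x, a) \<le> b \<and> (\<exists>r. strict_mono r \<and> (as \<circ> r) \<longlonglongrightarrow> a)" by blast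
qed

lemma Q_lsc_on: "lsc_on X v \<Longrightarrow> \<alpha> < top \<Longrightarrow> lsc_on G (Q \<alpha> v)"
  unfolding Q_def by (intro lsc_on_add_ennreal lsc_on_cmult_ennreal c_lsc_on next_exp_lsc_on)

lemma Q_K_inf_compact: "lsc_on X v \<Longrightarrow> \<alpha> < top \<Longrightarrow> K_inf_compact X A (Q \<alpha> v)"
  unfolding Q_def by (intro K_inf_compact_add_lsc lsc_on_cmult_ennreal next_exp_lsc_on)

lemma Q_mono: "(\<And>y. y \<in> X \<Longrightarrow> v y \<le> v' y) \<Longrightarrow> Q \<alpha> v p \<le> Q \<alpha> v' p"
  unfolding Q_def by (intro add_mono order_refl mult_left_mono next_exp_mono) auto

lemma stationary_minimizer:
  assumes f: "K_inf_compact X A f"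
  obtains \<phi> where "stationary M \<phi>" "\<And>x. x \<in> X \<Longrightarrow> f (x, \<phi> x) = (INF a\<in>A x. f (x, a))"
proof -
  obtain \<phi>0 where \<phi>0: "stationary M \<phi>0" using mdp by (auto simp: is_mdp_def)
  have "\<phi>0 \<in> restrict_space borel X \<rightarrow>\<^sub>M borel"
    using \<phi>0 measurable_restrict_space2_iff[of \<phi>0 "restrict_space borel X" borel "action_space M"]
    by (simp add: stationary_def state_borel_def action_borel_def)
  then obtain \<phi> where \<phi>: "\<phi> \<in> restrict_space borel X \<rightarrow>\<^sub>M borel"
    "\<And>x. x \<in> X \<Longrightarrow> \<phi> x \<in> A x" "\<And>x. x \<in> X \<Longrightarrow> f (x, \<phi> x) = (INF a\<in>A x. f (x, a))"
    using measurable_minimizer[OF f, of \<phi>0] \<phi>0 by (auto simp: stationary_def)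
  have "A x \<subseteq> action_space M" if "x \<in> X" for x
  proof -
    have "A x \<in> sets (action_borel M)" using mdp that by (simp add: is_mdp_def)
    from sets.sets_into_space[OF this] show ?thesis by (simp add: space_action_borel)
  qed
  then have "stationary M \<phi>"
    using \<phi>(1,2) unfolding stationary_def state_borel_def action_borel_def
    by (auto simp: measurable_restrict_space2_iff space_restrict_space)
  with \<phi>(3) show ?thesis by (rule that[rotated])
qed


section \<open>Costs along trajectories\<close>

definition stage :: "('x, 'a) policy \<Rightarrow> 'x \<Rightarrow> nat \<Rightarrow> ennreal" where
  "stage \<pi> x n = (\<integral>\<^sup>+\<omega>. c (\<omega> n) \<partial>traj_measure M \<pi> x)"

definition state_exp :: "('x, 'a) policy \<Rightarrow> 'x \<Rightarrow> ('x \<Rightarrow> ennreal) \<Rightarrow> nat \<Rightarrow> ennreal" where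
  "state_exp \<pi> x v n = (\<integral>\<^sup>+\<omega>. v (fst (\<omega> n)) \<partial>traj_measure M \<pi> x)"

lemma policy_runI: "\<pi> \<in> policies M \<Longrightarrow> x \<in> X \<Longrightarrow> policy_run M \<pi> x"
  by (simp add: policy_run_def mdp)

lemma state_exp_0: "\<pi> \<in> policies M \<Longrightarrow> x \<in> X \<Longrightarrow> lsc_on X v \<Longrightarrow> state_exp \<pi> x v 0 = v x"
  unfolding state_exp_def by (rule policy_run.nn_integral_traj_init[OF policy_runI lsc_on_measurable])

lemma nn_integral_traj_Q:
  assumes \<pi>: "\<pi> \<in> policies M" and x: "x \<in> X" and v: "lsc_on X v"
  shows "(\<integral>\<^sup>+\<omega>. Q \<alpha> v (\<omega> n) \<partial>traj_measure M \<pi> x) = stage \<pi> x n + \<alpha> * state_exp \<pi> x v (Suc n)"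
proof -
  interpret policy_run M \<pi> x by (rule policy_runI[OF \<pi> x])
  have m: "(\<lambda>\<omega>. c (\<omega> n)) \<in> borel_measurable \<P>" "(\<lambda>\<omega>. next_exp v (\<omega> n)) \<in> borel_measurable \<P>"
    by (rule measurable_compose[OF measurable_step c_measurable]
        measurable_compose[OF measurable_step next_exp_measurable[OF v]])+
  have "(\<integral>\<^sup>+\<omega>. Q \<alpha> v (\<omega> n) \<partial>\<P>) = stage \<pi> x n + \<alpha> * (\<integral>\<^sup>+\<omega>. next_exp v (\<omega> n) \<partial>\<P>)"
    unfolding Q_def stage_def using m by (simp add: nn_integral_add nn_integral_cmult)
  also have "(\<integral>\<^sup>+\<omega>. next_exp v (\<omega> n) \<partial>\<P>) = (\<integral>\<^sup>+\<omega>. \<integral>\<^sup>+y. v y \<partial>trans_kernel M (\<omega> n) \<partial>\<P>)"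
    by (rule nn_integral_cong_AE) (use AE_traj_graph[of n] in \<open>eventually_elim, simp add: next_exp_def\<close>)
  also have "\<dots> = state_exp \<pi> x v (Suc n)"
    unfolding state_exp_def by (rule nn_integral_traj_Suc[OF lsc_on_measurable[OF v], symmetric])
  finally show ?thesis .
qed

lemma state_exp_le_Q:
  assumes \<pi>: "\<pi> \<in> policies M" and x: "x \<in> X" and v: "lsc_on X v"
    and le: "\<And>p. p \<in> G \<Longrightarrow> w (fst p) \<le> Q \<alpha> v p"
  shows "state_exp \<pi> x w n \<le> stage \<pi> x n + \<alpha> * state_exp \<pi> x v (Suc n)"
proof -
  interpret policy_run M \<pi> x by (rule policy_runI[OF \<pi> x])
  show ?thesis
    unfolding nn_integral_traj_Q[OF \<pi> x v, symmetric] state_exp_def[of \<pi> x w]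
    by (rule nn_integral_mono_AE) (use AE_traj_graph[of n] in \<open>eventually_elim, simp add: le\<close>)
qed

text \<open>
  Taking expectations in the hypothesis at each time and telescoping. The case \<open>w = 0\<close>
  bounds discounted costs, the case \<open>\<alpha> = 1\<close> bounds the total cost of
  \<open>N\<close> steps in the average-cost problem.
\<close>

lemma stationary_sum_le:
  assumes \<phi>: "stationary M \<phi>" and x: "x \<in> X" and v: "lsc_on X v" and \<alpha>: "0 \<le> \<alpha>"
    and le: "\<And>y. y \<in> X \<Longrightarrow> Q (ennreal \<alpha>) v (y, \<phi> y) \<le> w + v y"
  shows "(\<Sum>n<N. ennreal (\<alpha> ^ n) * stage (stationary_policy M \<phi>) x n) \<le> v x + w * (\<Sum>n<N. ennreal (\<alpha> ^ n))"
proof -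
  let ?\<pi> = "stationary_policy M \<phi>"
  have \<pi>: "?\<pi> \<in> policies M" by (rule stationary_policy_in_policies[OF mdp \<phi>])
  interpret policy_run M ?\<pi> x by (rule policy_runI[OF \<pi> x])
  have step: "stage ?\<pi> x n + ennreal \<alpha> * state_exp ?\<pi> x v (Suc n) \<le> w + state_exp ?\<pi> x v n" for n
  proof -
    have "(\<lambda>\<omega>. v (fst (\<omega> n))) \<in> borel_measurable \<P>"
      by (rule measurable_compose[OF measurable_step])
         (simp add: step_borel_def measurable_compose[OF measurable_fst lsc_on_measurable[OF v]])
    then have "w + state_exp ?\<pi> x v n = (\<integral>\<^sup>+\<omega>. w + v (fst (\<omega> n)) \<partial>\<P>)"
      unfolding state_exp_def using prob_space.emeasure_space_1[OF prob_space_traj]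
      by (simp add: nn_integral_add)
    moreover have "(\<integral>\<^sup>+\<omega>. Q (ennreal \<alpha>) v (\<omega> n) \<partial>\<P>) \<le> (\<integral>\<^sup>+\<omega>. w + v (fst (\<omega> n)) \<partial>\<P>)"
    proof (rule nn_integral_mono_AE)
      show "AE \<omega> in \<P>. Q (ennreal \<alpha>) v (\<omega> n) \<le> w + v (fst (\<omega> n))"
        using AE_traj_stationary[OF mdp \<phi> x, of n] AE_traj_graph[of n]
      proof eventually_elim
        case (elim \<omega>)
        then have "\<omega> n = (fst (\<omega> n), \<phi> (fst (\<omega> n)))" "fst (\<omega> n) \<in> X"
          by (auto simp: prod_eq_iff Gr_def)
        then show ?case using le[of "fst (\<omega> n)"] by simp
      qed
    qed
    ultimately show ?thesis by (simp add: nn_integral_traj_Q[OF \<pi> x v])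
  qed
  have "(\<Sum>n<N. ennreal (\<alpha> ^ n) * stage ?\<pi> x n) + ennreal (\<alpha> ^ N) * state_exp ?\<pi> x v N
      \<le> v x + w * (\<Sum>n<N. ennreal (\<alpha> ^ n))"
  proof (induction N)
    case 0 then show ?case by (simp add: state_exp_0[OF \<pi> x v])
  next
    case (Suc N)
    have "(\<Sum>n<Suc N. ennreal (\<alpha> ^ n) * stage ?\<pi> x n) + ennreal (\<alpha> ^ Suc N) * state_exp ?\<pi> x v (Suc N)
        = (\<Sum>n<N. ennreal (\<alpha> ^ n) * stage ?\<pi> x n)
          + ennreal (\<alpha> ^ N) * (stage ?\<pi> x N + ennreal \<alpha> * state_exp ?\<pi> x v (Suc N))"
      using \<alpha> by (simp add: distrib_left ennreal_mult mult_ac add_ac)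
    also have "\<dots> \<le> (\<Sum>n<N. ennreal (\<alpha> ^ n) * stage ?\<pi> x n) + ennreal (\<alpha> ^ N) * (w + state_exp ?\<pi> x v N)"
      by (intro add_left_mono mult_left_mono step) simp
    also have "\<dots> = ((\<Sum>n<N. ennreal (\<alpha> ^ n) * stage ?\<pi> x n) + ennreal (\<alpha> ^ N) * state_exp ?\<pi> x v N)
        + w * ennreal (\<alpha> ^ N)"
      by (simp add: distrib_left mult_ac add_ac)
    also have "\<dots> \<le> (v x + w * (\<Sum>n<N. ennreal (\<alpha> ^ n))) + w * ennreal (\<alpha> ^ N)"
      by (intro add_right_mono Suc.IH)
    also have "\<dots> = v x + w * (\<Sum>n<Suc N. ennreal (\<alpha> ^ n))"
      by (simp add: distrib_left add_ac)
    finally show ?case .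
  qed
  then show ?thesis by (rule order_trans[rotated]) simp
qed


section \<open>Value iteration\<close>

primrec value_iter :: "ennreal \<Rightarrow> nat \<Rightarrow> 'x \<Rightarrow> ennreal" where
  "value_iter \<alpha> 0 = (\<lambda>_. 0)"
| "value_iter \<alpha> (Suc n) = (\<lambda>x. INF a\<in>A x. Q \<alpha> (value_iter \<alpha> n) (x, a))"

text \<open>
  The limit of value iteration, which turns out to be the discounted value function when
  \<open>\<alpha>\<close> is a real discount factor.
\<close>

definition V :: "ennreal \<Rightarrow> 'x \<Rightarrow> ennreal" where
  "V \<alpha> x = (SUP n. value_iter \<alpha> n x)"

lemma value_iter_lsc_on: "\<alpha> < top \<Longrightarrow> lsc_on X (value_iter \<alpha> n)"
proof (induction n)
  case 0 show ?case by (simp add: lsc_on_def)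
next
  case (Suc n)
  then show ?case
    using K_inf_compact_min_lsc_on[OF Q_K_inf_compact[OF Suc.IH]] by simp
qed

lemma value_iter_incseq: "incseq (\<lambda>n. value_iter \<alpha> n x)"
proof (rule incseq_SucI)
  fix n show "value_iter \<alpha> n x \<le> value_iter \<alpha> (Suc n) x"
    by (induction n arbitrary: x) (auto simp del: value_iter.simps(2) simp: value_iter.simps(2)[of \<alpha>] intro!: INF_mono' Q_mono)
qed

lemma V_lsc_on: "\<alpha> < top \<Longrightarrow> lsc_on X (V \<alpha>)"
  unfolding V_def[abs_def] by (intro lsc_on_SUP value_iter_lsc_on)

lemma Q_V_eq_SUP:
  assumes "\<alpha> < top"
  shows "Q \<alpha> (V \<alpha>) p = (SUP n. Q \<alpha> (value_iter \<alpha> n) p)"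
proof (cases "p \<in> G")
  case True
  have "value_iter \<alpha> n \<in> borel_measurable (trans_kernel M p)" for n
    unfolding measurable_cong_sets[OF kernel(2)[OF True] refl]
    by (rule borel_measurable_lsc_on[OF value_iter_lsc_on[OF assms]])
  then have "next_exp (V \<alpha>) p = (SUP n. next_exp (value_iter \<alpha> n) p)"
    unfolding next_exp_def V_def[abs_def] using True value_iter_incseq[of \<alpha>]
    by (simp add: nn_integral_monotone_convergence_SUP incseq_def le_fun_def)
  then show ?thesis
    unfolding Q_def by (simp add: SUP_mult_left_ennreal ennreal_SUP_add_right)
qed (simp add: Q_def next_exp_def)

text \<open>
  Minimizing actions \<open>b n\<close> for the iterates stay in a fixed compact set of actions, so
  they subconverge to some \<open>a\<close>. For each fixed \<open>m\<close>, \<open>b n\<close>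
  with \<open>n \<ge> m\<close> is good enough for the \<open>m\<close>-th iterate, hence so is
  \<open>a\<close>; now let \<open>m\<close> tend to infinity by monotone convergence.
\<close>

lemma V_optimality_inequality:
  assumes \<alpha>: "\<alpha> < top" and x: "x \<in> X"
  shows "(INF a\<in>A x. Q \<alpha> (V \<alpha>) (x, a)) \<le> V \<alpha> x"
proof (cases "V \<alpha> x < \<infinity>")
  case True
  have le_V: "value_iter \<alpha> n x \<le> V \<alpha> x" for n
    unfolding V_def by (rule SUP_upper) simp
  have "\<exists>a\<in>A x. Q \<alpha> (value_iter \<alpha> n) (x, a) \<le> V \<alpha> x" for n
    using K_inf_compact_attained[OF Q_K_inf_compact[OF value_iter_lsc_on[OF \<alpha>] \<alpha>] x, of n]
      le_V[of "Suc n"] True by (metis le_less_trans value_iter.simps(2))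
  then obtain b where b: "\<And>n. b n \<in> A x" "\<And>n. Q \<alpha> (value_iter \<alpha> n) (x, b n) \<le> V \<alpha> x" by metis
  have b_le: "Q \<alpha> (value_iter \<alpha> m) (x, b n) \<le> V \<alpha> x" if "m \<le> n" for m n
    using incseqD[OF value_iter_incseq that] by (intro order_trans[OF Q_mono b(2)]) auto
  obtain a r where a: "a \<in> A x" "strict_mono r" "(b \<circ> r) \<longlonglongrightarrow> a"
    by (rule K_inf_compactD[OF Q_K_inf_compact[OF value_iter_lsc_on[OF \<alpha>, of 0] \<alpha>] x, of "\<lambda>_. x" b "V \<alpha> x"])
       (use x b True b_le[of 0] in auto)
  have "Q \<alpha> (value_iter \<alpha> m) (x, a) \<le> V \<alpha> x" for m
  proof (rule lsc_on_level[OF Q_lsc_on[OF value_iter_lsc_on[OF \<alpha>] \<alpha>]])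
    show "(x, a) \<in> G" "(x, b (r n)) \<in> G" for n using x a b by (auto simp: mem_graph_iff)
    show "(\<lambda>n. (x, b (r n))) \<longlonglongrightarrow> (x, a)"
      using a(3) by (intro tendsto_Pair tendsto_const) (simp add: o_def)
    have "eventually (\<lambda>n. Q \<alpha> (value_iter \<alpha> m) (x, b (r n)) \<le> V \<alpha> x) sequentially"
      using eventually_ge_at_top[of m]
      by eventually_elim (use seq_suble[OF a(2)] in \<open>blast intro: b_le le_trans\<close>)
    then show "frequently (\<lambda>n. Q \<alpha> (value_iter \<alpha> m) (x, b (r n)) \<le> V \<alpha> x) sequentially"
      by (intro eventually_frequently) auto
  qed
  then have "Q \<alpha> (V \<alpha>) (x, a) \<le> V \<alpha> x"
    unfolding Q_V_eq_SUP[OF \<alpha>] by (rule SUP_least)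
  with a(1) show ?thesis by (rule INF_lower2)
qed (simp add: not_less top_unique)

text \<open>
  Backward induction over the horizon: the \<open>Suc N\<close>-th iterate is at most the current
  cost plus the discounted \<open>N\<close>-th iterate at the next state, for every action and so
  also on average.
\<close>

lemma value_iter_le_sum:
  assumes \<pi>: "\<pi> \<in> policies M" and x: "x \<in> X" and \<alpha>: "0 \<le> \<alpha>"
  shows "value_iter (ennreal \<alpha>) N x \<le> (\<Sum>n<N. ennreal (\<alpha> ^ n) * stage \<pi> x n)"
proof -
  have "state_exp \<pi> x (value_iter (ennreal \<alpha>) N) k \<le> (\<Sum>n<N. ennreal (\<alpha> ^ n) * stage \<pi> x (k + n))" for k
  proof (induction N arbitrary: k)
    case 0 show ?case by (simp add: state_exp_def)
  next
    case (Suc N)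
    have "state_exp \<pi> x (value_iter (ennreal \<alpha>) (Suc N)) k
        \<le> stage \<pi> x k + ennreal \<alpha> * state_exp \<pi> x (value_iter (ennreal \<alpha>) N) (Suc k)"
      by (rule state_exp_le_Q[OF \<pi> x value_iter_lsc_on]) (auto simp: Gr_def intro: INF_lower)
    also have "\<dots> \<le> stage \<pi> x k + ennreal \<alpha> * (\<Sum>n<N. ennreal (\<alpha> ^ n) * stage \<pi> x (Suc k + n))"
      by (intro add_left_mono mult_left_mono Suc.IH) simp
    also have "\<dots> = (\<Sum>n<Suc N. ennreal (\<alpha> ^ n) * stage \<pi> x (k + n))"
      using \<alpha> unfolding sum.lessThan_Suc_shift
      by (simp add: sum_distrib_left ennreal_mult mult.assoc)
    finally show ?case .
  qed
  from this[of 0] show ?thesis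
    by (simp add: state_exp_0[OF \<pi> x value_iter_lsc_on])
qed

definition discounted :: "real \<Rightarrow> ('x, 'a) policy \<Rightarrow> 'x \<Rightarrow> ennreal" where
  "discounted \<alpha> \<pi> x = (\<Sum>n. ennreal (\<alpha> ^ n) * stage \<pi> x n)"

lemma V_le_discounted:
  assumes "\<pi> \<in> policies M" "x \<in> X" "0 \<le> \<alpha>"
  shows "V (ennreal \<alpha>) x \<le> discounted \<alpha> \<pi> x"
  unfolding V_def discounted_def suminf_eq_SUP by (intro SUP_mono' value_iter_le_sum assms)

lemma discounted_optimal_selector:
  assumes \<alpha>: "0 \<le> \<alpha>"
  obtains \<phi> where "stationary M \<phi>" "\<And>x. x \<in> X \<Longrightarrow> Q (ennreal \<alpha>) (V (ennreal \<alpha>)) (x, \<phi> x) \<le> V (ennreal \<alpha>) x"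
proof -
  obtain \<phi> where \<phi>: "stationary M \<phi>"
    "\<And>x. x \<in> X \<Longrightarrow> Q (ennreal \<alpha>) (V (ennreal \<alpha>)) (x, \<phi> x) = (INF a\<in>A x. Q (ennreal \<alpha>) (V (ennreal \<alpha>)) (x, a))"
    using stationary_minimizer[OF Q_K_inf_compact[OF V_lsc_on, of "ennreal \<alpha>" "ennreal \<alpha>"]] by auto
  with that V_optimality_inequality[of "ennreal \<alpha>"] show ?thesis by simp
qed

text \<open>
  The selector makes the sums over every finite horizon at most \<open>V\<close>, and no policy can
  do better than \<open>V\<close>.
\<close>

lemma discounted_attains_V:
  assumes \<alpha>: "0 \<le> \<alpha>"
  obtains \<phi> where "stationary M \<phi>" "\<And>x. x \<in> X \<Longrightarrow> discounted \<alpha> (stationary_policy M \<phi>) x = V (ennreal \<alpha>) x"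
proof -
  obtain \<phi> where \<phi>: "stationary M \<phi>" "\<And>x. x \<in> X \<Longrightarrow> Q (ennreal \<alpha>) (V (ennreal \<alpha>)) (x, \<phi> x) \<le> V (ennreal \<alpha>) x"
    using discounted_optimal_selector[OF \<alpha>] by metis
  have "discounted \<alpha> (stationary_policy M \<phi>) x \<le> V (ennreal \<alpha>) x" if x: "x \<in> X" for x
    unfolding discounted_def suminf_eq_SUP
    by (rule SUP_least, use stationary_sum_le[OF \<phi>(1) x V_lsc_on[of "ennreal \<alpha>"] \<alpha>, where w=0] \<phi>(2) in simp)
  then show ?thesis
    using V_le_discounted[OF stationary_policy_in_policies[OF mdp \<phi>(1)] _ \<alpha>]
    by (intro that[OF \<phi>(1)] antisym) auto
qed

end


section \<open>The vanishing discount limit\<close>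

context wstar_mdp
begin

definition min_value :: "real \<Rightarrow> ennreal" where
  "min_value \<alpha> = (INF x\<in>X. V (ennreal \<alpha>) x)"

text \<open>
  The relative value function \<open>u\<^sub>\<alpha>\<close> of the theorem: the shift by \<open>K
  / (1 - \<alpha>)\<close> cancels in the difference.
\<close>

definition rel_value :: "real \<Rightarrow> 'x \<Rightarrow> ennreal" where
  "rel_value \<alpha> x = V (ennreal \<alpha>) x - min_value \<alpha>"

text \<open>
  The upper limit \<open>w\<close> of the theorem, diminished by \<open>K\<close>.
\<close>

definition W :: ennreal where
  "W = Limsup (at_left 1) (\<lambda>\<alpha>. ennreal (1 - \<alpha>) * min_value \<alpha>)"

definition discount :: "nat \<Rightarrow> real" where
  "discount k = 1 - inverse (real (Suc k))"

text \<open>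
  Taking infima over all discount factors from \<open>discount k\<close> on makes the sequence
  increasing in \<open>k\<close>, as the lower limit requires.
\<close>

definition rel_value_inf :: "nat \<Rightarrow> 'x \<Rightarrow> ennreal" where
  "rel_value_inf k z = (INF \<alpha>\<in>{discount k..<1}. rel_value \<alpha> z)"

definition u :: "'x \<Rightarrow> ennreal" where
  "u = lower_limit X rel_value_inf"

definition cesaro :: "('x, 'a) policy \<Rightarrow> 'x \<Rightarrow> ennreal" where
  "cesaro \<pi> x = limsup (\<lambda>N. ennreal (1 / real N) * (\<Sum>n<N. stage \<pi> x n))"

lemma discount_mono: "j \<le> k \<Longrightarrow> discount j \<le> discount k"
  by (auto simp: discount_def intro!: le_imp_inverse_le)

lemma discount_bounds: "0 \<le> discount k" "discount k < 1"
  by (auto simp: discount_def inverse_le_1_iff)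

lemma discount_exceeds:
  assumes "\<beta> < 1"
  obtains k where "\<beta> < discount k" "k0 \<le> k"
proof -
  obtain j where j: "inverse (real (Suc j)) < 1 - \<beta>"
    using reals_Archimedean[of "1 - \<beta>"] assms by auto
  then have "\<beta> < discount j" by (simp add: discount_def)
  then have "\<beta> < discount (max j k0)" using discount_mono[of j "max j k0"] by simp
  then show ?thesis by (rule that) simp
qed

lemma rel_value_inf_incseq: "incseq (\<lambda>k. rel_value_inf k z)"
  unfolding rel_value_inf_def by (intro monoI INF_superset_mono) (auto dest: discount_mono)

lemma u_lsc_on: "lsc_on T u"
  unfolding u_def by (rule lower_limit_lsc_on[OF rel_value_inf_incseq])

lemma min_value_le: "y \<in> X \<Longrightarrow> min_value \<alpha> \<le> V (ennreal \<alpha>) y"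
  unfolding min_value_def by (rule INF_lower)

text \<open>
  Writing \<open>V\<close> as \<open>rel_value\<close> plus the constant \<open>min_value\<close> in
  the discounted optimality inequality, \<open>\<alpha> * min_value \<alpha>\<close> cancels and
  \<open>(1 - \<alpha>) * min_value \<alpha>\<close> remains.
\<close>

lemma rel_value_inequality:
  assumes \<alpha>: "0 \<le> \<alpha>" "\<alpha> < 1" and fin: "min_value \<alpha> < \<infinity>" and y: "y \<in> X"
  shows "\<exists>a\<in>A y. c (y, a) + ennreal \<alpha> * next_exp (rel_value \<alpha>) (y, a)
    \<le> rel_value \<alpha> y + ennreal (1 - \<alpha>) * min_value \<alpha>"
proof -
  let ?m = "min_value \<alpha>" and ?V = "V (ennreal \<alpha>)"
  obtain \<phi> where \<phi>: "stationary M \<phi>" "\<And>x. x \<in> X \<Longrightarrow> Q (ennreal \<alpha>) ?V (x, \<phi> x) \<le> ?V x"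
    using discounted_optimal_selector[OF \<alpha>(1)] by metis
  let ?p = "(y, \<phi> y)"
  have a: "\<phi> y \<in> A y" using \<phi>(1) y by (simp add: stationary_def)
  then have p: "?p \<in> G" using y by (simp add: mem_graph_iff)
  have V_eq: "?V z = rel_value \<alpha> z + ?m" if "z \<in> X" for z
    unfolding rel_value_def using min_value_le[OF that] by (simp add: diff_add_cancel_ennreal)
  have "rel_value \<alpha> \<in> borel_measurable (trans_kernel M ?p)"
    unfolding measurable_cong_sets[OF kernel(2)[OF p] refl] rel_value_def[abs_def]
    using borel_measurable_lsc_on[OF V_lsc_on[of "ennreal \<alpha>"]] by measurable
  then have "next_exp (\<lambda>z. rel_value \<alpha> z + ?m) ?p = next_exp (rel_value \<alpha>) ?p + ?m"
    using p prob_space.emeasure_space_1[OF kernel(1)[OF p]]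
    by (simp add: next_exp_def nn_integral_add)
  moreover have "next_exp ?V ?p = next_exp (\<lambda>z. rel_value \<alpha> z + ?m) ?p"
    by (rule next_exp_cong[OF V_eq])
  ultimately have "c ?p + ennreal \<alpha> * (next_exp (rel_value \<alpha>) ?p + ?m) \<le> rel_value \<alpha> y + ?m"
    using \<phi>(2)[OF y] V_eq[OF y] by (simp add: Q_def)
  then have "ennreal \<alpha> * ?m + (c ?p + ennreal \<alpha> * next_exp (rel_value \<alpha>) ?p) \<le> rel_value \<alpha> y + ?m"
    by (simp add: distrib_left add_ac)
  also have "rel_value \<alpha> y + ?m = rel_value \<alpha> y + (ennreal (1 - \<alpha>) * ?m + ennreal \<alpha> * ?m)"
    using \<alpha> by (simp add: distrib_right[symmetric] flip: ennreal_plus)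
  also have "\<dots> = ennreal \<alpha> * ?m + (rel_value \<alpha> y + ennreal (1 - \<alpha>) * ?m)"
    by (simp add: add_ac)
  finally have "ennreal \<alpha> * ?m + (c ?p + ennreal \<alpha> * next_exp (rel_value \<alpha>) ?p)
      \<le> ennreal \<alpha> * ?m + (rel_value \<alpha> y + ennreal (1 - \<alpha>) * ?m)" .
  moreover have "ennreal \<alpha> * ?m \<noteq> \<infinity>"
    using fin by (simp add: ennreal_mult_eq_top_iff)
  ultimately have "c ?p + ennreal \<alpha> * next_exp (rel_value \<alpha>) ?p \<le> rel_value \<alpha> y + ennreal (1 - \<alpha>) * ?m"
    by (simp only: ennreal_add_left_cancel_le) simp
  with a show ?thesis by blast
qed

text \<open>
  Every infimum in the definition of \<open>u x\<close> is below \<open>b2\<close>, and all discount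
  factors close to \<open>1\<close> satisfy the bound by \<open>b1\<close>.
\<close>

lemma near_minimal_pair:
  assumes "W < b1" "u x < b2"
  shows "\<exists>\<alpha> y. discount k \<le> \<alpha> \<and> \<alpha> < 1 \<and> y \<in> X \<and> dist y x < inverse (real (Suc k)) \<and>
    ennreal (1 - \<alpha>) * min_value \<alpha> < b1 \<and> rel_value \<alpha> y < b2"
proof -
  have "\<forall>\<^sub>F \<alpha> in at_left 1. ennreal (1 - \<alpha>) * min_value \<alpha> < b1"
    using assms(1) unfolding W_def by (rule Limsup_lessD)
  then obtain \<beta> where \<beta>: "\<beta> < 1" "\<And>\<alpha>. \<beta> < \<alpha> \<Longrightarrow> \<alpha> < 1 \<Longrightarrow> ennreal (1 - \<alpha>) * min_value \<alpha> < b1"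
    unfolding eventually_at_left_field by auto
  obtain j where j: "\<beta> < discount j" "k \<le> j" using discount_exceeds[OF \<beta>(1)] by metis
  have "(INF z\<in>{z\<in>X. dist z x < inverse (real (Suc j))}. rel_value_inf j z) \<le> u x"
    unfolding u_def lower_limit_def by (rule SUP_upper) simp
  also note assms(2)
  finally obtain y where y: "y \<in> X" "dist y x < inverse (real (Suc j))" "rel_value_inf j y < b2"
    unfolding INF_less_iff by auto
  then obtain \<alpha> where \<alpha>: "discount j \<le> \<alpha>" "\<alpha> < 1" "rel_value \<alpha> y < b2"
    unfolding rel_value_inf_def INF_less_iff by auto
  have "inverse (real (Suc j)) \<le> inverse (real (Suc k))"
    using j(2) by (intro le_imp_inverse_le) auto
  with y(2) have "dist y x < inverse (real (Suc k))" by linarith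
  with y \<alpha> j discount_mono[OF j(2)] \<beta>(2)[of \<alpha>] show ?thesis
    by (intro exI[of _ \<alpha>] exI[of _ y]) auto
qed

lemma Q_u_eq: "Q 1 u p = c p + next_exp u p"
  by (simp add: Q_def)

text \<open>
  The vanishing discount argument. The near-minimal pairs provide states \<open>y k \<rightarrow>
  x\<close> and discount factors \<open>\<alpha> k \<rightarrow> 1\<close> whose right-hand sides in
  \<open>rel_value_inequality\<close> are below \<open>b\<close>, within \<open>e\<close> of
  \<open>W + u x\<close>. The resulting actions have bounded cost, so a subsequence converges, and
  the inequality survives in the limit.
\<close>

lemma average_cost_optimality_inequality:
  assumes x: "x \<in> X" and W: "W < \<infinity>" and ux: "u x < \<infinity>"
  shows "(INF a\<in>A x. Q 1 u (x, a)) \<le> W + u x"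
proof (rule ennreal_le_epsilon)
  fix e :: real assume e: "0 < e"
  define b1 b2 where "b1 = W + ennreal (e/2)" and "b2 = u x + ennreal (e/2)"
  have lt: "W < b1" "u x < b2"
    using W ux e unfolding b1_def b2_def by (cases W; cases "u x"; auto simp: ennreal_less_iff simp flip: ennreal_plus)+
  have "b1 + b2 < \<infinity>" using W ux by (simp add: b1_def b2_def)
  then obtain b where b: "b1 + b2 = ennreal b" "0 \<le> b" by (cases "b1 + b2") auto
  have "\<forall>k. \<exists>\<alpha> y. discount k \<le> \<alpha> \<and> \<alpha> < 1 \<and> y \<in> X \<and> dist y x < inverse (real (Suc k)) \<and>
      ennreal (1 - \<alpha>) * min_value \<alpha> < b1 \<and> rel_value \<alpha> y < b2"
    using near_minimal_pair[OF lt] by blast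
  then obtain \<alpha> y where \<alpha>: "\<And>k. discount k \<le> \<alpha> k" "\<And>k. \<alpha> k < 1"
    and y: "\<And>k. y k \<in> X" "\<And>k. dist (y k) x < inverse (real (Suc k))"
    and less: "\<And>k. ennreal (1 - \<alpha> k) * min_value (\<alpha> k) < b1" "\<And>k. rel_value (\<alpha> k) (y k) < b2"
    by metis
  have \<alpha>0: "0 \<le> \<alpha> k" for k using \<alpha>(1)[of k] discount_bounds(1)[of k] by linarith
  have "min_value (\<alpha> k) < \<infinity>" for k
  proof (rule ccontr)
    assume "\<not> min_value (\<alpha> k) < \<infinity>"
    then have "min_value (\<alpha> k) = top" by (simp add: not_less top_unique)
    with less(1)[of k] \<alpha>(2)[of k] show False by (simp add: ennreal_mult_top)
  qed
  then have "\<exists>a\<in>A (y k). c (y k, a) + ennreal (\<alpha> k) * next_exp (rel_value (\<alpha> k)) (y k, a)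
      \<le> rel_value (\<alpha> k) (y k) + ennreal (1 - \<alpha> k) * min_value (\<alpha> k)" for k
    by (intro rel_value_inequality \<alpha>0 \<alpha>(2) y(1))
  then obtain a where a: "\<And>k. a k \<in> A (y k)"
    and a_le: "\<And>k. c (y k, a k) + ennreal (\<alpha> k) * next_exp (rel_value (\<alpha> k)) (y k, a k)
      \<le> rel_value (\<alpha> k) (y k) + ennreal (1 - \<alpha> k) * min_value (\<alpha> k)"
    by metis
  have bound: "c (y k, a k) + ennreal (\<alpha> k) * next_exp (rel_value (\<alpha> k)) (y k, a k) \<le> ennreal b" for k
    unfolding b(1)[symmetric]
    using a_le[of k] add_mono[OF less_imp_le[OF less(2)[of k]] less_imp_le[OF less(1)[of k]]]
    by (simp add: add.commute)
  have y_lim: "y \<longlonglongrightarrow> x"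
  proof (rule tendsto_dist_iff[THEN iffD2])
    show "(\<lambda>k. dist (y k) x) \<longlonglongrightarrow> 0"
      by (rule real_tendsto_sandwich[OF _ _ tendsto_const LIMSEQ_inverse_real_of_nat])
         (use y(2) in \<open>auto intro!: always_eventually less_imp_le\<close>)
  qed
  have \<alpha>_lim: "\<alpha> \<longlonglongrightarrow> 1"
  proof (rule real_tendsto_sandwich)
    show "discount \<longlonglongrightarrow> 1"
      unfolding discount_def[abs_def]
      using tendsto_diff[OF tendsto_const[of 1] LIMSEQ_inverse_real_of_nat] by simp
    show "(\<lambda>_. 1) \<longlonglongrightarrow> (1::real)" by simp
  qed (use \<alpha> in \<open>auto intro!: always_eventually less_imp_le\<close>)
  have c_le: "c (y k, a k) \<le> ennreal b" for k
    using bound[of k] by (metis le_iff_add order_trans)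
  obtain a' r where a': "a' \<in> A x" "strict_mono r" "(a \<circ> r) \<longlonglongrightarrow> a'"
    by (rule K_inf_compactD[OF c_K_inf_compact x y(1) a c_le _ y_lim]) auto
  let ?p = "\<lambda>n. (y (r n), a (r n))"
  have p: "(x, a') \<in> G" "?p n \<in> G" for n using x a' y a by (auto simp: mem_graph_iff)
  have p_lim: "?p \<longlonglongrightarrow> (x, a')"
    using LIMSEQ_subseq_LIMSEQ[OF y_lim a'(2)] a'(3) by (intro tendsto_Pair) (auto simp: o_def)
  have \<alpha>r_lim: "(\<lambda>n. \<alpha> (r n)) \<longlonglongrightarrow> 1"
    using LIMSEQ_subseq_LIMSEQ[OF \<alpha>_lim a'(2)] by (simp add: o_def)
  have "c (x, a') \<le> liminf (\<lambda>n. c (?p n))"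
    by (rule lsc_onD[OF c_lsc_on p p_lim])
  moreover have "next_exp u (x, a') \<le> liminf (\<lambda>n. next_exp (rel_value (\<alpha> (r n))) (?p n))"
    unfolding u_def
  proof (rule kernel_Fatou[OF p p_lim rel_value_inf_incseq])
    fix k
    show "\<forall>\<^sub>F n in sequentially. \<forall>z\<in>X. rel_value_inf k z \<le> rel_value (\<alpha> (r n)) z"
      using eventually_ge_at_top[of k]
    proof eventually_elim
      case (elim n)
      then have "k \<le> r n" using seq_suble[OF a'(2), of n] by simp
      then have "discount k \<le> \<alpha> (r n)" using \<alpha>(1)[of "r n"] discount_mono[of k "r n"] by linarith
      then show ?case
        unfolding rel_value_inf_def using \<alpha>(2) by (auto intro: INF_lower)
    qed
  qed
  ultimately have "Q 1 u (x, a') \<le> liminf (\<lambda>n. c (?p n)) + liminf (\<lambda>n. next_exp (rel_value (\<alpha> (r n))) (?p n))"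
    unfolding Q_u_eq by (rule add_mono)
  also have "\<dots> \<le> liminf (\<lambda>n. c (?p n) + next_exp (rel_value (\<alpha> (r n))) (?p n))"
    by (rule liminf_add_le_ennreal)
  \<comment> \<open>The factor \<open>\<alpha>\<close> in front of the integral only is moved to the right-hand side: \<open>c + I \<le> (c + \<alpha> * I) / \<alpha>\<close>.\<close>
  also have "\<dots> \<le> liminf (\<lambda>n. ennreal (b / \<alpha> (r n)))"
  proof (rule Liminf_mono)
    have "\<forall>\<^sub>F n in sequentially. 0 < \<alpha> (r n)"
      using \<alpha>r_lim by (rule order_tendstoD) simp
    then show "\<forall>\<^sub>F n in sequentially. c (?p n) + next_exp (rel_value (\<alpha> (r n))) (?p n) \<le> ennreal (b / \<alpha> (r n))"
    proof eventually_elim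
      case (elim n)
      let ?\<alpha> = "\<alpha> (r n)" and ?s = "c (?p n) + next_exp (rel_value (\<alpha> (r n))) (?p n)"
      have "?s = ennreal (1 / ?\<alpha>) * (ennreal ?\<alpha> * ?s)"
        using elim by (simp add: mult.assoc[symmetric] flip: ennreal_mult)
      also have "ennreal ?\<alpha> * ?s \<le> c (?p n) + ennreal ?\<alpha> * next_exp (rel_value ?\<alpha>) (?p n)"
        unfolding distrib_left
        using \<alpha>(2)[of "r n"] mult_right_mono[of "ennreal ?\<alpha>" 1 "c (?p n)"] by (intro add_right_mono) simp
      also have "\<dots> \<le> ennreal b" by (rule bound)
      also have "ennreal (1 / ?\<alpha>) * ennreal b = ennreal (b / ?\<alpha>)"
        using elim b(2) by (simp flip: ennreal_mult)
      finally show ?case by (simp add: mult_left_mono)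
    qed
  qed
  also have "\<dots> = ennreal (b / 1)"
    by (intro lim_imp_Liminf tendsto_intros \<alpha>r_lim) auto
  finally have "(INF a\<in>A x. Q 1 u (x, a)) \<le> ennreal b"
    using a'(1) by (auto intro: INF_lower2)
  also have "ennreal b = W + u x + ennreal e"
  proof -
    have "ennreal e = ennreal (e/2) + ennreal (e/2)" using e by (simp flip: ennreal_plus)
    then show ?thesis unfolding b(1)[symmetric] b1_def b2_def by (simp add: add_ac)
  qed
  finally show "(INF a\<in>A x. Q 1 u (x, a)) \<le> W + u x + ennreal e" .
qed

lemma eventually_at_left_1: "(\<And>\<alpha>. 0 < \<alpha> \<Longrightarrow> \<alpha> < 1 \<Longrightarrow> P \<alpha>) \<Longrightarrow> eventually P (at_left (1::real))"
  unfolding eventually_at_left_field by (rule exI[of _ 0]) auto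

lemma W_le_Limsup_V: "x \<in> X \<Longrightarrow> W \<le> Limsup (at_left 1) (\<lambda>\<alpha>. ennreal (1 - \<alpha>) * V (ennreal \<alpha>) x)"
  unfolding W_def by (intro Limsup_mono always_eventually allI mult_left_mono min_value_le) auto

lemma Limsup_V_le_cesaro:
  assumes "\<pi> \<in> policies M" "x \<in> X"
  shows "Limsup (at_left 1) (\<lambda>\<alpha>. ennreal (1 - \<alpha>) * V (ennreal \<alpha>) x) \<le> cesaro \<pi> x"
proof -
  have "Limsup (at_left 1) (\<lambda>\<alpha>. ennreal (1 - \<alpha>) * V (ennreal \<alpha>) x)
      \<le> Limsup (at_left 1) (\<lambda>\<alpha>. ennreal (1 - \<alpha>) * (\<Sum>n. ennreal (\<alpha> ^ n) * stage \<pi> x n))"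
    using V_le_discounted[OF assms]
    by (intro Limsup_mono eventually_at_left_1 mult_left_mono) (auto simp: discounted_def)
  also have "\<dots> \<le> cesaro \<pi> x"
    unfolding cesaro_def by (rule Limsup_Abel_le_Cesaro)
  finally show ?thesis .
qed

text \<open>
  No policy beats \<open>W\<close>: pass from the average cost to Abel means, then to values, then
  to their infima.
\<close>

lemma W_le_cesaro: "\<pi> \<in> policies M \<Longrightarrow> x \<in> X \<Longrightarrow> W \<le> cesaro \<pi> x"
  by (rule order_trans[OF W_le_Limsup_V Limsup_V_le_cesaro])

text \<open>
  The optimality inequality adds up to the bound \<open>u x + W * N\<close> for \<open>N\<close>
  steps; division by \<open>N\<close> removes the contribution of \<open>u x\<close>.
\<close>

lemma cesaro_le_W:
  assumes \<phi>: "stationary M \<phi>" and le: "\<And>y. y \<in> X \<Longrightarrow> Q 1 u (y, \<phi> y) \<le> W + u y"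
    and x: "x \<in> X" and ux: "u x < \<infinity>"
  shows "cesaro (stationary_policy M \<phi>) x \<le> W"
proof -
  let ?S = "\<lambda>N. \<Sum>n<N. stage (stationary_policy M \<phi>) x n"
  have S: "?S N \<le> u x + W * of_nat N" for N
    using stationary_sum_le[OF \<phi> x u_lsc_on, of 1 W N] le by simp
  have "cesaro (stationary_policy M \<phi>) x \<le> limsup (\<lambda>N. ennreal (1 / real N) * u x + W)"
    unfolding cesaro_def
  proof (rule Limsup_mono)
    show "\<forall>\<^sub>F N in sequentially. ennreal (1 / real N) * ?S N \<le> ennreal (1 / real N) * u x + W"
      using eventually_gt_at_top[of 0]
    proof eventually_elim
      case (elim N)
      have "ennreal (1 / real N) * ?S N \<le> ennreal (1 / real N) * (u x + W * of_nat N)"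
        by (intro mult_left_mono S) simp
      also have "\<dots> = ennreal (1 / real N) * u x + W * (ennreal (1 / real N) * ennreal (real N))"
        by (simp add: distrib_left mult_ac ennreal_of_nat_eq_real_of_nat)
      also have "ennreal (1 / real N) * ennreal (real N) = 1"
        using elim by (simp flip: ennreal_mult)
      finally show ?case by simp
    qed
  qed
  also have "\<dots> = 0 + W"
  proof (intro lim_imp_Limsup tendsto_add tendsto_const)
    obtain t where t: "u x = ennreal t" "0 \<le> t" using ux by (cases "u x") auto
    have "(\<lambda>N. ennreal (1 / real N * t)) \<longlonglongrightarrow> ennreal (0 * t)"
      by (intro tendsto_intros lim_1_over_n)
    then show "(\<lambda>N. ennreal (1 / real N) * u x) \<longlonglongrightarrow> 0"
      using t by (simp add: ennreal_mult[symmetric])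
  qed simp
  finally show ?thesis by simp
qed

text \<open>
  At a state with \<open>u x \<le> b\<close> an optimal action has cost at most \<open>W +
  b\<close>. So the sublevel set lies in the projection of a compact sublevel set of the cost, in
  which it is closed.
\<close>

lemma u_level_compact:
  assumes W: "W < \<infinity>" and u: "\<And>x. x \<in> X \<Longrightarrow> u x < \<infinity>"
    and cpt: "\<And>t. t < \<infinity> \<Longrightarrow> compact {p \<in> G. c p \<le> t}" and b: "b < \<infinity>"
  shows "compact {x \<in> X. u x \<le> b}"
proof -
  let ?P = "fst ` {p \<in> G. c p \<le> W + b}"
  have P: "compact ?P"
    using W b by (intro compact_continuous_image continuous_intros cpt) simp
  have "{x \<in> X. u x \<le> b} = {x \<in> ?P. u x \<le> b}"
  proof (intro set_eqI iffI)
    fix x assume "x \<in> {x \<in> X. u x \<le> b}"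
    then have x: "x \<in> X" "u x \<le> b" by auto
    note le = average_cost_optimality_inequality[OF x(1) W u[OF x(1)]]
    also have "W + u x < \<infinity>" using W u[OF x(1)] by simp
    finally obtain a where a: "a \<in> A x" "Q 1 u (x, a) = (INF a\<in>A x. Q 1 u (x, a))"
      using K_inf_compact_attained[OF Q_K_inf_compact[OF u_lsc_on, of 1] x(1)] by auto
    have "c (x, a) \<le> Q 1 u (x, a)" by (simp add: Q_def)
    also have "\<dots> \<le> W + u x" using a le by simp
    also have "\<dots> \<le> W + b" using x by (intro add_left_mono)
    finally show "x \<in> {x \<in> ?P. u x \<le> b}"
      using x a(1) by (auto simp: mem_graph_iff intro!: image_eqI[of _ fst "(x, a)"])
  qed (auto simp: Gr_def)
  moreover have "closedin (top_of_set ?P) {x \<in> ?P. u x \<le> b}"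
    by (rule closedin_lsc_on_level[OF u_lsc_on])
  ultimately show ?thesis using closedin_compact[OF P] by simp
qed

end


section \<open>Translation to extended-real-valued costs\<close>

text \<open>
  The pointwise identity \<open>balance\<close> between positive and negative parts, arranged so
  that both sides are sums of nonnegative terms, can be integrated regardless of the sign of
  \<open>L\<close> and of infinite values. The negative part is bounded, so the final subtraction is
  harmless.
\<close>

lemma ext_integral_shifted:
  assumes N: "prob_space N" and f: "f \<in> borel_measurable N" and F: "AE x in N. F x = shifted L (f x)"
  shows "ext_integral N F = shifted L (\<integral>\<^sup>+x. f x \<partial>N)"
proof -
  interpret prob_space N by fact
  let ?pos = "\<lambda>x. e2ennreal (shifted L (f x))" and ?neg = "\<lambda>x. e2ennreal (- shifted L (f x))"
  have [measurable]: "f \<in> borel_measurable N" by fact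
  have [measurable]: "?pos \<in> borel_measurable N" "?neg \<in> borel_measurable N"
    unfolding shifted_def by measurable
  \<comment> \<open>Reals are clipped at \<open>0\<close> by \<open>ennreal\<close>, so this covers both signs of \<open>L\<close>.\<close>
  have balance: "?pos x + ennreal (- L) = f x + ennreal L + ?neg x" for x
  proof (cases "f x")
    case (real r)
    then show ?thesis
      by (cases "0 \<le> L"; cases "0 \<le> r + L")
         (auto simp: shifted_def ennreal_neg simp flip: ennreal_plus)
  qed (auto simp: shifted_def)
  have "integral\<^sup>N N ?pos + ennreal (- L) = (\<integral>\<^sup>+x. ?pos x + ennreal (- L) \<partial>N)"
    by (simp add: nn_integral_add emeasure_space_1)
  also have "\<dots> = integral\<^sup>N N f + ennreal L + integral\<^sup>N N ?neg"
    unfolding balance by (simp add: nn_integral_add emeasure_space_1)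
  finally have eq: "integral\<^sup>N N ?pos + ennreal (- L) = integral\<^sup>N N f + ennreal L + integral\<^sup>N N ?neg" .
  have "integral\<^sup>N N ?neg \<le> (\<integral>\<^sup>+x. ennreal (- L) \<partial>N)"
  proof (rule nn_integral_mono)
    fix x
    have "- shifted L (f x) \<le> ereal (- L)" by (cases "f x") (auto simp: shifted_def)
    from e2ennreal_mono[OF this] show "?neg x \<le> ennreal (- L)" by simp
  qed
  then have "integral\<^sup>N N ?neg \<le> ennreal (- L)" by (simp add: emeasure_space_1)
  then obtain n where n: "integral\<^sup>N N ?neg = ennreal n" "0 \<le> n"
    by (cases "integral\<^sup>N N ?neg") (auto simp: top_unique)
  have "ext_integral N F = enn2ereal (integral\<^sup>N N ?pos) - enn2ereal (integral\<^sup>N N ?neg)"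
  proof -
    have "(\<integral>\<^sup>+x. e2ennreal (F x) \<partial>N) = integral\<^sup>N N ?pos"
      by (rule nn_integral_cong_AE) (use F in eventually_elim, simp)
    moreover have "(\<integral>\<^sup>+x. e2ennreal (- F x) \<partial>N) = integral\<^sup>N N ?neg"
      by (rule nn_integral_cong_AE) (use F in eventually_elim, simp)
    ultimately show ?thesis by (simp add: ext_integral_def)
  qed
  also have "\<dots> = shifted L (integral\<^sup>N N f)"
  proof (cases "integral\<^sup>N N f")
    case top
    then have "integral\<^sup>N N ?pos = top"
      using eq by (cases "integral\<^sup>N N ?pos") (auto simp flip: ennreal_plus)
    then show ?thesis using top n by (simp add: shifted_def)
  next
    case (real r)
    then have "integral\<^sup>N N ?pos \<noteq> top"
      using eq n by (metis ennreal_add_eq_top ennreal_neq_top)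
    then obtain p where p: "integral\<^sup>N N ?pos = ennreal p" "0 \<le> p"
      by (cases "integral\<^sup>N N ?pos") auto
    have "ennreal (p + max 0 (- L)) = ennreal (r + max 0 L + n)"
    proof -
      have "ennreal (max 0 t) = ennreal t" for t by (simp add: max_def ennreal_neg)
      then show ?thesis using eq real p n by (simp add: ennreal_plus)
    qed
    then have "p + max 0 (- L) = r + max 0 L + n"
      using p n real by (subst (asm) ennreal_inj) auto
    then have "p - n = r + L" by (auto simp: max_def split: if_splits)
    then show ?thesis using p n real by (simp add: shifted_def)
  qed
  finally show ?thesis .
qed

lemma shifted_0: "shifted 0 z = enn2ereal z"
  by (simp add: shifted_def zero_ereal_def[symmetric])

lemma shifted_add_scaled: "0 \<le> r \<Longrightarrow> shifted L z + ereal r * shifted K z' = shifted (L + K * r) (z + ennreal r * z')"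
  by (cases z; cases z'; cases "r = 0")
     (auto simp: shifted_def algebra_simps ennreal_mult_top simp flip: ennreal_plus ennreal_mult zero_ereal_def)

lemma shifted_scaled: "0 \<le> r \<Longrightarrow> ereal r * shifted K z = shifted (r * K) (ennreal r * z)"
  by (cases z; cases "r = 0")
     (auto simp: shifted_def algebra_simps ennreal_mult_top zero_ennreal.rep_eq simp flip: ennreal_mult zero_ereal_def)

lemma shifted_diff: "z' \<le> z \<Longrightarrow> shifted L z - shifted L z' = enn2ereal (z - z')"
  by (cases z; cases z') (auto simp: shifted_def ennreal_minus ennreal_top_minus top_unique)

lemma shifted_add: "shifted K z + enn2ereal z' = shifted K (z + z')"
  by (cases z; cases z') (auto simp: shifted_def algebra_simps simp flip: ennreal_plus)

lemma shifted_eq_iff: "shifted K z = shifted K z' \<longleftrightarrow> z = z'"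
  by (simp add: eq_iff shifted_le_iff)

lemma shifted_less_top: "shifted K z < \<infinity> \<longleftrightarrow> z < \<infinity>"
  by (cases z) (auto simp: shifted_def)

lemma shifted_INF: "I \<noteq> {} \<Longrightarrow> (INF i\<in>I. shifted K (f i)) = shifted K (INF i\<in>I. f i)"
  using continuous_at_Inf_mono[OF mono_shifted, of "f ` I" K] continuous_on_shifted[of K]
  by (simp add: image_comp o_def continuous_on_eq_continuous_within continuous_at_imp_continuous_within)

lemma Limsup_shifted: "F \<noteq> bot \<Longrightarrow> Limsup F (\<lambda>x. shifted K (f x)) = shifted K (Limsup F f)"
  by (rule Limsup_compose_continuous_mono[OF continuous_on_shifted mono_shifted])

context wstar_mdp
begin

lemma sum_cost_eq:
  assumes "\<forall>n. \<omega> n \<in> G" "0 \<le> \<alpha>"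
  shows "(\<Sum>n<N. ereal (\<alpha> ^ n) * cost M (\<omega> n)) = shifted (K * (\<Sum>n<N. \<alpha> ^ n)) (\<Sum>n<N. ennreal (\<alpha> ^ n) * c (\<omega> n))"
proof (induction N)
  case 0 show ?case by (simp add: shifted_0 zero_ennreal.rep_eq)
next
  case (Suc N)
  then show ?case using assms
    by (simp add: cost_eq shifted_add_scaled distrib_left)
qed

lemma suminf_cost_eq:
  assumes \<omega>: "\<forall>n. \<omega> n \<in> G" and \<alpha>: "0 \<le> \<alpha>" "\<alpha> < 1"
  shows "(\<Sum>n. ereal (\<alpha> ^ n) * cost M (\<omega> n)) = shifted (K / (1 - \<alpha>)) (\<Sum>n. ennreal (\<alpha> ^ n) * c (\<omega> n))"
proof -
  have "(\<lambda>N. \<Sum>n<N. \<alpha> ^ n) \<longlonglongrightarrow> 1 / (1 - \<alpha>)"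
    using geometric_sums[of \<alpha>] \<alpha> by (simp add: sums_def)
  then have "(\<lambda>N. ereal (K * (\<Sum>n<N. \<alpha> ^ n))) \<longlonglongrightarrow> ereal (K * (1 / (1 - \<alpha>)))"
    by (intro tendsto_intros)
  moreover have "(\<lambda>N. \<Sum>n<N. ennreal (\<alpha> ^ n) * c (\<omega> n)) \<longlonglongrightarrow> (\<Sum>n. ennreal (\<alpha> ^ n) * c (\<omega> n))"
    by (rule summable_LIMSEQ) simp
  then have "(\<lambda>N. enn2ereal (\<Sum>n<N. ennreal (\<alpha> ^ n) * c (\<omega> n))) \<longlonglongrightarrow> enn2ereal (\<Sum>n. ennreal (\<alpha> ^ n) * c (\<omega> n))"
    by (rule tendsto_enn2erealI)
  ultimately have "(\<lambda>N. enn2ereal (\<Sum>n<N. ennreal (\<alpha> ^ n) * c (\<omega> n)) + ereal (K * (\<Sum>n<N. \<alpha> ^ n)))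
      \<longlonglongrightarrow> enn2ereal (\<Sum>n. ennreal (\<alpha> ^ n) * c (\<omega> n)) + ereal (K * (1 / (1 - \<alpha>)))"
    by (intro tendsto_add_ereal_general1) auto
  then have "(\<lambda>n. ereal (\<alpha> ^ n) * cost M (\<omega> n)) sums shifted (K / (1 - \<alpha>)) (\<Sum>n. ennreal (\<alpha> ^ n) * c (\<omega> n))"
    unfolding sums_def sum_cost_eq[OF \<omega> \<alpha>(1)] by (simp add: shifted_def)
  then show ?thesis by (rule sums_unique[symmetric])
qed

lemma measurable_stage:
  assumes "\<pi> \<in> policies M" "x \<in> X"
  shows "(\<lambda>\<omega>. c (\<omega> n)) \<in> borel_measurable (traj_measure M \<pi> x)"
  by (rule measurable_compose[OF policy_run.measurable_step[OF policy_runI[OF assms]] c_measurable])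

lemma finite_cost_eq:
  assumes \<pi>: "\<pi> \<in> policies M" "x \<in> X"
  shows "finite_cost M N 1 \<pi> x = shifted (K * N) (\<Sum>n<N. stage \<pi> x n)"
proof -
  interpret policy_run M \<pi> x by (rule policy_runI[OF \<pi>])
  note [measurable] = measurable_stage[OF \<pi>]
  have "finite_cost M N 1 \<pi> x = shifted (K * N) (\<integral>\<^sup>+\<omega>. (\<Sum>n<N. c (\<omega> n)) \<partial>\<P>)"
    unfolding finite_cost_def
  proof (rule ext_integral_shifted[OF prob_space_traj])
    show "AE \<omega> in \<P>. (\<Sum>n<N. ereal (1 ^ n) * cost M (\<omega> n)) = shifted (K * N) (\<Sum>n<N. c (\<omega> n))"
      using AE_traj_graph_all by eventually_elim (use sum_cost_eq[where \<alpha>=1] in simp)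
  qed measurable
  then show ?thesis by (simp add: nn_integral_sum stage_def)
qed

lemma discounted_cost_eq:
  assumes \<pi>: "\<pi> \<in> policies M" "x \<in> X" and \<alpha>: "0 \<le> \<alpha>" "\<alpha> < 1"
  shows "discounted_cost M \<alpha> \<pi> x = shifted (K / (1 - \<alpha>)) (discounted \<alpha> \<pi> x)"
proof -
  interpret policy_run M \<pi> x by (rule policy_runI[OF \<pi>])
  note [measurable] = measurable_stage[OF \<pi>]
  have "discounted_cost M \<alpha> \<pi> x = shifted (K / (1 - \<alpha>)) (\<integral>\<^sup>+\<omega>. (\<Sum>n. ennreal (\<alpha> ^ n) * c (\<omega> n)) \<partial>\<P>)"
    unfolding discounted_cost_def
  proof (rule ext_integral_shifted[OF prob_space_traj])
    show "AE \<omega> in \<P>. (\<Sum>n. ereal (\<alpha> ^ n) * cost M (\<omega> n)) = shifted (K / (1 - \<alpha>)) (\<Sum>n. ennreal (\<alpha> ^ n) * c (\<omega> n))"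
      using AE_traj_graph_all by eventually_elim (rule suminf_cost_eq[OF _ \<alpha>])
  qed measurable
  then show ?thesis by (simp add: nn_integral_suminf nn_integral_cmult stage_def discounted_def)
qed

lemma average_cost_eq:
  assumes \<pi>: "\<pi> \<in> policies M" "x \<in> X"
  shows "average_cost M \<pi> x = shifted K (cesaro \<pi> x)"
proof -
  have "average_cost M \<pi> x = limsup (\<lambda>N. shifted K (ennreal (1 / real N) * (\<Sum>n<N. stage \<pi> x n)))"
    unfolding average_cost_def
  proof (rule Limsup_eq)
    show "\<forall>\<^sub>F N in sequentially. ereal (1 / real N) * finite_cost M N 1 \<pi> x
        = shifted K (ennreal (1 / real N) * (\<Sum>n<N. stage \<pi> x n))"
      using eventually_gt_at_top[of 0]
      by eventually_elim (simp only: finite_cost_eq[OF \<pi>], subst shifted_scaled, auto)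
  qed
  then show ?thesis by (simp add: Limsup_shifted cesaro_def)
qed

lemma policies_nonempty: "policies M \<noteq> {}"
  using mdp stationary_policy_in_policies[OF mdp] by (auto simp: is_mdp_def)

lemma opt_discounted_eq:
  assumes x: "x \<in> X" and \<alpha>: "0 \<le> \<alpha>" "\<alpha> < 1"
  shows "opt_discounted M \<alpha> x = shifted (K / (1 - \<alpha>)) (V (ennreal \<alpha>) x)"
proof -
  have "opt_discounted M \<alpha> x = (INF \<pi>\<in>policies M. shifted (K / (1 - \<alpha>)) (discounted \<alpha> \<pi> x))"
    unfolding opt_discounted_def using discounted_cost_eq[OF _ x \<alpha>] by (intro INF_cong) auto
  also have "\<dots> = shifted (K / (1 - \<alpha>)) (INF \<pi>\<in>policies M. discounted \<alpha> \<pi> x)"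
    by (rule shifted_INF[OF policies_nonempty])
  also have "(INF \<pi>\<in>policies M. discounted \<alpha> \<pi> x) = V (ennreal \<alpha>) x"
  proof (rule antisym)
    obtain \<phi> where "stationary M \<phi>" "discounted \<alpha> (stationary_policy M \<phi>) x = V (ennreal \<alpha>) x"
      using discounted_attains_V[OF \<alpha>(1)] x by metis
    then show "(INF \<pi>\<in>policies M. discounted \<alpha> \<pi> x) \<le> V (ennreal \<alpha>) x"
      using stationary_policy_in_policies[OF mdp] by (metis INF_lower)
  qed (intro INF_greatest V_le_discounted x \<alpha>(1))
  finally show ?thesis .
qed

lemma m_disc_eq:
  assumes "X \<noteq> {}" and \<alpha>: "0 \<le> \<alpha>" "\<alpha> < 1"
  shows "m_disc M \<alpha> = shifted (K / (1 - \<alpha>)) (min_value \<alpha>)"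
proof -
  have "m_disc M \<alpha> = (INF x\<in>X. shifted (K / (1 - \<alpha>)) (V (ennreal \<alpha>) x))"
    unfolding m_disc_def using opt_discounted_eq[OF _ \<alpha>] by (intro INF_cong) auto
  then show ?thesis by (simp add: shifted_INF[OF assms(1)] min_value_def)
qed

lemma u_disc_eq:
  assumes "x \<in> X" "0 \<le> \<alpha>" "\<alpha> < 1"
  shows "u_disc M \<alpha> x = enn2ereal (rel_value \<alpha> x)"
proof -
  have "m_disc M \<alpha> = shifted (K / (1 - \<alpha>)) (min_value \<alpha>)"
    using assms by (intro m_disc_eq) auto
  then show ?thesis
    using opt_discounted_eq[OF assms] min_value_le[OF assms(1)]
    by (simp add: u_disc_def rel_value_def shifted_diff)
qed

lemma w_upper_eq:
  assumes "X \<noteq> {}"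
  shows "w_upper M = shifted K W"
proof -
  have "w_upper M = Limsup (at_left 1) (\<lambda>\<alpha>. shifted K (ennreal (1 - \<alpha>) * min_value \<alpha>))"
    unfolding w_upper_def
    by (intro Limsup_eq eventually_at_left_1) (subst m_disc_eq[OF assms], auto simp: shifted_scaled)
  then show ?thesis by (simp add: Limsup_shifted W_def)
qed

lemma Limsup_opt_discounted_eq:
  assumes "x \<in> X"
  shows "Limsup (at_left 1) (\<lambda>\<alpha>. ereal (1 - \<alpha>) * opt_discounted M \<alpha> x)
    = shifted K (Limsup (at_left 1) (\<lambda>\<alpha>. ennreal (1 - \<alpha>) * V (ennreal \<alpha>) x))"
proof -
  have "Limsup (at_left 1) (\<lambda>\<alpha>. ereal (1 - \<alpha>) * opt_discounted M \<alpha> x)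
      = Limsup (at_left 1) (\<lambda>\<alpha>. shifted K (ennreal (1 - \<alpha>) * V (ennreal \<alpha>) x))"
    by (intro Limsup_eq eventually_at_left_1) (subst opt_discounted_eq[OF assms], auto simp: shifted_scaled)
  then show ?thesis by (simp add: Limsup_shifted)
qed

text \<open>
  The pairs \<open>(discount k, 1/(k+1))\<close> are cofinal among all pairs \<open>(\<beta>,
  R)\<close>.
\<close>

lemma u_lim_eq: "u_lim M x = enn2ereal (u x)"
proof (rule antisym)
  show "u_lim M x \<le> enn2ereal (u x)"
    unfolding u_lim_def
  proof (rule SUP_least, clarify)
    fix \<beta> R :: real assume \<beta>: "\<beta> \<in> {0..<1}" and R: "0 < R"
    obtain k0 where k0: "inverse (real (Suc k0)) < R" using reals_Archimedean[OF R] by auto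
    obtain k where k: "\<beta> < discount k" "k0 \<le> k" using discount_exceeds[of \<beta>] \<beta> by auto
    have "inverse (real (Suc k)) \<le> inverse (real (Suc k0))"
      using k(2) by (intro le_imp_inverse_le) auto
    with k0 have kR: "inverse (real (Suc k)) < R" by linarith
    let ?I = "INF (\<alpha>, y)\<in>{\<beta>..<1} \<times> {y \<in> X. dist y x < R}. u_disc M \<alpha> y"
    have "e2ennreal ?I \<le> (INF z\<in>{z\<in>X. dist z x < inverse (real (Suc k))}. rel_value_inf k z)"
      unfolding rel_value_inf_def
    proof (intro INF_greatest)
      fix z \<alpha> assume z: "z \<in> {z\<in>X. dist z x < inverse (real (Suc k))}" and \<alpha>: "\<alpha> \<in> {discount k..<1}"
      have "?I \<le> u_disc M \<alpha> z"
        using z \<alpha> k kR by (intro INF_lower2[of "(\<alpha>, z)"]) auto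
      also have "\<dots> = enn2ereal (rel_value \<alpha> z)"
        using z \<alpha> k \<beta> by (intro u_disc_eq) auto
      finally have "?I \<le> enn2ereal (rel_value \<alpha> z)" .
      from e2ennreal_mono[OF this] show "e2ennreal ?I \<le> rel_value \<alpha> z"
        by (simp only: e2ennreal_enn2ereal)
    qed
    also have "\<dots> \<le> u x"
      unfolding u_def lower_limit_def by (rule SUP_upper) simp
    finally have "enn2ereal (e2ennreal ?I) \<le> enn2ereal (u x)"
      by (simp only: less_eq_ennreal.rep_eq)
    moreover have "i \<le> enn2ereal (e2ennreal i)" for i
      by (cases "0 \<le> i") (auto simp: enn2ereal_e2ennreal intro: order_trans[of _ 0])
    ultimately show "?I \<le> enn2ereal (u x)"
      by (rule order_trans[rotated])
  qed
  have "u x \<le> e2ennreal (u_lim M x)"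
    unfolding u_def lower_limit_def
  proof (rule SUP_least)
    fix k
    let ?Y = "INF z\<in>{z\<in>X. dist z x < inverse (real (Suc k))}. rel_value_inf k z"
    have "enn2ereal ?Y \<le> (INF (\<alpha>, y)\<in>{discount k..<1} \<times> {y \<in> X. dist y x < inverse (real (Suc k))}. u_disc M \<alpha> y)"
    proof (rule INF_greatest, clarify)
      fix \<alpha> y assume \<alpha>: "\<alpha> \<in> {discount k..<1}" and y: "y \<in> X" "dist y x < inverse (real (Suc k))"
      have "?Y \<le> rel_value \<alpha> y"
        unfolding rel_value_inf_def using \<alpha> y by (intro INF_lower2[of y] INF_lower2[of \<alpha>]) auto
      moreover have "u_disc M \<alpha> y = enn2ereal (rel_value \<alpha> y)"
        using \<alpha> y discount_bounds(1)[of k] by (intro u_disc_eq) auto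
      ultimately show "enn2ereal ?Y \<le> u_disc M \<alpha> y" by (simp add: less_eq_ennreal.rep_eq)
    qed
    also have "\<dots> \<le> u_lim M x"
      unfolding u_lim_def
      using discount_bounds[of k] by (intro SUP_upper2[of "(discount k, inverse (real (Suc k)))"]) auto
    finally have "enn2ereal ?Y \<le> u_lim M x" .
    from e2ennreal_mono[OF this] show "?Y \<le> e2ennreal (u_lim M x)" by simp
  qed
  then have le: "enn2ereal (u x) \<le> enn2ereal (e2ennreal (u_lim M x))"
    by (simp add: less_eq_ennreal.rep_eq)
  show "enn2ereal (u x) \<le> u_lim M x"
  proof (cases "0 \<le> u_lim M x")
    case True then show ?thesis using le by (simp add: enn2ereal_e2ennreal)
  next
    case False
    have "(0::ereal) \<le> (INF (\<alpha>, y)\<in>{0..<1} \<times> {y \<in> X. dist y x < 1}. u_disc M \<alpha> y)"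
      by (rule INF_greatest) (auto simp: u_disc_eq)
    also have "\<dots> \<le> u_lim M x"
      unfolding u_lim_def by (intro SUP_upper2[of "(0, 1)"]) auto
    finally show ?thesis using False by simp
  qed
qed

text \<open>
  Restricting the infima to \<open>y = x\<close> shows that \<open>u x\<close> is at most the lower
  limit of \<open>u_disc M \<alpha> x\<close>.
\<close>

lemma u_finite:
  assumes x: "x \<in> X" and B: "Liminf (at_left 1) (\<lambda>\<alpha>. u_disc M \<alpha> x) < \<infinity>"
  shows "u x < \<infinity>"
proof -
  have "u_lim M x \<le> Liminf (at_left 1) (\<lambda>\<alpha>. u_disc M \<alpha> x)"
    unfolding u_lim_def
  proof (rule SUP_least, clarify, rule Liminf_bounded)
    fix \<beta> R :: real assume "\<beta> \<in> {0..<1}" "0 < R"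
    then show "\<forall>\<^sub>F \<alpha> in at_left 1. (INF (\<alpha>, y)\<in>{\<beta>..<1} \<times> {y \<in> X. dist y x < R}. u_disc M \<alpha> y) \<le> u_disc M \<alpha> x"
      unfolding eventually_at_left_field
    proof (intro exI[of _ \<beta>] conjI allI impI)
      fix \<alpha> assume "\<beta> < \<alpha>" "\<alpha> < 1"
      then show "(INF (\<alpha>, y)\<in>{\<beta>..<1} \<times> {y \<in> X. dist y x < R}. u_disc M \<alpha> y) \<le> u_disc M \<alpha> x"
        using x \<open>0 < R\<close> by (intro INF_lower2[of "(\<alpha>, x)"]) auto
    qed simp
  qed
  also note B
  finally show ?thesis by (simp add: u_lim_eq less_top)
qed

lemma W_finite:
  assumes "w_star M < \<infinity>"
  shows "W < \<infinity>" "X \<noteq> {}"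
proof -
  obtain x where x: "x \<in> X" "opt_average M x < \<infinity>"
    using assms unfolding w_star_def INF_less_iff by auto
  then obtain \<pi> where \<pi>: "\<pi> \<in> policies M" "average_cost M \<pi> x < \<infinity>"
    unfolding opt_average_def INF_less_iff by auto
  have "cesaro \<pi> x < \<infinity>"
    using \<pi>(2) by (simp only: average_cost_eq[OF \<pi>(1) x(1)] shifted_less_top)
  then show "W < \<infinity>" using W_le_cesaro[OF \<pi>(1) x(1)] by (rule le_less_trans[rotated])
  show "X \<noteq> {}" using x by auto
qed

lemma acoi_rhs_eq:
  assumes x: "x \<in> X" and a: "a \<in> A x"
  shows "acoi_rhs M x a = shifted K (Q 1 u (x, a))"
proof -
  have p: "(x, a) \<in> G" using x a by (simp add: mem_graph_iff)
  have "ext_integral (trans_kernel M (x, a)) (u_lim M) = shifted 0 (\<integral>\<^sup>+y. u y \<partial>trans_kernel M (x, a))"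
  proof (rule ext_integral_shifted[OF kernel(1)[OF p]])
    show "u \<in> borel_measurable (trans_kernel M (x, a))"
      unfolding measurable_cong_sets[OF kernel(2)[OF p] refl] by (rule borel_measurable_lsc_on[OF u_lsc_on])
  qed (simp add: shifted_0 u_lim_eq)
  then show ?thesis
    unfolding acoi_rhs_def cost_eq[OF p] Q_u_eq using p
    by (simp add: shifted_0 next_exp_def shifted_add)
qed

lemma A_upper_eq:
  assumes x: "x \<in> X"
  shows "A_upper M x = {a \<in> A x. Q 1 u (x, a) \<le> W + u x}"
proof -
  have "w_upper M + u_lim M x = shifted K (W + u x)"
    using x by (subst w_upper_eq) (auto simp: u_lim_eq shifted_add)
  then show ?thesis
    unfolding A_upper_def by (auto simp: acoi_rhs_eq[OF x] shifted_le_iff)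
qed

lemma A_lower_eq:
  assumes x: "x \<in> X"
  shows "A_lower M x = {a \<in> A x. Q 1 u (x, a) = (INF b\<in>A x. Q 1 u (x, b))}"
proof -
  have "A x \<noteq> {}" using mdp x by (simp add: is_mdp_def)
  then have "(INF b\<in>A x. acoi_rhs M x b) = shifted K (INF b\<in>A x. Q 1 u (x, b))"
    using acoi_rhs_eq[OF x] by (simp flip: shifted_INF cong: INF_cong)
  then show ?thesis
    unfolding A_lower_def by (auto simp: acoi_rhs_eq[OF x] shifted_eq_iff)
qed

lemma Gr_A_upper_measurable:
  "Gr X (A_upper M) \<in> sets (restrict_space borel (X \<times> action_space M))"
proof -
  have XA: "X \<times> action_space M \<in> sets borel"
    using mdp by (auto simp: is_mdp_def intro!: borel_Times)
  have G: "G \<in> sets (restrict_space borel (X \<times> action_space M))" using mdp by (simp add: is_mdp_def)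
  then have Gb: "G \<in> sets borel" "G \<subseteq> X \<times> action_space M"
    using XA by (auto simp: sets_restrict_space)
  have "u \<in> borel_measurable borel"
    using borel_measurable_lsc_on[OF u_lsc_on[of UNIV]]
    by (simp add: measurable_cong_sets[OF sets_restrict_UNIV refl])
  moreover have "(fst :: 'x \<times> 'a \<Rightarrow> 'x) \<in> borel \<rightarrow>\<^sub>M borel"
    by (intro borel_measurable_continuous_onI continuous_intros)
  ultimately have "(\<lambda>p :: 'x \<times> 'a. u (fst p)) \<in> borel_measurable borel"
    by (rule measurable_compose[rotated])
  then have "(\<lambda>p. u (fst p)) \<in> borel_measurable (restrict_space borel G)"
    by (rule measurable_restrict_space1)
  moreover have "Q 1 u \<in> borel_measurable (restrict_space borel G)"
    by (rule borel_measurable_lsc_on[OF Q_lsc_on[OF u_lsc_on]]) simp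
  ultimately have "{p \<in> space (restrict_space borel G). Q 1 u p \<le> W + u (fst p)} \<in> sets (restrict_space borel G)"
    by measurable
  moreover have "{p \<in> space (restrict_space borel G). Q 1 u p \<le> W + u (fst p)} = Gr X (A_upper M)"
    by (auto simp: space_restrict_space Gr_def A_upper_eq)
  ultimately have "Gr X (A_upper M) \<in> sets (restrict_space borel G)" by simp
  then have "Gr X (A_upper M) \<in> sets borel" "Gr X (A_upper M) \<subseteq> G"
    using Gb(1) by (auto simp: sets_restrict_space)
  then show ?thesis
    using Gb(2) XA by (auto simp: sets_restrict_space_iff)
qed

text \<open>
  Membership in \<open>A_upper\<close> is the optimality inequality, so the average cost is at most
  \<open>W\<close>, and no policy does better.
\<close>

lemma stationary_in_A_upper_optimal:
  assumes W: "W < \<infinity>" and u: "\<And>x. x \<in> X \<Longrightarrow> u x < \<infinity>"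
    and \<phi>: "stationary M \<phi>" "\<And>x. x \<in> X \<Longrightarrow> \<phi> x \<in> A_upper M x" and x: "x \<in> X"
  shows "average_cost M (stationary_policy M \<phi>) x = shifted K W"
proof -
  have "cesaro (stationary_policy M \<phi>) x \<le> W"
    using \<phi>(2) by (intro cesaro_le_W \<phi>(1) x u) (auto simp: A_upper_eq)
  then have "cesaro (stationary_policy M \<phi>) x = W"
    using W_le_cesaro[OF stationary_policy_in_policies[OF mdp \<phi>(1)] x] by (rule antisym)
  then show ?thesis
    by (simp add: average_cost_eq[OF stationary_policy_in_policies[OF mdp \<phi>(1)] x])
qed

end

theorem theorem5p2:
  fixes M :: "('x::polish_space, 'a::polish_space) mdp"
  assumes "is_mdp M" and "assumption_W_star M" and "assumption_B M"
  shows
    "(\<exists>\<phi>. stationary M \<phi> \<and> acoi M \<phi> \<and>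
        average_optimal M (stationary_policy M \<phi>) \<and>
        (\<forall>x\<in>state_space M.
           opt_average M x = average_cost M (stationary_policy M \<phi>) x \<and>
           average_cost M (stationary_policy M \<phi>) x
             = Limsup (at_left 1) (\<lambda>\<alpha>. ereal (1 - \<alpha>) * opt_discounted M \<alpha> x) \<and>
           Limsup (at_left 1) (\<lambda>\<alpha>. ereal (1 - \<alpha>) * opt_discounted M \<alpha> x) = w_upper M \<and>
           w_upper M = w_star M)) \<and>
     (\<forall>x\<in>state_space M. 0 \<le> u_lim M x \<and> u_lim M x < \<infinity>) \<and>
     lower_semicontinuous_on (state_space M) (u_lim M) \<and>
     (\<forall>x\<in>state_space M. A_upper M x \<noteq> {}) \<and>
     Gr (state_space M) (A_upper M)
       \<in> sets (restrict_space borel (state_space M \<times> action_space M)) \<and>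
     (\<forall>x\<in>state_space M. compact (A_upper M x)) \<and>
     (\<forall>\<phi>. stationary M \<phi> \<longrightarrow> (\<forall>x\<in>state_space M. \<phi> x \<in> A_upper M x) \<longrightarrow>
        average_optimal M (stationary_policy M \<phi>) \<and> acoi M \<phi>) \<and>
     (\<exists>\<phi>. stationary M \<phi> \<and>
        (\<forall>x\<in>state_space M. \<phi> x \<in> A_lower M x \<and> A_lower M x \<subseteq> A_upper M x)) \<and>
     (assumption_Wu M \<longrightarrow> inf_compact_on (state_space M) (u_lim M))"
proof -
  obtain K :: real where K: "\<And>p. p \<in> graph M \<Longrightarrow> ereal K \<le> cost M p"
    using assms(1) by (auto simp: is_mdp_def bounded_below_on_def)
  interpret wstar_mdp M K
    by standard (fact assms(1), fact assms(2), fact K)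
  have W: "W < \<infinity>" and ne: "X \<noteq> {}"
    using W_finite assms(3) by (auto simp: assumption_B_def)
  have u: "u x < \<infinity>" if "x \<in> X" for x
    using assms(3) that unfolding assumption_B_def by (blast intro: u_finite)
  have Wu: "W + u x < \<infinity>" if "x \<in> X" for x
    using W u[OF that] by simp
  note acoi_min = average_cost_optimality_inequality[OF _ W u]

  have sub: "A_lower M x \<subseteq> A_upper M x" if x: "x \<in> X" for x
    using acoi_min[OF x x] by (auto simp: A_upper_eq[OF x] A_lower_eq[OF x])
  obtain \<phi> where \<phi>: "stationary M \<phi>" "\<And>x. x \<in> X \<Longrightarrow> Q 1 u (x, \<phi> x) = (INF a\<in>A x. Q 1 u (x, a))"
    using stationary_minimizer[OF Q_K_inf_compact[OF u_lsc_on, of 1]] by auto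
  have \<phi>_lower: "\<phi> x \<in> A_lower M x" if x: "x \<in> X" for x
    using \<phi> x by (auto simp: A_lower_eq[OF x] stationary_def)
  have \<phi>_upper: "\<phi> x \<in> A_upper M x" if x: "x \<in> X" for x
    using \<phi>_lower[OF x] sub[OF x] by auto

  note w_upper = w_upper_eq[OF ne]
  have opt_avg: "opt_average M x = w_upper M" if x: "x \<in> X" for x
  proof (rule antisym)
    have "opt_average M x \<le> average_cost M (stationary_policy M \<phi>) x"
      unfolding opt_average_def by (rule INF_lower[OF stationary_policy_in_policies[OF mdp \<phi>(1)]])
    also have "\<dots> = w_upper M"
      unfolding w_upper by (rule stationary_in_A_upper_optimal[OF W u \<phi>(1) \<phi>_upper x])
    finally show "opt_average M x \<le> w_upper M" .
    show "w_upper M \<le> opt_average M x"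
      unfolding opt_average_def w_upper
      using W_le_cesaro[OF _ x] by (intro INF_greatest) (auto simp: average_cost_eq[OF _ x] shifted_le_iff)
  qed
  have w_star: "w_upper M = w_star M"
    unfolding w_star_def using opt_avg ne by simp
  have abel: "Limsup (at_left 1) (\<lambda>\<alpha>. ereal (1 - \<alpha>) * opt_discounted M \<alpha> x) = w_upper M" if x: "x \<in> X" for x
  proof -
    have "cesaro (stationary_policy M \<phi>) x = W"
      using stationary_in_A_upper_optimal[OF W u \<phi>(1) \<phi>_upper x]
        average_cost_eq[OF stationary_policy_in_policies[OF mdp \<phi>(1)] x] by (simp add: shifted_eq_iff)
    then have "Limsup (at_left 1) (\<lambda>\<alpha>. ennreal (1 - \<alpha>) * V (ennreal \<alpha>) x) = W"
      using W_le_Limsup_V[OF x] Limsup_V_le_cesaro[OF stationary_policy_in_policies[OF mdp \<phi>(1)] x]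
      by (intro antisym) auto
    then show ?thesis by (simp add: Limsup_opt_discounted_eq[OF x] w_upper)
  qed
  have optimal: "average_optimal M (stationary_policy M \<psi>)" and acoi: "acoi M \<psi>"
    if \<psi>: "stationary M \<psi>" "\<And>x. x \<in> X \<Longrightarrow> \<psi> x \<in> A_upper M x" for \<psi>
  proof -
    show "average_optimal M (stationary_policy M \<psi>)"
      unfolding average_optimal_def
      using stationary_in_A_upper_optimal[OF W u \<psi>] opt_avg w_upper by auto
    show "acoi M \<psi>"
      using \<psi>(2) by (auto simp: acoi_def A_upper_def)
  qed
  have avg: "opt_average M x = average_cost M (stationary_policy M \<phi>) x" if "x \<in> X" for x
    using optimal[OF \<phi>(1) \<phi>_upper] that by (simp add: average_optimal_def)

  have inf_compact: "inf_compact_on X (u_lim M)" if "assumption_Wu M"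
    unfolding inf_compact_on_def
  proof
    fix l :: real
    have c_compact: "compact {p \<in> G. c p \<le> t}" if t: "t < \<infinity>" for t
    proof -
      obtain r where "t = ennreal r" "0 \<le> r" using t by (cases t) auto
      then have "shifted K t = ereal (r + K)" by (simp add: shifted_def)
      then have "{p \<in> G. c p \<le> t} = {p \<in> G. cost M p \<le> ereal (r + K)}"
        using c_le_iff[of _ t] by auto
      then show ?thesis
        using \<open>assumption_Wu M\<close> by (simp add: assumption_Wu_def inf_compact_on_def)
    qed
    show "compact {y \<in> X. u_lim M y \<le> ereal l}"
    proof (cases "0 \<le> l")
      case True
      then have "{y \<in> X. u_lim M y \<le> ereal l} = {y \<in> X. u y \<le> ennreal l}"
        by (auto simp: u_lim_eq less_eq_ennreal.rep_eq)
      then show ?thesis using u_level_compact[OF W u c_compact, of "ennreal l"] by simp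
    next
      case False
      have "\<not> u_lim M y \<le> ereal l" for y
        using False enn2ereal_nonneg[of "u y"] unfolding u_lim_eq
        by (metis ereal_less_eq(5) order_trans)
      then have "{y \<in> X. u_lim M y \<le> ereal l} = {}" by blast
      then show ?thesis by (simp only: compact_empty)
    qed
  qed
  have lsc: "lower_semicontinuous_on X (u_lim M)"
    unfolding lower_semicontinuous_on_iff_lsc_on
  proof (rule lsc_onI_level)
    fix b p s
    assume p: "p \<in> X" and s: "\<And>n::nat. s n \<in> X" "s \<longlonglongrightarrow> p" and b: "\<And>n. u_lim M (s n) \<le> b"
    have "u (s n) \<le> e2ennreal b" for n
      using e2ennreal_mono[OF b[of n]] by (simp add: u_lim_eq)
    then have "u p \<le> e2ennreal b" by (rule lsc_on_level'[OF u_lsc_on p s])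
    moreover have "0 \<le> b" using b[of 0] enn2ereal_nonneg[of "u (s 0)"] unfolding u_lim_eq by (rule order_trans[rotated])
    ultimately show "u_lim M p \<le> b"
      by (simp add: u_lim_eq less_eq_ennreal.rep_eq enn2ereal_e2ennreal)
  qed
  have upper_compact: "compact (A_upper M x)" if x: "x \<in> X" for x
    unfolding A_upper_eq[OF x]
    by (rule K_inf_compact_level_compact[OF Q_K_inf_compact[OF u_lsc_on] x Wu[OF x]]) simp
  show ?thesis
  proof (intro conjI)
    show "\<exists>\<phi>. stationary M \<phi> \<and> acoi M \<phi> \<and> average_optimal M (stationary_policy M \<phi>) \<and>
        (\<forall>x\<in>X. opt_average M x = average_cost M (stationary_policy M \<phi>) x \<and>
           average_cost M (stationary_policy M \<phi>) x
             = Limsup (at_left 1) (\<lambda>\<alpha>. ereal (1 - \<alpha>) * opt_discounted M \<alpha> x) \<and>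
           Limsup (at_left 1) (\<lambda>\<alpha>. ereal (1 - \<alpha>) * opt_discounted M \<alpha> x) = w_upper M \<and>
           w_upper M = w_star M)"
      using \<phi>(1) acoi[OF \<phi>(1) \<phi>_upper] optimal[OF \<phi>(1) \<phi>_upper] avg abel opt_avg w_star
      by (intro exI[of _ \<phi>]) simp
    show "\<forall>x\<in>X. 0 \<le> u_lim M x \<and> u_lim M x < \<infinity>"
      using u by (simp add: u_lim_eq less_top)
    show "\<forall>x\<in>X. A_upper M x \<noteq> {}" using \<phi>_upper by blast
    show "\<forall>\<phi>. stationary M \<phi> \<longrightarrow> (\<forall>x\<in>X. \<phi> x \<in> A_upper M x) \<longrightarrow>
        average_optimal M (stationary_policy M \<phi>) \<and> acoi M \<phi>"
      using optimal acoi by blast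
    show "\<exists>\<phi>. stationary M \<phi> \<and> (\<forall>x\<in>X. \<phi> x \<in> A_lower M x \<and> A_lower M x \<subseteq> A_upper M x)"
      using \<phi>(1) \<phi>_lower sub by blast
  qed (use lsc Gr_A_upper_measurable upper_compact inf_compact in auto)
qed

end
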